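(* Let $X(\mathbb{R})$ be a separable Banach function space such that the Hardy-Littlewood maximal operator $M$ is bounded on $X(\mathbb{R})$ and on its associate space $X'(\mathbb{R})$. Suppose that $\psi$ is an orthonormal differentiable wavelet such that $\psi$ and $\psi'$ have a common radial decreasing $L^1$-majorant $W$ satisfying $\int_0^\infty sW(s)\,ds<\infty$. Then for every $\varepsilon\in\mathcal{E}$ the operator $T_{K_\varepsilon}$, defined initially on $C_0^\infty(\mathbb{R})$, extends to a bounded linear operator on $X(\mathbb{R})$, and \[ \sup_{\varepsilon\in\mathcal{E}}\|T_{K_\varepsilon}\|_{\mathcal{B}(X(\mathbb{R}))}<\infty. \]
   Context: A Banach function norm is a map $\rho$ from nonnegative measurable functions on $\mathbb{R}$ to $[0,\infty]$ that is a norm-like functional ($\rho(f)=0\iff f=0$ a.e., positive homogeneous, subadditive), has the lattice property, the Fatou property ($0\le f_n\uparrow f$ a.e. implies $\rho(f_n)\uparrow\rho(f)$), satisfies $\rho(\chi_E)<\infty$ and $\int_E f\,dx\le C_E\rho(f)$ for every measurable $E$ with $|E|<\infty$. $X(\mathbb{R})$ is the set of measurable $f$ with $\|f\|_{X(\mathbb{R})}:=\rho(|f|)<\infty$; the associate space $X'(\mathbb{R})$ is given by $\rho'(g)=\sup\{\int fg: f\ge0,\ \rho(f)\le1\}$. $M$ is the Hardy-Littlewood maximal operator $(Mf)(x)=\sup_{Q\ni x}\frac1{|Q|}\int_Q|f|$ over bounded intervals $Q\ni x$. A function $\psi\in L^2(\mathbb{R})$ is an orthonormal wavelet if $\psi_{j,k}(x)=2^{j/2}\psi(2^jx-k)$,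 $j,k\in\mathbb{Z}$, form an orthonormal basis of $L^2(\mathbb{R})$. $W:[0,\infty)\to(0,\infty)$ is a radial decreasing $L^1$-majorant of $g$ if $|g(x)|\le W(|x|)$ a.e., $W\in L^1([0,\infty))$, $W$ decreasing, $W(0)<\infty$. $\mathcal{E}$ is the set of sequences $\varepsilon=\{\varepsilon_{j,k}\}_{j,k\in\mathbb{Z}}$ with $\varepsilon_{j,k}\in\{-1,1\}$, and $T_{K_\varepsilon}f=\sum_{j,k\in\mathbb{Z}}\varepsilon_{j,k}\langle f,\psi_{j,k}\rangle\psi_{j,k}$, where $\langle f,g\rangle=\int_\mathbb{R} f\overline g\,dx$. *)

theory Defs
  imports "HOL-Analysis.Analysis"
begin

definition banach_function_norm :: "((real \<Rightarrow> ennreal) \<Rightarrow> ennreal) \<Rightarrow> bool" where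
  "banach_function_norm \<rho> \<longleftrightarrow>
     (\<forall>f \<in> borel_measurable lebesgue. \<rho> f = 0 \<longleftrightarrow> (AE x in lebesgue. f x = 0))
   \<and> (\<forall>f \<in> borel_measurable lebesgue. \<forall>a::real. a \<ge> 0 \<longrightarrow>
        \<rho> (\<lambda>x. ennreal a * f x) = ennreal a * \<rho> f)
   \<and> (\<forall>f \<in> borel_measurable lebesgue. \<forall>g \<in> borel_measurable lebesgue.
        \<rho> (\<lambda>x. f x + g x) \<le> \<rho> f + \<rho> g)
   \<and> (\<forall>f \<in> borel_measurable lebesgue. \<forall>g \<in> borel_measurable lebesgue.
        (AE x in lebesgue. g x \<le> f x) \<longrightarrow> \<rho> g \<le> \<rho> f)
   \<and> (\<forall>(fs :: nat \<Rightarrow> real \<Rightarrow> ennreal) F. (\<forall>n. fs n \<in> borel_measurable lebesgue)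
        \<and> F \<in> borel_measurable lebesgue
        \<and> (AE x in lebesgue. incseq (\<lambda>n. fs n x) \<and> (\<lambda>n. fs n x) \<longlonglongrightarrow> F x)
        \<longrightarrow> incseq (\<lambda>n. \<rho> (fs n)) \<and> (\<lambda>n. \<rho> (fs n)) \<longlonglongrightarrow> \<rho> F)
   \<and> (\<forall>E \<in> sets lebesgue. emeasure lebesgue E < \<infinity> \<longrightarrow>
        \<rho> (indicator E) < \<infinity>
        \<and> (\<exists>C::real. \<forall>f \<in> borel_measurable lebesgue.
              (\<integral>\<^sup>+ x\<in>E. f x \<partial>lebesgue) \<le> ennreal C * \<rho> f))"

definition inX :: "((real \<Rightarrow> ennreal) \<Rightarrow> ennreal) \<Rightarrow> (real \<Rightarrow> complex) \<Rightarrow> bool" where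
  "inX \<rho> f \<longleftrightarrow> f \<in> borel_measurable lebesgue \<and> \<rho> (\<lambda>x. ennreal (cmod (f x))) < \<infinity>"

definition normX :: "((real \<Rightarrow> ennreal) \<Rightarrow> ennreal) \<Rightarrow> (real \<Rightarrow> complex) \<Rightarrow> real" where
  "normX \<rho> f = enn2real (\<rho> (\<lambda>x. ennreal (cmod (f x))))"

definition assoc_norm :: "((real \<Rightarrow> ennreal) \<Rightarrow> ennreal) \<Rightarrow> (real \<Rightarrow> ennreal) \<Rightarrow> ennreal" where
  "assoc_norm \<rho> g = (SUP f \<in> {f \<in> borel_measurable lebesgue. \<rho> f \<le> 1}.
                        \<integral>\<^sup>+ x. f x * g x \<partial>lebesgue)"

definition X_separable :: "((real \<Rightarrow> ennreal) \<Rightarrow> ennreal) \<Rightarrow> bool" where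
  "X_separable \<rho> \<longleftrightarrow> (\<exists>D. countable D \<and> (\<forall>d\<in>D. inX \<rho> d) \<and>
      (\<forall>f. inX \<rho> f \<longrightarrow> (\<forall>e>0. \<exists>d\<in>D. normX \<rho> (\<lambda>x. f x - d x) < e)))"

definition maximal_op :: "(real \<Rightarrow> ennreal) \<Rightarrow> real \<Rightarrow> ennreal" where
  "maximal_op f x = (SUP Q \<in> {{a..b} | a b. a < b \<and> x \<in> {a..b}}.
                       (\<integral>\<^sup>+ t\<in>Q. f t \<partial>lebesgue) / emeasure lebesgue Q)"

definition maximal_bounded :: "((real \<Rightarrow> ennreal) \<Rightarrow> ennreal) \<Rightarrow> bool" where
  "maximal_bounded \<rho> \<longleftrightarrow> (\<exists>C::real. \<forall>f::real \<Rightarrow> complex. inX \<rho> f \<longrightarrow>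
      \<rho> (maximal_op (\<lambda>x. ennreal (cmod (f x)))) \<le> ennreal C * \<rho> (\<lambda>x. ennreal (cmod (f x))))"

definition in_L2 :: "(real \<Rightarrow> complex) \<Rightarrow> bool" where
  "in_L2 f \<longleftrightarrow> f \<in> borel_measurable lebesgue \<and>
     (\<integral>\<^sup>+ x. ennreal ((cmod (f x))\<^sup>2) \<partial>lebesgue) < \<infinity>"

definition l2_inner :: "(real \<Rightarrow> complex) \<Rightarrow> (real \<Rightarrow> complex) \<Rightarrow> complex" where
  "l2_inner f g = (LINT x|lebesgue. f x * cnj (g x))"

definition wav :: "(real \<Rightarrow> complex) \<Rightarrow> int \<Rightarrow> int \<Rightarrow> real \<Rightarrow> complex" where
  "wav \<psi> j k x = complex_of_real (2 powr (real_of_int j / 2)) *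
                   \<psi> (2 powr (real_of_int j) * x - real_of_int k)"

definition orthonormal_wavelet :: "(real \<Rightarrow> complex) \<Rightarrow> bool" where
  "orthonormal_wavelet \<psi> \<longleftrightarrow> in_L2 \<psi>
    \<and> (\<forall>j k j' k'. l2_inner (wav \<psi> j k) (wav \<psi> j' k') = (if (j, k) = (j', k') then 1 else 0))
    \<and> (\<forall>f. in_L2 f \<and> (\<forall>j k. l2_inner f (wav \<psi> j k) = 0) \<longrightarrow> (AE x in lebesgue. f x = 0))"

definition radial_decr_L1_majorant :: "(real \<Rightarrow> real) \<Rightarrow> (real \<Rightarrow> complex) \<Rightarrow> bool" where
  "radial_decr_L1_majorant W g \<longleftrightarrow>
     (AE x in lebesgue. cmod (g x) \<le> W \<bar>x\<bar>)
   \<and> set_integrable lborel {0..} W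
   \<and> (\<forall>s t. 0 \<le> s \<and> s \<le> t \<longrightarrow> W t \<le> W s)
   \<and> (\<forall>s \<ge> 0. W s > 0)"

definition smooth_compact :: "(real \<Rightarrow> complex) \<Rightarrow> bool" where
  "smooth_compact f \<longleftrightarrow>
     (\<exists>D :: nat \<Rightarrow> real \<Rightarrow> complex. D 0 = f \<and>
        (\<forall>n x. (D n has_vector_derivative D (Suc n) x) (at x)))
   \<and> (\<exists>R. \<forall>x. R < \<bar>x\<bar> \<longrightarrow> f x = 0)"

definition sign_seqs :: "(int \<times> int \<Rightarrow> real) set" where
  "sign_seqs = {\<epsilon>. \<forall>jk. \<epsilon> jk \<in> {-1, 1}}"

text \<open>T_{K_eps} f = g: g is the L^2-sum (unconditional, over finite sets of indices)
  of the series sum eps_{j,k} <f, psi_{j,k}> psi_{j,k}.\<close>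

definition wavelet_op_value ::
  "(real \<Rightarrow> complex) \<Rightarrow> (int \<times> int \<Rightarrow> real) \<Rightarrow> (real \<Rightarrow> complex) \<Rightarrow> (real \<Rightarrow> complex) \<Rightarrow> bool" where
  "wavelet_op_value \<psi> \<epsilon> f g \<longleftrightarrow> in_L2 g \<and>
     (\<forall>e>0. \<exists>F. finite F \<and> (\<forall>G. finite G \<and> F \<subseteq> G \<longrightarrow>
        (\<integral>\<^sup>+ x. ennreal ((cmod (g x - (\<Sum>(j, k)\<in>G.
            complex_of_real (\<epsilon> (j, k)) * l2_inner f (wav \<psi> j k) * wav \<psi> j k x)))\<^sup>2) \<partial>lebesgue)
          < ennreal e))"

end

theory Submission
  imports Defs
begin

text \<open>For a finite set of indices the operator is an integral operator whose kernel satisfies the standard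
  Calderon-Zygmund smoothness estimates and which contracts \<open>L\<^sup>2\<close> (Bessel), both uniformly in the signs and in the
  index set. Hence it is of weak type (1,1), and on every interval \<open>Q\<close> the function \<open>T f\<close> differs from a
  constant by at most \<open>C inf\<^bsub>Q\<^esub> M f\<close> off a small part of \<open>Q\<close>. Iterating this on the stopping intervals of the
  exceptional sets, which cover at most half of \<open>Q\<close>, gives \<open>\<integral> |T f| g \<le> C \<integral> M f \<cdot> M g\<close>.
  The right-hand side is at most \<open>C \<rho>(M f) \<rho>'(M g)\<close>, so \<open>\<rho>(T f) \<le> C' \<rho>(f)\<close> by the Lorentz-Luxemburg duality
  \<open>\<rho>'' = \<rho>\<close>. The bound passes to the full series by the Fatou property, and separability of the space provides
  the density needed for the extension.\<close>

section \<open>Dyadic stopping intervals\<close>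

text \<open>Finite index sets keep the kernel bounded and continuous, so \<open>T f\<close> is an
  absolutely convergent integral and a bounded continuous function. The sizes obtained this way
  depend on the index set and serve only to start the iteration with a finite error, which each
  generation halves; what survives depends on \<open>B\<close> alone. \<open>B\<close> is uniform
  because the smoothness bound is proved with absolute values inside the double sum over scales and
  translates: translates are summed by the integrability of \<open>W\<close>, and scales by
  comparing the sum of \<open>4^j W(2^j t)\<close> with the integral of \<open>s W(s)\<close>
  divided by \<open>t^2\<close>, which is the origin of the moment condition. The bilinear estimate
  mirrors the two hypotheses on the maximal operator: one maximal function falls on \<open>f\<close>
  and is controlled in the space, the other on the dual function \<open>g\<close> and is controlled
  in the associate space. Duality is proved for bounded functions of bounded support, where a
  nearest point in L2 plays the role of a separation theorem.\<close>

definition dyadic_Ico :: "real \<Rightarrow> real \<Rightarrow> nat \<Rightarrow> int \<Rightarrow> real set" where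
  "dyadic_Ico a L n k = {a + of_int k * (L / 2 ^ n) ..< a + of_int k * (L / 2 ^ n) + L / 2 ^ n}"

text \<open>These are the maximal intervals with \<open>P\<close>: \<open>k div 2 ^ (n - m)\<close>
  is the index of the ancestor at level \<open>m\<close>, and no proper ancestor may satisfy
  \<open>P\<close>. The predicate is left abstract because two different stopping rules are run
  below.\<close>

definition stopping :: "(nat \<Rightarrow> int \<Rightarrow> bool) \<Rightarrow> (nat \<times> int) set" where
  "stopping P = {(n, k). P n k \<and> (\<forall>m<n. \<not> P m (k div 2 ^ (n - m)))}"

text \<open>Reading the index off as a floor turns inclusion of dyadic intervals into integer
  division, so nesting and disjointness become arithmetic.\<close>

lemma dyadic_Ico_iff:
  assumes "L > 0"
  shows "x \<in> dyadic_Ico a L n k \<longleftrightarrow> \<lfloor>(x - a) / L * 2 ^ n\<rfloor> = k"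
proof -
  have "x \<in> dyadic_Ico a L n k \<longleftrightarrow> of_int k \<le> (x - a) / L * 2 ^ n \<and> (x - a) / L * 2 ^ n < of_int k + 1"
    using assms unfolding dyadic_Ico_def
    by (auto simp: field_simps)
  then show ?thesis by (simp add: floor_eq_iff)
qed

lemma dyadic_Ico_ancestor:
  assumes "L > 0" "m \<le> n" "x \<in> dyadic_Ico a L n k"
  shows "x \<in> dyadic_Ico a L m (k div 2 ^ (n - m))"
proof -
  let ?y = "(x - a) / L"
  have "(2::real) ^ n = 2 ^ m * 2 ^ (n - m)"
    using assms(2) by (simp flip: power_add)
  then have "?y * 2 ^ m = (?y * 2 ^ n) / real_of_int (2 ^ (n - m))"
    by simp
  then have "\<lfloor>?y * 2 ^ m\<rfloor> = \<lfloor>?y * 2 ^ n\<rfloor> div 2 ^ (n - m)"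
    by (metis floor_divide_real_eq_div zero_le_numeral zero_le_power)
  then show ?thesis using assms by (simp add: dyadic_Ico_iff)
qed

lemma dyadic_Ico_level_zero [simp]: "dyadic_Ico a L 0 0 = {a..<a + L}"
  by (simp add: dyadic_Ico_def)

lemma dyadic_Ico_nonempty: "L > 0 \<Longrightarrow> a + of_int k * (L / 2 ^ n) \<in> dyadic_Ico a L n k"
  by (simp add: dyadic_Ico_def)

lemma dyadic_Ico_ancestor_subset:
  assumes "L > 0" "m \<le> n"
  shows "dyadic_Ico a L n k \<subseteq> dyadic_Ico a L m (k div 2 ^ (n - m))"
  using dyadic_Ico_ancestor[OF assms] by blast

lemma dyadic_Ico_subset_top:
  assumes "L > 0" "x \<in> dyadic_Ico a L n k" "x \<in> {a..<a + L}"
  shows "dyadic_Ico a L n k \<subseteq> {a..<a + L}"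
proof -
  have "x \<in> dyadic_Ico a L 0 0" using assms by simp
  moreover have "x \<in> dyadic_Ico a L 0 (k div 2 ^ (n - 0))"
    using dyadic_Ico_ancestor[OF assms(1) _ assms(2)] by blast
  ultimately have "k div 2 ^ (n - 0) = 0"
    using assms(1) by (simp only: dyadic_Ico_iff)
  then show ?thesis
    using dyadic_Ico_ancestor_subset[OF assms(1), of 0 n a k] by auto
qed

text \<open>If the levels differ, the shorter interval has an ancestor at the level of the longer
  one that contains the same point and hence equals it; this ancestor has \<open>P\<close>, against
  maximality. At equal levels the point determines the index.\<close>

lemma stopping_disjoint:
  assumes "L > 0" "(n, k) \<in> stopping P" "(n', k') \<in> stopping P"
    and "x \<in> dyadic_Ico a L n k" "x \<in> dyadic_Ico a L n' k'"
  shows "(n, k) = (n', k')"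
proof -
  have *: False
    if "(n, k) \<in> stopping P" "(n', k') \<in> stopping P" "x \<in> dyadic_Ico a L n k" "x \<in> dyadic_Ico a L n' k'" "n < n'"
    for n n' k k'
  proof -
    have "x \<in> dyadic_Ico a L n (k' div 2 ^ (n' - n))"
      using dyadic_Ico_ancestor[OF assms(1)] that by simp
    then have "k' div 2 ^ (n' - n) = k"
      using that(3) assms(1) by (simp add: dyadic_Ico_iff)
    then show False using that unfolding stopping_def by auto
  qed
  have "n = n'" using *[of n k n' k'] *[of n' k' n k] assms(2-) by (cases n n' rule: linorder_cases) auto
  then show ?thesis using assms by (simp add: dyadic_Ico_iff)
qed

text \<open>The coarsest ancestor with \<open>P\<close> is a stopping interval; it exists since the
  given interval is itself a candidate.\<close>

lemma stopping_cover:
  assumes "L > 0" "P n k" "x \<in> dyadic_Ico a L n k"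
  obtains n' k' where "(n', k') \<in> stopping P" "x \<in> dyadic_Ico a L n' k'"
proof -
  define R where "R m \<longleftrightarrow> m \<le> n \<and> P m (k div 2 ^ (n - m))" for m
  have "R n" using assms by (simp add: R_def)
  then have m: "R (LEAST m. R m)" by (rule LeastI)
  define m where "m = (LEAST m. R m)"
  have mn: "m \<le> n" using m by (simp add: m_def R_def)
  have "(m, k div 2 ^ (n - m)) \<in> stopping P"
    unfolding stopping_def
  proof (clarsimp, intro conjI allI impI)
    show "P m (k div 2 ^ (n - m))" using m by (simp add: m_def R_def)
    fix i assume i: "i < m"
    then have "\<not> R i" unfolding m_def by (rule not_less_Least)
    \<comment> \<open>Ancestors of ancestors are ancestors: dividing by \<open>2 ^ (n - m)\<close>
      and then by \<open>2 ^ (m - i)\<close> is one division by \<open>2 ^ (n - i)\<close>.\<close>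
    moreover have "k div 2 ^ (n - m) div 2 ^ (m - i) = k div 2 ^ (n - i)"
    proof -
      have "n - i = (n - m) + (m - i)" using i mn by simp
      then show ?thesis by (simp add: power_add div_mult2_eq zdiv_zmult2_eq)
    qed
    ultimately show "\<not> P i (k div 2 ^ (n - m) div 2 ^ (m - i))"
      using i mn by (simp add: R_def)
  qed
  then show ?thesis using that dyadic_Ico_ancestor[OF assms(1) mn assms(3)] by blast
qed

lemma emeasure_lebesgue_Ico: "l \<ge> 0 \<Longrightarrow> emeasure lebesgue {c..<c + l} = ennreal l"
  by (simp add: emeasure_completion)

lemma set_nn_integral_UN_countable:
  assumes "countable I" "\<And>i. i \<in> I \<Longrightarrow> A i \<in> sets M" "disjoint_family_on A I" "f \<in> borel_measurable M"
  shows "(\<integral>\<^sup>+x\<in>(\<Union>i\<in>I. A i). f x \<partial>M) = (\<integral>\<^sup>+i. (\<integral>\<^sup>+x\<in>A i. f x \<partial>M) \<partial>count_space I)"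
proof -
  have "(\<integral>\<^sup>+x\<in>(\<Union>i\<in>I. A i). f x \<partial>M) = emeasure (density M f) (\<Union>i\<in>I. A i)"
    using assms by (subst emeasure_density) (auto intro: sets.countable_UN'')
  also have "\<dots> = (\<integral>\<^sup>+i. emeasure (density M f) (A i) \<partial>count_space I)"
    using assms by (intro emeasure_UN_countable) auto
  also have "\<dots> = (\<integral>\<^sup>+i. (\<integral>\<^sup>+x\<in>A i. f x \<partial>M) \<partial>count_space I)"
    using assms by (intro nn_integral_cong) (auto simp: emeasure_density)
  finally show ?thesis .
qed


text \<open>Stop at the first interval whose mean exceeds \<open>t\<close>. The top interval does
  not stop by \<open>avg\<close>, so every stopping interval has a non-stopping parent of twice the
  length, which yields the factor 2. Off the stopping intervals all small dyadic means are at most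
  \<open>t\<close>; this is exported both as it stands, for arguments with open sets, and as an a.e.
  bound on \<open>u\<close>.\<close>

lemma Calderon_Zygmund_stopping_intervals:
  fixes u :: "real \<Rightarrow> ennreal" and t :: real
  assumes L: "L > 0" and t: "t \<ge> 0" and u[measurable]: "u \<in> borel_measurable lebesgue"
    and avg: "(\<integral>\<^sup>+x\<in>{a..<a + L}. u x \<partial>lebesgue) \<le> ennreal (t * L)"
  obtains I :: "(real \<times> real) set" where "countable I"
    and "disjoint_family_on (\<lambda>(c, l). {c..<c + l}) I"
    and "\<And>c l. (c, l) \<in> I \<Longrightarrow> l > 0 \<and> {c..<c + l} \<subseteq> {a..<a + L} \<and>
           ennreal (t * l) \<le> (\<integral>\<^sup>+x\<in>{c..<c + l}. u x \<partial>lebesgue) \<and>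
           (\<integral>\<^sup>+x\<in>{c..<c + l}. u x \<partial>lebesgue) \<le> ennreal (2 * t * l)"
    and "\<And>x \<delta>. x \<in> {a..<a + L} \<Longrightarrow> x \<notin> (\<Union>(c, l)\<in>I. {c..<c + l}) \<Longrightarrow> \<delta> > 0 \<Longrightarrow>
           \<exists>c l. 0 < l \<and> l < \<delta> \<and> x \<in> {c..<c + l} \<and> {c..<c + l} \<subseteq> {a..<a + L} \<and>
             (\<integral>\<^sup>+y\<in>{c..<c + l}. u y \<partial>lebesgue) \<le> ennreal (t * l)"
    and "AE x in lebesgue. x \<in> {a..<a + L} - (\<Union>(c, l)\<in>I. {c..<c + l}) \<longrightarrow> u x \<le> ennreal t"
proof -
  let ?Q = "{a..<a + L}"
  let ?D = "dyadic_Ico a L"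
  have Dm[measurable]: "?D n k \<in> sets lebesgue" for n k
    by (auto simp: dyadic_Ico_def)
  have De: "emeasure lebesgue (?D n k) = ennreal (L / 2 ^ n)" for n k
    unfolding dyadic_Ico_def using L by (intro emeasure_lebesgue_Ico) auto
  \<comment> \<open>All integer indices occur at every level, so lying inside \<open>?Q\<close> has
    to be part of the stopping rule.\<close>
  define P where "P n k \<longleftrightarrow> ?D n k \<subseteq> ?Q \<and>
     ennreal (t * (L / 2 ^ n)) < (\<integral>\<^sup>+x\<in>?D n k. u x \<partial>lebesgue)" for n k
  define e where "e = (\<lambda>(n::nat, k::int). (a + of_int k * (L / 2 ^ n), L / 2 ^ n))"
  define I where "I = e ` stopping P"
  have eD: "(\<lambda>(c, l). {c..<c + l}) (e (n, k)) = ?D n k" for n k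
    by (simp add: e_def dyadic_Ico_def)
  have disjS: "disjoint_family_on (\<lambda>(n, k). ?D n k) (stopping Q)" for Q
    unfolding disjoint_family_on_def using stopping_disjoint[OF L, of _ _ Q _ _ _ a] by fast
  have U: "(\<Union>(c, l)\<in>I. {c..<c + l}) = (\<Union>(n, k)\<in>stopping P. ?D n k)"
    unfolding I_def image_image by (intro SUP_cong refl) (auto simp: e_def dyadic_Ico_def)
  have 1: "countable I" unfolding I_def by blast
  have 2: "disjoint_family_on (\<lambda>(c, l). {c..<c + l}) I"
  proof -
    have "(\<lambda>(c, l). {c..<c + l}) (e p) \<inter> (\<lambda>(c, l). {c..<c + l}) (e q) = {}"
      if "p \<in> stopping P" "q \<in> stopping P" "p \<noteq> q" for p q
    proof -
      obtain n k n' k' where "p = (n, k)" "q = (n', k')" by fastforce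
      then show ?thesis using that stopping_disjoint[OF L, of n k P n' k' _ a]
        by (simp only: eD) blast
    qed
    then show ?thesis unfolding disjoint_family_on_def I_def
      by (metis (no_types, lifting) imageE)
  qed
  have stop: "(\<integral>\<^sup>+x\<in>?D n k. u x \<partial>lebesgue) \<le> ennreal (2 * t * (L / 2 ^ n))" "?D n k \<subseteq> ?Q"
    "ennreal (t * (L / 2 ^ n)) \<le> (\<integral>\<^sup>+x\<in>?D n k. u x \<partial>lebesgue)" if "(n, k) \<in> stopping P" for n k
  proof -
    have Pnk: "P n k" using that by (simp add: stopping_def)
    then show "?D n k \<subseteq> ?Q" "ennreal (t * (L / 2 ^ n)) \<le> (\<integral>\<^sup>+x\<in>?D n k. u x \<partial>lebesgue)"
      by (auto simp: P_def)
    have ne: "a + of_int k * (L / 2 ^ n) \<in> ?D n k" by (rule dyadic_Ico_nonempty[OF L])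
    \<comment> \<open>The only level-0 interval inside \<open>?Q\<close> is \<open>?Q\<close>
      itself, and \<open>avg\<close> forbids it to stop.\<close>
    have "n \<noteq> 0"
    proof
      assume [simp]: "n = 0"
      have "?D 0 k = ?D 0 0" 
      proof -
        have "a + of_int k * (L / 2 ^ n) \<in> ?D 0 0" using ne Pnk by (auto simp: P_def)
        then show ?thesis using ne by (simp only: dyadic_Ico_iff[OF L] \<open>n = 0\<close>)
      qed
      then show False using Pnk avg by (auto simp: P_def)
    qed
    then obtain m where m: "n = Suc m" by (cases n) auto
    \<comment> \<open>The parent does not stop although it lies in \<open>?Q\<close>, so its mean
      must be at most \<open>t\<close>.\<close>
    have "\<not> P m (k div 2)" using that m by (auto simp: stopping_def)
    moreover have "?D m (k div 2) \<subseteq> ?Q"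
    proof (rule dyadic_Ico_subset_top[OF L])
      show "a + of_int k * (L / 2 ^ n) \<in> ?D m (k div 2)"
        using dyadic_Ico_ancestor[OF L _ ne, of m] m by simp
      show "a + of_int k * (L / 2 ^ n) \<in> ?Q" using ne Pnk by (auto simp: P_def)
    qed
    ultimately have "(\<integral>\<^sup>+x\<in>?D m (k div 2). u x \<partial>lebesgue) \<le> ennreal (t * (L / 2 ^ m))"
      by (simp add: P_def not_less)
    moreover have "?D n k \<subseteq> ?D m (k div 2)"
      using dyadic_Ico_ancestor_subset[OF L, of m n a k] m by simp
    then have "(\<integral>\<^sup>+x\<in>?D n k. u x \<partial>lebesgue) \<le> (\<integral>\<^sup>+x\<in>?D m (k div 2). u x \<partial>lebesgue)"
      by (intro nn_integral_mono) (auto split: split_indicator)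
    ultimately show "(\<integral>\<^sup>+x\<in>?D n k. u x \<partial>lebesgue) \<le> ennreal (2 * t * (L / 2 ^ n))"
      using m by (auto elim!: order_trans)
  qed
  have 3: "l > 0 \<and> {c..<c + l} \<subseteq> {a..<a + L} \<and>
           ennreal (t * l) \<le> (\<integral>\<^sup>+x\<in>{c..<c + l}. u x \<partial>lebesgue) \<and>
           (\<integral>\<^sup>+x\<in>{c..<c + l}. u x \<partial>lebesgue) \<le> ennreal (2 * t * l)" if "(c, l) \<in> I" for c l
  proof -
    obtain n k where nk: "(n, k) \<in> stopping P" "c = a + of_int k * (L / 2 ^ n)" "l = L / 2 ^ n"
      using \<open>(c, l) \<in> I\<close> by (auto simp: I_def e_def)
    then have "{c..<c + l} = ?D n k" by (simp add: dyadic_Ico_def)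
    then show ?thesis using stop[OF nk(1)] nk(3) L by simp
  qed
  have smallD: "\<exists>n k. L / 2 ^ n < \<delta> \<and> x \<in> ?D n k" if "\<delta> > 0" for x \<delta>
  proof -
    obtain n where "(1/2) ^ n < \<delta> / L"
      using real_arch_pow_inv[of "\<delta> / L" "1/2"] divide_pos_pos[OF \<open>\<delta> > 0\<close> L] by force
    then have "L / 2 ^ n < \<delta>" using L by (simp add: field_simps power_divide)
    then show ?thesis using dyadic_Ico_iff[OF L, of x a n] by blast
  qed
  have nP: "(\<integral>\<^sup>+y\<in>?D n k. u y \<partial>lebesgue) \<le> ennreal (t * (L / 2 ^ n))" "?D n k \<subseteq> ?Q"
    if "x \<in> ?Q" and nx: "x \<notin> (\<Union>(c, l)\<in>I. {c..<c + l})" and x: "x \<in> ?D n k" for x n k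
  proof -
    show sub: "?D n k \<subseteq> ?Q" using dyadic_Ico_subset_top[OF L] that by blast
    have "\<not> P n k"
    proof
      assume "P n k"
      then obtain n' k' where "(n', k') \<in> stopping P" "x \<in> ?D n' k'"
        using stopping_cover[OF L, of P n k x a] x by metis
      then show False using nx unfolding U by auto
    qed
    then show "(\<integral>\<^sup>+y\<in>?D n k. u y \<partial>lebesgue) \<le> ennreal (t * (L / 2 ^ n))"
      using sub by (simp add: P_def not_less)
  qed
  have 4: "\<exists>c l. 0 < l \<and> l < \<delta> \<and> x \<in> {c..<c + l} \<and> {c..<c + l} \<subseteq> {a..<a + L} \<and>
             (\<integral>\<^sup>+y\<in>{c..<c + l}. u y \<partial>lebesgue) \<le> ennreal (t * l)"
    if "x \<in> ?Q" "x \<notin> (\<Union>(c, l)\<in>I. {c..<c + l})" "\<delta> > 0" for x \<delta>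
  proof -
    obtain n k where nk: "L / 2 ^ n < \<delta>" "x \<in> ?D n k" using smallD[OF \<open>\<delta> > 0\<close>] by blast
    show ?thesis using nP[OF that(1,2) nk(2)] nk L
      by (intro exI[of _ "a + of_int k * (L / 2 ^ n)"] exI[of _ "L / 2 ^ n"]) (auto simp: dyadic_Ico_def)
  qed
  have 5: "AE x in lebesgue. x \<in> ?Q - (\<Union>(c, l)\<in>I. {c..<c + l}) \<longrightarrow> u x \<le> ennreal t"
  proof -
    \<comment> \<open>The a.e. bound is reached without differentiating integrals. \<open>Y\<close>
      is the set where it fails, and the aim is that the integral of \<open>u\<close> over
      \<open>Y\<close> is at most \<open>t\<close> times the measure of \<open>Y\<close>; as
      \<open>u > t\<close> on \<open>Y\<close>, this leaves only a null set.\<close>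
    define Y where "Y = {x \<in> ?Q - (\<Union>(c, l)\<in>I. {c..<c + l}). ennreal t < u x}"
    have Um: "(\<Union>(c, l)\<in>I. {c..<c + l}) \<in> sets lebesgue"
      using 1 by (intro sets.countable_UN'') auto
    have Ym[measurable]: "Y \<in> sets lebesgue"
    proof -
      have "{x \<in> space lebesgue. ennreal t < u x} \<in> sets lebesgue" by measurable
      moreover have "Y = (?Q - (\<Union>(c, l)\<in>I. {c..<c + l})) \<inter> {x \<in> space lebesgue. ennreal t < u x}"
        by (auto simp: Y_def)
      ultimately show ?thesis by (simp only:) (intro sets.Int sets.Diff Um, auto)
    qed
    have fin: "emeasure lebesgue Y < \<infinity>"
    proof -
      have "emeasure lebesgue Y \<le> emeasure lebesgue ?Q"
        by (intro emeasure_mono) (auto simp: Y_def)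
      then show ?thesis using emeasure_lebesgue_Ico[of L a] L by (auto simp: less_top order_le_less_trans)
    qed
    have main: "(\<integral>\<^sup>+x\<in>Y. u x \<partial>lebesgue) \<le> ennreal t * emeasure lebesgue T" if T: "open T" "Y \<subseteq> T" for T
    proof -
      \<comment> \<open>A second stopping rule, now inside an open set \<open>T\<close>: each point
        of \<open>Y\<close> lies in arbitrarily small intervals with mean at most \<open>t\<close>,
        and the maximal ones among those contained in \<open>T\<close> are disjoint and cover
        \<open>Y\<close>.\<close>
      define R where "R n k \<longleftrightarrow> ?D n k \<subseteq> T \<and>
        (\<integral>\<^sup>+y\<in>?D n k. u y \<partial>lebesgue) \<le> ennreal (t * (L / 2 ^ n))" for n k
      have cov: "Y \<subseteq> (\<Union>(n, k)\<in>stopping R. ?D n k)"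
      proof
        fix x assume x: "x \<in> Y"
        then obtain \<delta> where \<delta>: "\<delta> > 0" "ball x \<delta> \<subseteq> T" using T openE by blast
        obtain n k where nk: "L / 2 ^ n < \<delta>" "x \<in> ?D n k" using smallD[OF \<delta>(1)] by blast
        have "?D n k \<subseteq> ball x \<delta>" using nk by (auto simp: dyadic_Ico_def dist_real_def)
        then have "R n k" using nP[of x n k] nk x \<delta> unfolding R_def Y_def by blast
        then show "x \<in> (\<Union>(n, k)\<in>stopping R. ?D n k)"
        proof -
          obtain n' k' where "(n', k') \<in> stopping R" "x \<in> ?D n' k'"
            using stopping_cover[OF L, of R n k x a] \<open>R n k\<close> nk(2) by metis
          then show ?thesis by auto
        qed
      qed
      have "(\<integral>\<^sup>+x\<in>Y. u x \<partial>lebesgue) \<le> (\<integral>\<^sup>+x\<in>(\<Union>p\<in>stopping R. (\<lambda>(n, k). ?D n k) p). u x \<partial>lebesgue)"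
        using cov by (intro nn_integral_mono) (auto split: split_indicator)
      also have "\<dots> = (\<integral>\<^sup>+p. (\<integral>\<^sup>+x\<in>(\<lambda>(n, k). ?D n k) p. u x \<partial>lebesgue) \<partial>count_space (stopping R))"
        by (rule set_nn_integral_UN_countable) (use disjS[of R] in auto)
      also have "\<dots> \<le> (\<integral>\<^sup>+p. ennreal t * emeasure lebesgue ((\<lambda>(n, k). ?D n k) p) \<partial>count_space (stopping R))"
        using t L by (intro nn_integral_mono) (auto simp: De stopping_def R_def ennreal_mult[symmetric])
      also have "\<dots> = ennreal t * (\<integral>\<^sup>+p. emeasure lebesgue ((\<lambda>(n, k). ?D n k) p) \<partial>count_space (stopping R))"
        by (intro nn_integral_cmult) auto
      also have "(\<integral>\<^sup>+p. emeasure lebesgue ((\<lambda>(n, k). ?D n k) p) \<partial>count_space (stopping R))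
         = emeasure lebesgue (\<Union>p\<in>stopping R. (\<lambda>(n, k). ?D n k) p)"
        by (intro emeasure_UN_countable[symmetric]) (use disjS[of R] in auto)
      also have "\<dots> \<le> emeasure lebesgue T"
        by (intro emeasure_mono) (use T in \<open>auto simp: stopping_def R_def\<close>)
      finally show ?thesis by (simp add: mult_left_mono)
    qed
    \<comment> \<open>Outer regularity lets the open set shrink to \<open>Y\<close>. The denominator
      \<open>t + 1\<close> covers the case \<open>t = 0\<close>.\<close>
    have le: "(\<integral>\<^sup>+x\<in>Y. u x \<partial>lebesgue) \<le> ennreal t * emeasure lebesgue Y"
    proof (rule ennreal_le_epsilon)
      fix \<epsilon> :: real assume e: "\<epsilon> > 0"
      obtain T where T: "open T" "Y \<subseteq> T" "emeasure lebesgue (T - Y) < ennreal (\<epsilon> / (t + 1))" "T - Y \<in> lmeasurable"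
        using sets_lebesgue_outer_open[OF Ym, of "\<epsilon> / (t + 1)"] e t by auto
      have "emeasure lebesgue T \<le> emeasure lebesgue Y + emeasure lebesgue (T - Y)"
        using T by (metis Diff_partition Ym emeasure_subadditive fmeasurableD)
      then have "ennreal t * emeasure lebesgue T \<le> ennreal t * (emeasure lebesgue Y + ennreal (\<epsilon> / (t + 1)))"
        using T(3) by (meson add_left_mono less_imp_le mult_left_mono order_trans zero_le)
      also have "\<dots> = ennreal t * emeasure lebesgue Y + ennreal (t * (\<epsilon> / (t + 1)))"
        using t e by (simp add: distrib_left ennreal_mult[symmetric])
      also have "\<dots> \<le> ennreal t * emeasure lebesgue Y + ennreal \<epsilon>"
        using t e by (intro add_left_mono ennreal_leI) (auto simp: field_simps)
      finally show "(\<integral>\<^sup>+x\<in>Y. u x \<partial>lebesgue) \<le> ennreal t * emeasure lebesgue Y + ennreal \<epsilon>"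
        using main[OF T(1,2)] by order
    qed
    have "(\<integral>\<^sup>+x\<in>Y. u x \<partial>lebesgue) = (\<integral>\<^sup>+x. ennreal t * indicator Y x + (u x - ennreal t) * indicator Y x \<partial>lebesgue)"
      by (intro nn_integral_cong) (auto split: split_indicator simp: Y_def add_diff_self_ennreal)
    also have "\<dots> = ennreal t * emeasure lebesgue Y + (\<integral>\<^sup>+x. (u x - ennreal t) * indicator Y x \<partial>lebesgue)"
      by (subst nn_integral_add) (auto simp: nn_integral_cmult_indicator)
    finally have "ennreal t * emeasure lebesgue Y + (\<integral>\<^sup>+x. (u x - ennreal t) * indicator Y x \<partial>lebesgue)
        \<le> ennreal t * emeasure lebesgue Y + 0"
      using le by simp
    \<comment> \<open>Finiteness of the measure of \<open>Y\<close> permits cancelling the common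
      term.\<close>
    moreover have "ennreal t * emeasure lebesgue Y \<noteq> top"
      using fin by (metis ennreal_less_top ennreal_mult_less_top infinity_ennreal_def less_irrefl)
    ultimately have "(\<integral>\<^sup>+x. (u x - ennreal t) * indicator Y x \<partial>lebesgue) = 0"
      unfolding ennreal_add_left_cancel_le by auto
    then have "AE x in lebesgue. (u x - ennreal t) * indicator Y x = 0"
      by (subst (asm) nn_integral_0_iff_AE) auto
    then show ?thesis
    proof (rule AE_mp, intro AE_I2 impI)
      fix x assume x: "(u x - ennreal t) * indicator Y x = 0" "x \<in> ?Q - (\<Union>(c, l)\<in>I. {c..<c + l})"
      show "u x \<le> ennreal t"
      proof (rule ccontr)
        assume "\<not> u x \<le> ennreal t"
        then have "ennreal t < u x" "x \<in> Y" using x by (auto simp: Y_def)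
        then show False using x(1) by (auto dest!: ennreal_minus_eq_0 simp: not_le)
      qed
    qed
  qed
  show thesis
    by (rule that[OF 1 2 3 4 5])
qed

section \<open>Local oscillations\<close>

lemma borel_measurable_lebesgue_ident [measurable]: "(\<lambda>x::real. x) \<in> borel_measurable lebesgue"
  by (rule measurable_completion) simp

text \<open>The stopping intervals are taken for the indicator of the exceptional set of the whole
  interval, at height 1/4. They carry exceptional density between 1/4 and 1/2: the lower bound
  limits their total length to \<open>4 * L / 8\<close>, the upper one leaves points that are good
  for parent and child at once, so that the two constants can be compared.\<close>

lemma oscillation_stopping:
  fixes h :: "real \<Rightarrow> complex" and c :: "real \<Rightarrow> real \<Rightarrow> complex" and \<alpha> :: "real \<Rightarrow> real \<Rightarrow> real"
  assumes h: "continuous_on UNIV h" and L: "L > 0"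
    and osc: "\<And>a L. L > 0 \<Longrightarrow> emeasure lebesgue {x \<in> {a..<a + L}. \<alpha> a L < cmod (h x - c a L)} \<le> ennreal (L / 8)"
    and mono: "\<And>a L b l. L > 0 \<Longrightarrow> l > 0 \<Longrightarrow> {b..<b + l} \<subseteq> {a..<a + L} \<Longrightarrow> \<alpha> a L \<le> \<alpha> b l"
  obtains I :: "(real \<times> real) set" where "countable I"
    and "disjoint_family_on (\<lambda>(b, l). {b..<b + l}) I"
    and "\<And>b l. (b, l) \<in> I \<Longrightarrow> l > 0 \<and> {b..<b + l} \<subseteq> {a..<a + L} \<and> cmod (c a L - c b l) \<le> 2 * \<alpha> b l"
    and "(\<integral>\<^sup>+(b, l). ennreal l \<partial>count_space I) \<le> ennreal (L / 2)"
    and "\<And>x. x \<in> {a..<a + L} - (\<Union>(b, l)\<in>I. {b..<b + l}) \<Longrightarrow> cmod (h x - c a L) \<le> \<alpha> a L"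
proof -
  let ?Q = "{a..<a + L}"
  define X where "X b l = {x \<in> {b..<b + l}. \<alpha> b l < cmod (h x - c b l)}" for b l
  have [measurable]: "h \<in> borel_measurable borel" by (rule borel_measurable_continuous_onI[OF h])
  have Xm[measurable, simp]: "X b l \<in> sets lebesgue" for b l
  proof -
    have "X b l \<in> sets borel" unfolding X_def by measurable
    then show ?thesis by auto
  qed
  define u where "u = (\<lambda>x. indicator (X a L) x :: ennreal)"
  have u[measurable]: "u \<in> borel_measurable lebesgue" unfolding u_def by measurable
  have ui: "(\<integral>\<^sup>+x\<in>S. u x \<partial>lebesgue) = emeasure lebesgue (X a L \<inter> S)" if "S \<in> sets lebesgue" for S
  proof -
    have "(\<integral>\<^sup>+x\<in>S. u x \<partial>lebesgue) = (\<integral>\<^sup>+x. indicator (X a L \<inter> S) x \<partial>lebesgue)"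
      unfolding u_def by (intro nn_integral_cong) (auto split: split_indicator)
    also have "\<dots> = emeasure lebesgue (X a L \<inter> S)"
      using that by (intro nn_integral_indicator) auto
    finally show ?thesis .
  qed
  have "(\<integral>\<^sup>+x\<in>?Q. u x \<partial>lebesgue) \<le> ennreal (L / 8)"
    using osc[OF L, of a] emeasure_mono[of "X a L \<inter> ?Q" "X a L" lebesgue]
    by (subst ui) (auto simp: X_def)
  also have "\<dots> \<le> ennreal (1/4 * L)" using L by (intro ennreal_leI) auto
  finally have avg: "(\<integral>\<^sup>+x\<in>?Q. u x \<partial>lebesgue) \<le> ennreal (1/4 * L)" .
  obtain I where I: "countable I" "disjoint_family_on (\<lambda>(b, l). {b..<b + l}) I"
    and I3: "\<And>b l. (b, l) \<in> I \<Longrightarrow> l > 0 \<and> {b..<b + l} \<subseteq> ?Q \<and>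
           ennreal (1/4 * l) \<le> (\<integral>\<^sup>+x\<in>{b..<b + l}. u x \<partial>lebesgue) \<and>
           (\<integral>\<^sup>+x\<in>{b..<b + l}. u x \<partial>lebesgue) \<le> ennreal (2 * (1/4) * l)"
    and I4: "\<And>x \<delta>. x \<in> ?Q \<Longrightarrow> x \<notin> (\<Union>(b, l)\<in>I. {b..<b + l}) \<Longrightarrow> \<delta> > 0 \<Longrightarrow>
           \<exists>b l. 0 < l \<and> l < \<delta> \<and> x \<in> {b..<b + l} \<and> {b..<b + l} \<subseteq> ?Q \<and>
             (\<integral>\<^sup>+y\<in>{b..<b + l}. u y \<partial>lebesgue) \<le> ennreal (1/4 * l)"
    by (rule Calderon_Zygmund_stopping_intervals[OF L _ u avg]) auto
  have 3: "l > 0 \<and> {b..<b + l} \<subseteq> ?Q \<and> cmod (c a L - c b l) \<le> 2 * \<alpha> b l" if "(b, l) \<in> I" for b l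
  proof -
    note * = I3[OF that]
    \<comment> \<open>The exceptional set of the parent fills at most \<open>l / 2\<close> and that
      of the child at most \<open>l / 8\<close>, together \<open>5/8 * l < l\<close>.\<close>
    have "\<exists>x\<in>{b..<b + l}. x \<notin> X a L \<and> x \<notin> X b l"
    proof (rule ccontr)
      assume "\<not> ?thesis"
      then have "{b..<b + l} \<subseteq> (X a L \<inter> {b..<b + l}) \<union> X b l" by auto
      then have "emeasure lebesgue {b..<b + l} \<le> emeasure lebesgue (X a L \<inter> {b..<b + l}) + emeasure lebesgue (X b l)"
        by (intro order_trans[OF emeasure_mono emeasure_subadditive] sets.Un sets.Int Xm) auto
      also have "\<dots> \<le> ennreal (2 * (1/4) * l) + ennreal (l / 8)"
        using * osc[of l b] by (intro add_mono) (auto simp: ui X_def)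
      also have "\<dots> = ennreal (5/8 * l)" using * by (subst ennreal_plus[symmetric]) (auto simp: field_simps)
      finally show False using * by (subst (asm) emeasure_lebesgue_Ico) auto
    qed
    then obtain x where x: "x \<in> {b..<b + l}" "x \<notin> X a L" "x \<notin> X b l" by auto
    then have "x \<in> ?Q" using * by auto
    then have "cmod (h x - c a L) \<le> \<alpha> a L" "cmod (h x - c b l) \<le> \<alpha> b l"
      using x by (auto simp: X_def)
    moreover have "\<alpha> a L \<le> \<alpha> b l" using mono[OF L, of l b a] * by auto
    moreover have "cmod (c a L - c b l) \<le> cmod (h x - c b l) + cmod (h x - c a L)"
      using norm_triangle_ineq4[of "h x - c b l" "h x - c a L"] by simp
    ultimately show ?thesis using * by auto
  qed
  have 4: "(\<integral>\<^sup>+(b, l). ennreal l \<partial>count_space I) \<le> ennreal (L / 2)"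
  proof -
    have "(\<integral>\<^sup>+(b, l). ennreal l \<partial>count_space I) \<le> (\<integral>\<^sup>+p. 4 * (\<integral>\<^sup>+x\<in>(\<lambda>(b, l). {b..<b + l}) p. u x \<partial>lebesgue) \<partial>count_space I)"
    proof (intro nn_integral_mono, clarsimp)
      fix b l assume "(b, l) \<in> I"
      from I3[OF this] have "ennreal 4 * ennreal (1/4 * l) \<le> 4 * (\<integral>\<^sup>+x\<in>{b..<b + l}. u x \<partial>lebesgue)" "l > 0"
        by (auto intro: mult_left_mono)
      then show "ennreal l \<le> 4 * (\<integral>\<^sup>+x\<in>{b..<b + l}. u x \<partial>lebesgue)"
        by (subst (asm) ennreal_mult[symmetric]) auto
    qed
    also have "\<dots> = 4 * (\<integral>\<^sup>+p. (\<integral>\<^sup>+x\<in>(\<lambda>(b, l). {b..<b + l}) p. u x \<partial>lebesgue) \<partial>count_space I)"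
      by (intro nn_integral_cmult) auto
    also have "\<dots> = 4 * (\<integral>\<^sup>+x\<in>(\<Union>p\<in>I. (\<lambda>(b, l). {b..<b + l}) p). u x \<partial>lebesgue)"
      using I by (subst set_nn_integral_UN_countable) auto
    also have "\<dots> \<le> 4 * (\<integral>\<^sup>+x\<in>?Q. u x \<partial>lebesgue)"
      using I3 by (intro mult_left_mono nn_integral_mono) (fastforce split: split_indicator)+
    also have "\<dots> \<le> ennreal 4 * ennreal (L / 8)"
      using \<open>(\<integral>\<^sup>+x\<in>?Q. u x \<partial>lebesgue) \<le> ennreal (L / 8)\<close> by (auto intro: mult_left_mono)
    also have "\<dots> = ennreal (L / 2)" using L by (subst ennreal_mult[symmetric]) auto
    finally show ?thesis .
  qed
  \<comment> \<open>The exceptional set is open relative to the interval by continuity of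
    \<open>h\<close>, so an exceptional point outside the stopping intervals would lie in small
    intervals of density 1, against density at most 1/4. The bound thus holds at every such point,
    not only a.e.\<close>
  have 5: "cmod (h x - c a L) \<le> \<alpha> a L" if x: "x \<in> ?Q - (\<Union>(b, l)\<in>I. {b..<b + l})" for x
  proof (rule ccontr)
    assume "\<not> ?thesis"
    then have "x \<in> {y. \<alpha> a L < cmod (h y - c a L)}" by simp
    moreover have "open {y. \<alpha> a L < cmod (h y - c a L)}"
      by (intro open_Collect_less continuous_intros h)
    ultimately obtain \<delta> where \<delta>: "\<delta> > 0" "ball x \<delta> \<subseteq> {y. \<alpha> a L < cmod (h y - c a L)}"
      using openE by blast
    obtain b l where bl: "0 < l" "l < \<delta>" "x \<in> {b..<b + l}" "{b..<b + l} \<subseteq> ?Q"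
      "(\<integral>\<^sup>+y\<in>{b..<b + l}. u y \<partial>lebesgue) \<le> ennreal (1/4 * l)"
      using I4[of x \<delta>] x \<delta>(1) by auto
    have "{b..<b + l} \<subseteq> ball x \<delta>" using bl by (auto simp: dist_real_def)
    then have "X a L \<inter> {b..<b + l} = {b..<b + l}" using bl \<delta> by (auto simp: X_def)
    then show False using bl by (subst (asm) ui) (auto simp: emeasure_lebesgue_Ico)
  qed
  show thesis by (rule that[OF I 3 4 5])
qed

text \<open>On the intervals of \<open>oscillation_stopping\<close> the constant is changed and the
  argument repeated. Only the part left over in each generation is charged; these parts are disjoint
  and fill at least half of their interval, so \<open>\<alpha> a L\<close> times the integral of
  \<open>g\<close> is at most twice the integral of \<open>V * U\<close> over this part. Each
  interval is charged three times, which gives the 6. \<open>H\<close> enters only an error that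
  vanishes as the number of generations grows.\<close>

lemma local_oscillation_bound:
  fixes h :: "real \<Rightarrow> complex" and c :: "real \<Rightarrow> real \<Rightarrow> complex" and \<alpha> :: "real \<Rightarrow> real \<Rightarrow> real"
    and g U V :: "real \<Rightarrow> ennreal"
  assumes h: "continuous_on UNIV h"
    and [measurable]: "g \<in> borel_measurable lebesgue" "U \<in> borel_measurable lebesgue" "V \<in> borel_measurable lebesgue"
    and osc: "\<And>a L. L > 0 \<Longrightarrow> emeasure lebesgue {x \<in> {a..<a + L}. \<alpha> a L < cmod (h x - c a L)} \<le> ennreal (L / 8)"
    and mono: "\<And>a L b l. L > 0 \<Longrightarrow> l > 0 \<Longrightarrow> {b..<b + l} \<subseteq> {a..<a + L} \<Longrightarrow> \<alpha> a L \<le> \<alpha> b l"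
    and \<alpha>V: "\<And>a L x. L > 0 \<Longrightarrow> x \<in> {a..<a + L} \<Longrightarrow> ennreal (\<alpha> a L) \<le> V x"
    and gU: "\<And>a L x. L > 0 \<Longrightarrow> x \<in> {a..<a + L} \<Longrightarrow> (\<integral>\<^sup>+y\<in>{a..<a + L}. g y \<partial>lebesgue) \<le> ennreal L * U x"
    and \<alpha>0: "\<And>a L. L > 0 \<Longrightarrow> 0 \<le> \<alpha> a L"
    and bounds: "\<And>x. cmod (h x) \<le> H" "\<And>a L. cmod (c a L) \<le> H" "\<And>a L. L > 0 \<Longrightarrow> \<alpha> a L \<le> H" "\<And>x. g x \<le> ennreal H"
    and L: "L > 0"
  shows "(\<integral>\<^sup>+x\<in>{a..<a + L}. ennreal (cmod (h x - c a L)) * g x \<partial>lebesgue)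
           \<le> 6 * (\<integral>\<^sup>+x\<in>{a..<a + L}. V x * U x \<partial>lebesgue)"
proof -
  have H0: "H \<ge> 0" using bounds(1)[of 0] norm_ge_zero order_trans by blast
  have hb: "h \<in> borel_measurable borel" by (rule borel_measurable_continuous_onI[OF h])
  have [measurable]: "h \<in> borel_measurable lebesgue" 
    using measurable_completion[of h lborel borel] hb by simp
  define G where "G a L = (\<integral>\<^sup>+y\<in>{a..<a + L}. g y \<partial>lebesgue)" for a L
  \<comment> \<open>The second summand pays in advance for replacing the constant of the parent by
    \<open>c a L\<close>: by the stopping lemma they differ by at most
    \<open>2 * \<alpha> a L\<close>.\<close>
  define \<Phi> where "\<Phi> a L = (\<integral>\<^sup>+x\<in>{a..<a + L}. ennreal (cmod (h x - c a L)) * g x \<partial>lebesgue) +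
     2 * ennreal (\<alpha> a L) * G a L" for a L
  \<comment> \<open>Induction on the number of generations. The crude bound
    \<open>4 * H * H * L\<close> is proportional to the length, and the children have total length
    at most \<open>L / 2\<close>, so each generation halves the error.\<close>
  have "L > 0 \<Longrightarrow> \<Phi> a L \<le> 6 * (\<integral>\<^sup>+x\<in>{a..<a + L}. V x * U x \<partial>lebesgue) + ennreal (4 * H * H * L / 2 ^ n)" for n a L
  proof (induction n arbitrary: a L)
    case 0
    have "G a L \<le> (\<integral>\<^sup>+y\<in>{a..<a + L}. ennreal H \<partial>lebesgue)"
      unfolding G_def using bounds by (intro nn_integral_mono mult_right_mono) auto
    also have "\<dots> = ennreal (H * L)"
      using 0 H0 by (subst nn_integral_cmult_indicator) (auto simp: emeasure_lebesgue_Ico ennreal_mult simp del: emeasure_completion)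
    finally have G: "G a L \<le> ennreal (H * L)" .
    have "(\<integral>\<^sup>+x\<in>{a..<a + L}. ennreal (cmod (h x - c a L)) * g x \<partial>lebesgue) \<le> (\<integral>\<^sup>+x\<in>{a..<a + L}. ennreal (2 * H * H) \<partial>lebesgue)"
    proof (intro nn_integral_mono mult_right_mono)
      fix x
      have "cmod (h x - c a L) \<le> 2 * H"
        using norm_triangle_ineq4[of "h x" "c a L"] bounds(1)[of x] bounds(2)[of a L] by simp
      then have "ennreal (cmod (h x - c a L)) * g x \<le> ennreal (2 * H) * ennreal H"
        using bounds(4)[of x] by (intro mult_mono ennreal_leI) auto
      then show "ennreal (cmod (h x - c a L)) * g x \<le> ennreal (2 * H * H)"
        using H0 by (simp add: ennreal_mult[symmetric])
    qed auto
    also have "\<dots> = ennreal (2 * H * H * L)"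
      using 0 H0 by (subst nn_integral_cmult_indicator) (auto simp: emeasure_lebesgue_Ico ennreal_mult simp del: emeasure_completion)
    finally have "(\<integral>\<^sup>+x\<in>{a..<a + L}. ennreal (cmod (h x - c a L)) * g x \<partial>lebesgue) \<le> ennreal (2 * H * H * L)" .
    moreover have "2 * ennreal (\<alpha> a L) * G a L \<le> ennreal (2 * H) * ennreal (H * L)"
    proof (intro mult_mono G)
      have "2 * ennreal (\<alpha> a L) \<le> 2 * ennreal H" using bounds(3)[OF 0, of a] by (intro mult_left_mono ennreal_leI) auto
      then show "2 * ennreal (\<alpha> a L) \<le> ennreal (2 * H)" using H0 by (simp add: ennreal_mult)
    qed auto
    ultimately have "\<Phi> a L \<le> ennreal (2 * H * H * L) + ennreal (2 * H) * ennreal (H * L)"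
      unfolding \<Phi>_def by (rule add_mono)
    also have "\<dots> = ennreal (4 * H * H * L / 2 ^ 0)"
      using H0 0 by (simp add: ennreal_mult[symmetric] ennreal_plus[symmetric] del: ennreal_plus)
    finally show ?case by (simp add: add_increasing)
  next
    case (Suc n)
    let ?Q = "{a..<a + L}"
    obtain I :: "(real \<times> real) set" where I: "countable I"
      "disjoint_family_on (\<lambda>(b, l). {b..<b + l}) I"
      and I3: "\<And>b l. (b, l) \<in> I \<Longrightarrow> l > 0 \<and> {b..<b + l} \<subseteq> ?Q \<and> cmod (c a L - c b l) \<le> 2 * \<alpha> b l"
      and I4: "(\<integral>\<^sup>+(b, l). ennreal l \<partial>count_space I) \<le> ennreal (L / 2)"
      and I5: "\<And>x. x \<in> ?Q - (\<Union>(b, l)\<in>I. {b..<b + l}) \<Longrightarrow> cmod (h x - c a L) \<le> \<alpha> a L"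
      by (rule oscillation_stopping[where c = c and \<alpha> = \<alpha> and h = h, OF h Suc.prems osc mono]) auto
    let ?D = "\<lambda>(b, l). {b..<b + l} :: real set"
    define J where "J = (\<Union>p\<in>I. ?D p)"
    have Jm[measurable]: "J \<in> sets lebesgue" unfolding J_def
      using I(1) by (intro sets.countable_UN'') auto
    have Jsub: "J \<subseteq> ?Q"
    proof
      fix x assume "x \<in> J"
      then obtain b l where "(b, l) \<in> I" "x \<in> {b..<b + l}" by (auto simp: J_def)
      then show "x \<in> ?Q" using I3[of b l] by blast
    qed
    have intJ: "(\<integral>\<^sup>+x\<in>J. f x \<partial>lebesgue) = (\<integral>\<^sup>+p. (\<integral>\<^sup>+x\<in>?D p. f x \<partial>lebesgue) \<partial>count_space I)"
      if "f \<in> borel_measurable lebesgue" for f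
      unfolding J_def using I that by (intro set_nn_integral_UN_countable) auto
    have split: "(\<integral>\<^sup>+x\<in>?Q. f x \<partial>lebesgue) = (\<integral>\<^sup>+x\<in>?Q - J. f x \<partial>lebesgue) + (\<integral>\<^sup>+x\<in>J. f x \<partial>lebesgue)"
      if [measurable]: "f \<in> borel_measurable lebesgue" for f
    proof -
      have "(\<integral>\<^sup>+x\<in>?Q. f x \<partial>lebesgue) = (\<integral>\<^sup>+x. f x * indicator (?Q - J) x + f x * indicator J x \<partial>lebesgue)"
        using Jsub by (intro nn_integral_cong) (auto split: split_indicator)
      also have "\<dots> = (\<integral>\<^sup>+x\<in>?Q - J. f x \<partial>lebesgue) + (\<integral>\<^sup>+x\<in>J. f x \<partial>lebesgue)"
        by (rule nn_integral_add; measurable)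
      finally show ?thesis .
    qed
    have Jle: "emeasure lebesgue J \<le> ennreal (L / 2)"
    proof -
      have "emeasure lebesgue J = (\<integral>\<^sup>+p. emeasure lebesgue (?D p) \<partial>count_space I)"
        unfolding J_def using I by (intro emeasure_UN_countable) auto
      also have "\<dots> = (\<integral>\<^sup>+(b, l). ennreal l \<partial>count_space I)"
      proof (intro nn_integral_cong, clarify)
        fix b l assume "(b, l) \<in> space (count_space I)"
        then show "emeasure lebesgue {b..<b + l} = ennreal l" using I3[of b l] emeasure_lebesgue_Ico[of l b] by auto
      qed
      finally show ?thesis using I4 by simp
    qed
    have compl: "ennreal (L / 2) \<le> emeasure lebesgue (?Q - J)"
    proof -
      have "ennreal L = emeasure lebesgue ?Q" using Suc.prems by (intro emeasure_lebesgue_Ico[symmetric]) auto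
      also have "\<dots> \<le> emeasure lebesgue (?Q - J) + emeasure lebesgue J"
        by (intro order_trans[OF emeasure_mono emeasure_subadditive]) auto
      also have "\<dots> \<le> emeasure lebesgue (?Q - J) + ennreal (L / 2)" using Jle by (intro add_left_mono)
      finally have "ennreal (L / 2) + ennreal (L / 2) \<le> emeasure lebesgue (?Q - J) + ennreal (L / 2)"
        using Suc.prems by (simp add: ennreal_plus[symmetric] del: ennreal_plus)
      then show ?thesis by (metis add.commute ennreal_add_left_cancel_le ennreal_neq_top infinity_ennreal_def)
    qed
    \<comment> \<open>Average the pointwise bounds \<open>\<alpha> a L \<le> V x\<close> and
      \<open>G a L \<le> L * U x\<close> over the leftover set, whose measure is at least
      \<open>L / 2\<close>; the quotient of \<open>L\<close> by \<open>L / 2\<close> is the factor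
      2.\<close>
    have good: "ennreal (\<alpha> a L) * G a L \<le> 2 * (\<integral>\<^sup>+x\<in>?Q - J. V x * U x \<partial>lebesgue)"
    proof -
      have "ennreal (L / 2) * (ennreal (\<alpha> a L) * G a L) \<le> emeasure lebesgue (?Q - J) * (ennreal (\<alpha> a L) * G a L)"
        using compl by (rule mult_right_mono) simp
      also have "\<dots> = (\<integral>\<^sup>+x\<in>?Q - J. ennreal (\<alpha> a L) * G a L \<partial>lebesgue)"
        by (subst nn_integral_cmult_indicator) (auto simp: mult.commute)
      also have "\<dots> \<le> (\<integral>\<^sup>+x. ennreal L * (V x * U x * indicator (?Q - J) x) \<partial>lebesgue)"
      proof (intro nn_integral_mono)
        fix x
        show "ennreal (\<alpha> a L) * G a L * indicator (?Q - J) x \<le> ennreal L * (V x * U x * indicator (?Q - J) x)"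
        proof (cases "x \<in> ?Q - J")
          case True
          then have "ennreal (\<alpha> a L) * G a L \<le> V x * (ennreal L * U x)"
            using \<alpha>V[OF Suc.prems, of x a] gU[OF Suc.prems, of x a] by (intro mult_mono) (auto simp: G_def)
          then show ?thesis using True by (simp add: mult_ac)
        qed auto
      qed
      also have "\<dots> = ennreal L * (\<integral>\<^sup>+x\<in>?Q - J. V x * U x \<partial>lebesgue)"
        by (intro nn_integral_cmult) measurable
      finally have "ennreal (2 / L) * (ennreal (L / 2) * (ennreal (\<alpha> a L) * G a L))
          \<le> ennreal (2 / L) * (ennreal L * (\<integral>\<^sup>+x\<in>?Q - J. V x * U x \<partial>lebesgue))"
        by (rule mult_left_mono) simp
      then show ?thesis using Suc.prems
        unfolding mult.assoc[symmetric] by (simp add: ennreal_mult[symmetric])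
    qed
    have piece: "(\<integral>\<^sup>+x\<in>{b..<b + l}. ennreal (cmod (h x - c a L)) * g x \<partial>lebesgue) \<le> \<Phi> b l" if "(b, l) \<in> I" for b l
    proof -
      have "(\<integral>\<^sup>+x\<in>{b..<b + l}. ennreal (cmod (h x - c a L)) * g x \<partial>lebesgue)
        \<le> (\<integral>\<^sup>+x. ennreal (cmod (h x - c b l)) * g x * indicator {b..<b + l} x + 2 * ennreal (\<alpha> b l) * (g x * indicator {b..<b + l} x) \<partial>lebesgue)"
      proof (intro nn_integral_mono)
        fix x
        have "cmod (h x - c a L) \<le> cmod (h x - c b l) + 2 * \<alpha> b l"
          using norm_triangle_ineq4[of "h x - c b l" "c a L - c b l"] I3[OF that] by simp
        then have "ennreal (cmod (h x - c a L)) \<le> ennreal (cmod (h x - c b l)) + 2 * ennreal (\<alpha> b l)"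
          using \<alpha>0[of l b] I3[OF that] by (simp add: ennreal_mult'[symmetric] ennreal_plus[symmetric] ennreal_leI del: ennreal_plus flip: ennreal_numeral)
        then have "ennreal (cmod (h x - c a L)) * (g x * indicator {b..<b + l} x)
          \<le> (ennreal (cmod (h x - c b l)) + 2 * ennreal (\<alpha> b l)) * (g x * indicator {b..<b + l} x)"
          by (rule mult_right_mono) simp
        then show "ennreal (cmod (h x - c a L)) * g x * indicator {b..<b + l} x
           \<le> ennreal (cmod (h x - c b l)) * g x * indicator {b..<b + l} x + 2 * ennreal (\<alpha> b l) * (g x * indicator {b..<b + l} x)"
          by (simp add: distrib_left distrib_right mult_ac)
      qed
      also have "\<dots> = \<Phi> b l"
        unfolding \<Phi>_def G_def by (subst nn_integral_add) (auto simp: nn_integral_cmult)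
      finally show ?thesis .
    qed
    have "(\<integral>\<^sup>+x\<in>?Q. ennreal (cmod (h x - c a L)) * g x \<partial>lebesgue)
        = (\<integral>\<^sup>+x\<in>?Q - J. ennreal (cmod (h x - c a L)) * g x \<partial>lebesgue) +
          (\<integral>\<^sup>+p. (\<integral>\<^sup>+x\<in>?D p. ennreal (cmod (h x - c a L)) * g x \<partial>lebesgue) \<partial>count_space I)"
      by (subst split, measurable, subst intJ) auto
    also have "\<dots> \<le> ennreal (\<alpha> a L) * G a L + (\<integral>\<^sup>+(b, l). \<Phi> b l \<partial>count_space I)"
    proof (intro add_mono)
      have "(\<integral>\<^sup>+x\<in>?Q - J. ennreal (cmod (h x - c a L)) * g x \<partial>lebesgue) \<le> (\<integral>\<^sup>+x. ennreal (\<alpha> a L) * (g x * indicator ?Q x) \<partial>lebesgue)"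
      proof (intro nn_integral_mono)
        fix x
        show "ennreal (cmod (h x - c a L)) * g x * indicator (?Q - J) x \<le> ennreal (\<alpha> a L) * (g x * indicator ?Q x)"
        proof (cases "x \<in> ?Q - J")
          case True
          then have "cmod (h x - c a L) \<le> \<alpha> a L" using I5[of x] by (auto simp: J_def)
          then show ?thesis using True by (auto intro!: mult_right_mono ennreal_leI)
        qed auto
      qed
      also have "\<dots> = ennreal (\<alpha> a L) * G a L" unfolding G_def by (intro nn_integral_cmult) measurable
      finally show "(\<integral>\<^sup>+x\<in>?Q - J. ennreal (cmod (h x - c a L)) * g x \<partial>lebesgue) \<le> ennreal (\<alpha> a L) * G a L" .
      show "(\<integral>\<^sup>+p. (\<integral>\<^sup>+x\<in>?D p. ennreal (cmod (h x - c a L)) * g x \<partial>lebesgue) \<partial>count_space I) \<le> (\<integral>\<^sup>+(b, l). \<Phi> b l \<partial>count_space I)"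
        using piece by (intro nn_integral_mono) auto
    qed
    \<comment> \<open>One copy of \<open>\<alpha> a L * G a L\<close> comes from the points outside
      the children, two come from the definition of \<open>\<Phi>\<close>.\<close>
    finally have "\<Phi> a L \<le> ennreal (\<alpha> a L) * G a L + (\<integral>\<^sup>+(b, l). \<Phi> b l \<partial>count_space I) + 2 * ennreal (\<alpha> a L) * G a L"
      unfolding \<Phi>_def[of a L] by (rule add_right_mono)
    also have "\<dots> = 3 * (ennreal (\<alpha> a L) * G a L) + (\<integral>\<^sup>+(b, l). \<Phi> b l \<partial>count_space I)"
    proof -
      have "x + y + 2 * z * w = 3 * x + y" if "x = z * w" for x y z w :: ennreal
        using distrib_right[of 1 2 x] by (simp add: that add_ac mult.assoc)
      then show ?thesis by blast
    qed
    also have "\<dots> \<le> 3 * (2 * (\<integral>\<^sup>+x\<in>?Q - J. V x * U x \<partial>lebesgue)) +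
       (\<integral>\<^sup>+p. 6 * (\<integral>\<^sup>+x\<in>?D p. V x * U x \<partial>lebesgue) + ennreal (4 * H * H / 2 ^ n) * (\<lambda>(b, l). ennreal l) p \<partial>count_space I)"
    proof (intro add_mono mult_left_mono good nn_integral_mono)
      fix p assume "p \<in> space (count_space I)"
      then obtain b l where p: "p = (b, l)" "(b, l) \<in> I" by (cases p) auto
      then have "l > 0" using I3 by auto
      then show "(\<lambda>(b, l). \<Phi> b l) p \<le> 6 * (\<integral>\<^sup>+x\<in>?D p. V x * U x \<partial>lebesgue) + ennreal (4 * H * H / 2 ^ n) * (\<lambda>(b, l). ennreal l) p"
        using Suc.IH[of l b] H0 unfolding p by (simp add: ennreal_mult[symmetric])
    qed auto
    also have "\<dots> = 6 * (\<integral>\<^sup>+x\<in>?Q - J. V x * U x \<partial>lebesgue) + (6 * (\<integral>\<^sup>+x\<in>J. V x * U x \<partial>lebesgue) +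
        ennreal (4 * H * H / 2 ^ n) * (\<integral>\<^sup>+(b, l). ennreal l \<partial>count_space I))"
      by (subst intJ) (auto simp: nn_integral_add nn_integral_cmult mult.assoc[symmetric])
    also have "\<dots> \<le> 6 * (\<integral>\<^sup>+x\<in>?Q - J. V x * U x \<partial>lebesgue) + (6 * (\<integral>\<^sup>+x\<in>J. V x * U x \<partial>lebesgue) +
        ennreal (4 * H * H / 2 ^ n) * ennreal (L / 2))"
      by (intro add_left_mono mult_left_mono I4) auto
    also have "\<dots> = 6 * (\<integral>\<^sup>+x\<in>?Q. V x * U x \<partial>lebesgue) + ennreal (4 * H * H * L / 2 ^ Suc n)"
      using H0 Suc.prems by (subst split) (auto simp: distrib_left add.assoc ennreal_mult[symmetric] mult_ac)
    finally show ?case .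
  qed
  note main = this
  have "\<Phi> a L \<le> 6 * (\<integral>\<^sup>+x\<in>{a..<a + L}. V x * U x \<partial>lebesgue)"
  proof (rule ennreal_le_epsilon)
    fix e :: real assume e: "e > 0"
    obtain n where "(1/2) ^ n < e / (4 * H * H * L + 1)"
      using real_arch_pow_inv[of "e / (4 * H * H * L + 1)" "1/2"] e H0 L
      by (auto simp: add_nonneg_pos)
    then have "4 * H * H * L / 2 ^ n \<le> e"
    proof -
      have "4 * H * H * L * (1/2) ^ n \<le> (4 * H * H * L + 1) * (1/2) ^ n" by simp
      also have "\<dots> \<le> (4 * H * H * L + 1) * (e / (4 * H * H * L + 1))"
        using \<open>(1/2) ^ n < _\<close> H0 L by (intro mult_left_mono) auto
      also have "\<dots> = e" using H0 L by (simp add: add_nonneg_pos less_imp_neq[symmetric] add_nonneg_eq_0_iff)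
      finally show ?thesis by (simp add: power_divide)
    qed
    then show "\<Phi> a L \<le> 6 * (\<integral>\<^sup>+x\<in>{a..<a + L}. V x * U x \<partial>lebesgue) + ennreal e"
      using main[OF L, of a n] by (meson add_left_mono ennreal_leI order_trans)
  qed
  then show ?thesis unfolding \<Phi>_def by (meson add_increasing2 order_refl order_trans zero_le le_iff_add)
qed

section \<open>The maximal operator\<close>

lemma suminf_half_ennreal: "(\<Sum>n. ennreal ((1/2) ^ n)) = 2"
proof -
  have "(\<lambda>n. (1/2::real) ^ n) sums 2" using geometric_sums[of "1/2::real"] by simp
  then show ?thesis by (subst suminf_ennreal_eq) auto
qed

text \<open>On the shell of radii between \<open>2 ^ n * l\<close> and
  \<open>2 ^ (n + 1) * l\<close> the weight is at most \<open>1 / (4 ^ n * l^2)\<close>, while the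
  integral of \<open>f\<close> is at most \<open>2 ^ (n + 2) * l * m\<close>; the products sum
  geometrically to \<open>8 / l * m\<close>.\<close>

lemma nn_integral_inverse_square_tail:
  fixes f :: "real \<Rightarrow> ennreal" and m :: ennreal
  assumes [measurable]: "f \<in> borel_measurable lebesgue" and l: "l > 0"
    and avg: "\<And>s. s \<ge> l \<Longrightarrow> (\<integral>\<^sup>+y\<in>{c - s..c + s}. f y \<partial>lebesgue) \<le> ennreal (2 * s) * m"
  shows "(\<integral>\<^sup>+y\<in>{y. l \<le> \<bar>y - c\<bar>}. f y * ennreal (1 / (y - c)\<^sup>2) \<partial>lebesgue) \<le> ennreal (8 / l) * m"
proof -
  define s where "s n = 2 ^ Suc n * l" for n :: nat
  have sl: "s n \<ge> l" for n
  proof -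
    have "1 * l \<le> 2 ^ Suc n * l" using l by (intro mult_right_mono one_le_power) auto
    then show ?thesis by (simp add: s_def)
  qed
  have "(\<integral>\<^sup>+y\<in>{y. l \<le> \<bar>y - c\<bar>}. f y * ennreal (1 / (y - c)\<^sup>2) \<partial>lebesgue)
      \<le> (\<integral>\<^sup>+y. (\<Sum>n. ennreal (1 / (4 ^ n * l\<^sup>2)) * (f y * indicator {c - s n..c + s n} y)) \<partial>lebesgue)"
  proof (intro nn_integral_mono)
    fix y :: real
    show "f y * ennreal (1 / (y - c)\<^sup>2) * indicator {y. l \<le> \<bar>y - c\<bar>} y \<le> (\<Sum>n. ennreal (1 / (4 ^ n * l\<^sup>2)) * (f y * indicator {c - s n..c + s n} y))"
    proof (cases "l \<le> \<bar>y - c\<bar>")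
      case True
      have ex: "\<exists>n. \<bar>y - c\<bar> < s n"
      proof -
        obtain n where "\<bar>y - c\<bar> / l < 2 ^ n" using real_arch_pow[of 2 "\<bar>y - c\<bar> / l"] by auto
        then have "\<bar>y - c\<bar> < 2 ^ n * l" using l by (simp add: field_simps)
        also have "\<dots> \<le> s n" using l by (simp add: s_def)
        finally show ?thesis by blast
      qed
      \<comment> \<open>The least such index puts \<open>y\<close> in a shell: it is beyond radius
        \<open>2 ^ n * l\<close> by minimality, or by the case assumption if
        \<open>n = 0\<close>.\<close>
      define n where "n = (LEAST n. \<bar>y - c\<bar> < s n)"
      have n1: "\<bar>y - c\<bar> < s n" unfolding n_def by (rule LeastI_ex[OF ex])
      have n2: "2 ^ n * l \<le> \<bar>y - c\<bar>"
      proof (cases n)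
        case 0 then show ?thesis using True by simp
      next
        case (Suc k)
        then have "\<not> \<bar>y - c\<bar> < s k" using not_less_Least[of k "\<lambda>n. \<bar>y - c\<bar> < s n"] by (simp add: n_def)
        then show ?thesis using Suc by (simp add: s_def)
      qed
      have "4 ^ n * l\<^sup>2 = (2 ^ n * l)\<^sup>2" by (simp add: power2_eq_square power_mult_distrib[symmetric] mult_ac)
      also have "\<dots> \<le> \<bar>y - c\<bar>\<^sup>2" using n2 l by (intro power_mono) auto
      finally have sq: "4 ^ n * l\<^sup>2 \<le> (y - c)\<^sup>2" by simp
      have "f y * ennreal (1 / (y - c)\<^sup>2) \<le> f y * ennreal (1 / (4 ^ n * l\<^sup>2))"
        using l True by (intro mult_left_mono ennreal_leI divide_left_mono sq) auto
      also have "\<dots> = (\<Sum>n\<in>{n}. ennreal (1 / (4 ^ n * l\<^sup>2)) * (f y * indicator {c - s n..c + s n} y))"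
        using n1 by (auto simp: mult.commute indicator_def abs_less_iff)
      also have "\<dots> \<le> (\<Sum>n. ennreal (1 / (4 ^ n * l\<^sup>2)) * (f y * indicator {c - s n..c + s n} y))"
        by (intro sum_le_suminf) auto
      finally show ?thesis using True by simp
    qed simp
  qed
  also have "\<dots> = (\<Sum>n. \<integral>\<^sup>+y. ennreal (1 / (4 ^ n * l\<^sup>2)) * (f y * indicator {c - s n..c + s n} y) \<partial>lebesgue)"
    by (intro nn_integral_suminf) measurable
  also have "\<dots> = (\<Sum>n. ennreal (1 / (4 ^ n * l\<^sup>2)) * (\<integral>\<^sup>+y\<in>{c - s n..c + s n}. f y \<partial>lebesgue))"
    by (intro suminf_cong nn_integral_cmult) measurable
  also have "\<dots> \<le> (\<Sum>n. ennreal (1 / (4 ^ n * l\<^sup>2)) * (ennreal (2 * s n) * m))"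
    by (intro suminf_le mult_left_mono avg sl) auto
  also have "\<dots> = (\<Sum>n. (ennreal (4 / l) * m) * ennreal ((1/2) ^ n))"
  proof (intro suminf_cong)
    fix n
    have "1 / (4 ^ n * l\<^sup>2) * (2 * s n) = 4 / l * (1/2) ^ n"
    proof -
      have "1 / (p * p * l\<^sup>2) * (2 * (2 * p * l)) = 4 / l * (1 / p)" if "p > 0" for p :: real
        using l that by (simp add: field_simps power2_eq_square)
      moreover have "(4::real) ^ n = 2 ^ n * 2 ^ n" by (simp flip: power_mult_distrib)
      ultimately show ?thesis by (simp add: s_def power_divide)
    qed
    then have "ennreal (1 / (4 ^ n * l\<^sup>2)) * ennreal (2 * s n) = ennreal (4 / l) * ennreal ((1/2) ^ n)"
      using l by (simp only: ennreal_mult'[symmetric] ennreal_mult''[symmetric] zero_le_divide_1_iff zero_le_mult_iff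
        zero_le_power zero_le_numeral zero_le_power2 s_def less_imp_le simp_thms divide_nonneg_pos)
    then show "ennreal (1 / (4 ^ n * l\<^sup>2)) * (ennreal (2 * s n) * m) = (ennreal (4 / l) * m) * ennreal ((1/2) ^ n)"
      by (metis mult.assoc mult.commute)
  qed
  also have "\<dots> = (ennreal (4 / l) * m) * 2"
    by (simp add: suminf_half_ennreal)
  also have "\<dots> = ennreal (8 / l) * m"
  proof -
    have "ennreal (8 / l) = ennreal (4 / l) * 2" using l by (simp add: ennreal_mult'[symmetric] flip: ennreal_numeral)
    then show ?thesis by (simp add: mult_ac)
  qed
  finally show ?thesis .
qed

lemma set_nn_integral_le_maximal_op:
  assumes "a < b" "x \<in> {a..b}" "S \<subseteq> {a..b}"
  shows "(\<integral>\<^sup>+y\<in>S. f y \<partial>lebesgue) \<le> ennreal (b - a) * maximal_op f x"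
proof -
  have "(\<integral>\<^sup>+y\<in>S. f y \<partial>lebesgue) \<le> (\<integral>\<^sup>+y\<in>{a..b}. f y \<partial>lebesgue)"
    using assms by (intro nn_integral_mono) (auto split: split_indicator)
  also have "\<dots> = ennreal (b - a) * ((\<integral>\<^sup>+y\<in>{a..b}. f y \<partial>lebesgue) / emeasure lebesgue {a..b})"
    using assms by (simp add: ennreal_times_divide mult.commute[of "ennreal (b - a)"] mult_divide_eq_ennreal)
  also have "\<dots> \<le> ennreal (b - a) * maximal_op f x"
    unfolding maximal_op_def using assms by (intro mult_left_mono SUP_upper) auto
  finally show ?thesis .
qed

lemma maximal_op_le:
  assumes "\<And>x. f x \<le> c"
  shows "maximal_op f x \<le> c"
  unfolding maximal_op_def
proof (rule SUP_least, clarify)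
  fix a b :: real assume ab: "a < b" "x \<in> {a..b}"
  have "(\<integral>\<^sup>+y\<in>{a..b}. f y \<partial>lebesgue) \<le> (\<integral>\<^sup>+y\<in>{a..b}. c \<partial>lebesgue)"
    using assms by (intro nn_integral_mono mult_right_mono) auto
  also have "\<dots> = c * emeasure lebesgue {a..b}" by (rule nn_integral_cmult_indicator) auto
  finally show "(\<integral>\<^sup>+y\<in>{a..b}. f y \<partial>lebesgue) / emeasure lebesgue {a..b} \<le> c"
    using ab by (intro divide_le_posI_ennreal) (auto simp: mult.commute)
qed

text \<open>A strict inequality for the mean over \<open>[a, b]\<close> survives a small enlargement
  of the interval, and the enlarged interval contains a neighbourhood of \<open>x\<close>. This
  lower semicontinuity is how the maximal function becomes measurable.\<close>

lemma open_maximal_op_superlevel: "open {x. y < maximal_op f x}"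
proof (rule openI)
  fix x assume "x \<in> {x. y < maximal_op f x}"
  then obtain a b where ab: "a < b" "a \<le> x" "x \<le> b"
    and y: "y < (\<integral>\<^sup>+t\<in>{a..b}. f t \<partial>lebesgue) / emeasure lebesgue {a..b}"
    unfolding maximal_op_def by (auto simp: less_SUP_iff simp del: emeasure_completion)
  define I where "I = (\<integral>\<^sup>+t\<in>{a..b}. f t \<partial>lebesgue)"
  obtain l where l: "y = ennreal l" "l \<ge> 0" using y by (cases y) auto
  have "\<exists>d>0. y < I / ennreal (b - a + 2 * d)"
  proof (cases I)
    case (real r)
    have lr: "l * (b - a) < r"
    proof -
      have "ennreal l < ennreal (r / (b - a))"
        using y real l ab unfolding I_def[symmetric] by (simp add: divide_ennreal)
      then show ?thesis using l ab by (simp add: ennreal_less_iff field_simps)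
    qed
    \<comment> \<open>The enlargement adds \<open>2 * d\<close> to the length, so
      \<open>l * (2 * d)\<close> has to fit into the gap \<open>r - l * (b - a)\<close>; this choice
      uses at most half of it, with \<open>l + 1\<close> in case \<open>l = 0\<close>.\<close>
    define d where "d = (r - l * (b - a)) / (4 * (l + 1))"
    have d: "d > 0" using lr l by (simp add: d_def)
    have "l * (2 * d) < r - l * (b - a)"
    proof -
      have "l * (2 * d) \<le> (l + 1) * (2 * d)" using d by (intro mult_right_mono) auto
      also have "\<dots> = (r - l * (b - a)) / 2" using l by (simp add: d_def field_simps)
      finally show ?thesis using lr by simp
    qed
    then have "l < r / (b - a + 2 * d)" using ab d by (simp add: field_simps)
    then have "y < I / ennreal (b - a + 2 * d)"
      using l ab d real by (simp add: divide_ennreal ennreal_less_iff del: ennreal_plus)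
    then show ?thesis using d by blast
  next
    case top
    then show ?thesis using l by (intro exI[of _ 1]) (auto simp: ennreal_top_divide)
  qed
  then obtain d where d: "d > 0" "y < I / ennreal (b - a + 2 * d)" by blast
  show "\<exists>e>0. ball x e \<subseteq> {x. y < maximal_op f x}"
  proof (intro exI[of _ d] conjI subsetI, rule d)
    fix z assume "z \<in> ball x d"
    then have z: "z \<in> {a - d..b + d}" using ab by (auto simp: dist_real_def abs_real_def split: if_splits)
    have "I / ennreal (b - a + 2 * d) \<le> (\<integral>\<^sup>+t\<in>{a - d..b + d}. f t \<partial>lebesgue) / emeasure lebesgue {a - d..b + d}"
      unfolding I_def using ab d
      by (auto intro!: divide_right_mono_ennreal nn_integral_mono simp: algebra_simps split: split_indicator)
    also have "\<dots> \<le> maximal_op f z"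
      unfolding maximal_op_def using ab d z by (intro SUP_upper) auto
    finally show "z \<in> {x. y < maximal_op f x}" using d by auto
  qed
qed

lemma borel_measurable_maximal_op [measurable]: "maximal_op f \<in> borel_measurable lebesgue"
proof (rule borel_measurableI_greater)
  fix y :: ennreal
  show "{x \<in> space lebesgue. y < maximal_op f x} \<in> sets lebesgue"
    using borel_open[OF open_maximal_op_superlevel[of y f]] by auto
qed

text \<open>The core class on which all operators are defined: it is contained in L1, in L2 and in
  every space considered, contains the test functions, and is stable under cutting with measurable
  sets, as the decompositions require. One \<open>m\<close> serves both as bound and as radius of
  the support, and the conditions hold everywhere, not just a.e.\<close>

definition bounded_bounded_support :: "(real \<Rightarrow> complex) \<Rightarrow> bool" where
  "bounded_bounded_support f \<longleftrightarrow> f \<in> borel_measurable lebesgue \<and>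
     (\<exists>m. \<forall>x. cmod (f x) \<le> m \<and> (m < \<bar>x\<bar> \<longrightarrow> f x = 0))"

lemma bounded_bounded_supportI:
  assumes "f \<in> borel_measurable lebesgue" "\<And>x. cmod (f x) \<le> m" "\<And>x. r < \<bar>x\<bar> \<Longrightarrow> f x = 0"
  shows "bounded_bounded_support f"
  unfolding bounded_bounded_support_def using assms
  by (intro conjI exI[of _ "max m r"]) (auto intro: max.coboundedI1)

lemma bounded_bounded_supportE:
  assumes "bounded_bounded_support f"
  obtains m where "m > 0" "\<And>x. cmod (f x) \<le> m" "\<And>x. m < \<bar>x\<bar> \<Longrightarrow> f x = 0" "f \<in> borel_measurable lebesgue"
proof -
  obtain m where m: "\<forall>x. cmod (f x) \<le> m \<and> (m < \<bar>x\<bar> \<longrightarrow> f x = 0)" and "f \<in> borel_measurable lebesgue"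
    using assms unfolding bounded_bounded_support_def by blast
  moreover have "m + 1 > 0" using m norm_ge_zero[of "f 0"] by (smt (verit))
  ultimately show thesis by (intro that[of "m + 1"]) (auto intro: order_trans[of _ m])
qed

lemma bounded_bounded_support_measurable: "bounded_bounded_support f \<Longrightarrow> f \<in> borel_measurable lebesgue"
  by (simp add: bounded_bounded_support_def)

lemma bounded_bounded_support_mult:
  assumes f: "bounded_bounded_support f" and g: "g \<in> borel_measurable lebesgue" "\<And>x. cmod (g x) \<le> N"
  shows "bounded_bounded_support (\<lambda>x. g x * f x)"
proof -
  obtain m where m: "m > 0" "\<And>x. cmod (f x) \<le> m" "\<And>x. m < \<bar>x\<bar> \<Longrightarrow> f x = 0" "f \<in> borel_measurable lebesgue"
    using bounded_bounded_supportE[OF f] by blast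
  show ?thesis
  proof (rule bounded_bounded_supportI[of _ "N * m" m])
    show "(\<lambda>x. g x * f x) \<in> borel_measurable lebesgue" using g m by measurable
    show "cmod (g x * f x) \<le> N * m" for x
      using m g(2)[of x] order_trans[OF norm_ge_zero g(2)[of x]] by (auto simp: norm_mult intro!: mult_mono)
  qed (use m in auto)
qed

lemma bounded_bounded_support_indicator:
  assumes "bounded_bounded_support f" "S \<in> sets lebesgue"
  shows "bounded_bounded_support (\<lambda>x. indicator S x * f x)"
  using assms by (intro bounded_bounded_support_mult[where N = 1]) (auto split: split_indicator)

lemma bounded_bounded_support_cmult: "bounded_bounded_support f \<Longrightarrow> bounded_bounded_support (\<lambda>x. a * f x)"
  by (rule bounded_bounded_support_mult[where N = "cmod a"]) auto

lemma bounded_bounded_support_add: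
  assumes "bounded_bounded_support f" "bounded_bounded_support g"
  shows "bounded_bounded_support (\<lambda>x. f x + g x)"
proof -
  obtain m where m: "m > 0" "\<And>x. cmod (f x) \<le> m" "\<And>x. m < \<bar>x\<bar> \<Longrightarrow> f x = 0" "f \<in> borel_measurable lebesgue"
    using bounded_bounded_supportE[OF assms(1)] by blast
  obtain n where n: "n > 0" "\<And>x. cmod (g x) \<le> n" "\<And>x. n < \<bar>x\<bar> \<Longrightarrow> g x = 0" "g \<in> borel_measurable lebesgue"
    using bounded_bounded_supportE[OF assms(2)] by blast
  show ?thesis
  proof (rule bounded_bounded_supportI[of _ "m + n" "m + n"])
    show "(\<lambda>x. f x + g x) \<in> borel_measurable lebesgue" using m n by measurable
    show "cmod (f x + g x) \<le> m + n" for x using m n by (intro norm_triangle_le add_mono)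
    show "f x + g x = 0" if "m + n < \<bar>x\<bar>" for x using m n that by simp
  qed
qed

lemma bounded_bounded_support_diff:
  assumes "bounded_bounded_support f" "bounded_bounded_support g"
  shows "bounded_bounded_support (\<lambda>x. f x - g x)"
  using bounded_bounded_support_add[OF assms(1) bounded_bounded_support_cmult[OF assms(2), of "-1"]] by simp

lemma bounded_bounded_support_integrable:
  assumes "bounded_bounded_support f"
  shows "integrable lebesgue f"
proof -
  obtain m where m: "m > 0" "\<And>x. cmod (f x) \<le> m" "\<And>x. m < \<bar>x\<bar> \<Longrightarrow> f x = 0" "f \<in> borel_measurable lebesgue"
    using bounded_bounded_supportE[OF assms(1)] by blast
  show ?thesis
  proof (rule Bochner_Integration.integrable_bound)
    show "integrable lebesgue (\<lambda>x. indicator {-m..m} x * m)"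
      using m by (intro integrable_mult_left) auto
    show "AE x in lebesgue. norm (f x) \<le> norm (indicator {-m..m} x * m)"
    proof (intro AE_I2)
      fix x show "norm (f x) \<le> norm (indicator {-m..m} x * m)"
        using m(1) m(2)[of x] m(3)[of x] by (cases "x \<in> {-m..m}") (auto simp: abs_le_iff not_less[symmetric])
    qed
  qed (rule m)
qed

lemma norm_integral_UN_countable_le:
  fixes F :: "'a \<Rightarrow> 'b::{banach, second_countable_topology}"
  assumes "countable I" and A: "\<And>i. i \<in> I \<Longrightarrow> A i \<in> sets M" and disj: "disjoint_family_on A I" and F: "integrable M F"
    and zero: "\<And>x. x \<notin> (\<Union>i\<in>I. A i) \<Longrightarrow> F x = 0"
  shows "ennreal (norm (\<integral>x. F x \<partial>M)) \<le> (\<integral>\<^sup>+i. ennreal (norm (\<integral>x. indicator (A i) x *\<^sub>R F x \<partial>M)) \<partial>count_space I)"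
proof -
  define e where "e = to_nat_on I"
  have inj: "inj_on e I" unfolding e_def by (rule inj_on_to_nat_on[OF \<open>countable I\<close>])
  define A' where "A' n = (\<Union>i\<in>{i \<in> I. e i = n}. A i)" for n
  have A'e: "A' (e i) = A i" if "i \<in> I" for i
    using that inj by (auto simp: A'_def inj_on_def)
  have A'm: "A' n \<in> sets M" for n
    unfolding A'_def using A \<open>countable I\<close> by (intro sets.countable_UN'') (auto intro: countable_subset)
  have U: "(\<Union>n. A' n) = (\<Union>i\<in>I. A i)" by (auto simp: A'_def)
  have F': "(\<lambda>x. indicator (\<Union>n. A' n) x *\<^sub>R F x) = F"
    using zero unfolding U by (auto simp: fun_eq_iff split: split_indicator)
  have disj': "A' i \<inter> A' j = {}" if "i \<noteq> j" for i j
  proof (rule equals0I)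
    fix x assume "x \<in> A' i \<inter> A' j"
    then obtain p q where pq: "p \<in> I" "e p = i" "x \<in> A p" "q \<in> I" "e q = j" "x \<in> A q"
      by (auto simp: A'_def)
    then have "A p \<inter> A q = {}" using disj that by (intro disjoint_family_onD) auto
    then show False using pq by blast
  qed
  define G where "G n = ennreal (norm (\<integral>x. indicator (A' n) x *\<^sub>R F x \<partial>M))" for n
  have "(\<integral>x. F x \<partial>M) = (\<Sum>n. \<integral>x. indicator (A' n) x *\<^sub>R F x \<partial>M)"
  proof -
    have "(LINT x:(\<Union>n. A' n)|M. F x) = (\<Sum>n. LINT x:(A' n)|M. F x)"
    proof (rule lebesgue_integral_countable_add)
      show "set_integrable M (\<Union>n. A' n) F" unfolding set_integrable_def using F F' by simp
    qed (use A'm disj' in auto)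
    then show ?thesis unfolding set_lebesgue_integral_def using F' by simp
  qed
  \<comment> \<open>If the norms are not summable, the sum on the left carries no information, but
    the right-hand side is \<open>top\<close>.\<close>
  moreover have "ennreal (norm (\<Sum>n. a n)) \<le> (\<Sum>n. ennreal (norm (a n)))" for a :: "nat \<Rightarrow> 'b"
  proof (cases "summable (\<lambda>n. norm (a n))")
    case True
    then show ?thesis by (subst suminf_ennreal2) (auto intro!: ennreal_leI summable_norm)
  next
    case False
    have "(\<Sum>n. ennreal (norm (a n))) = top"
      using False summable_suminf_not_top[of "\<lambda>n. norm (a n)", OF norm_ge_zero] by blast
    then show ?thesis by simp
  qed
  ultimately have "ennreal (norm (\<integral>x. F x \<partial>M)) \<le> (\<Sum>n. G n)" unfolding G_def by simp
  also have "\<dots> = (\<integral>\<^sup>+n. G n \<partial>count_space UNIV)" by (simp add: nn_integral_count_space_nat)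
  also have "\<dots> = (\<integral>\<^sup>+n. G n * indicator (e ` I) n \<partial>count_space UNIV)"
  proof (intro nn_integral_cong)
    fix n show "G n = G n * indicator (e ` I) n"
    proof (cases "n \<in> e ` I")
      case False
      then have "A' n = {}" by (auto simp: A'_def)
      then show ?thesis by (simp add: G_def)
    qed simp
  qed
  also have "\<dots> = (\<integral>\<^sup>+n. G n \<partial>count_space (e ` I))"
    by (rule nn_integral_count_space_indicator[symmetric]) simp
  also have "\<dots> = (\<integral>\<^sup>+i. G (e i) \<partial>count_space I)"
    using inj by (intro nn_integral_bij_count_space[symmetric]) (auto simp: bij_betw_def)
  also have "\<dots> = (\<integral>\<^sup>+i. ennreal (norm (\<integral>x. indicator (A i) x *\<^sub>R F x \<partial>M)) \<partial>count_space I)"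
    by (intro nn_integral_cong) (auto simp: G_def A'e)
  finally show ?thesis .
qed

section \<open>Singular integrals and the weak-type estimate\<close>

text \<open>\<open>B\<close> is the quantitative constant of the Lipschitz-type conditions of
  Calderon-Zygmund theory. \<open>N\<close> is qualitative: it makes \<open>T f\<close> an
  absolutely convergent integral, continuous and bounded, and it stays out of the weak-type and
  oscillation constants. The factor 2 says that the displacement is at most half the distance to the
  other variable.\<close>

locale smooth_kernel =
  fixes K :: "real \<Rightarrow> real \<Rightarrow> complex" and B N :: real
  assumes continuous_fst: "\<And>y. continuous_on UNIV (\<lambda>x. K x y)"
    and continuous_snd: "\<And>x. continuous_on UNIV (K x)"
    and bounded: "\<And>x y. cmod (K x y) \<le> N"
    and smooth_fst: "\<And>x c y. 2 * \<bar>x - c\<bar> \<le> \<bar>y - c\<bar> \<Longrightarrow> cmod (K x y - K c y) \<le> B * \<bar>x - c\<bar> / (y - c)\<^sup>2"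
    and smooth_snd: "\<And>x c y. 2 * \<bar>y - c\<bar> \<le> \<bar>x - c\<bar> \<Longrightarrow> cmod (K x y - K x c) \<le> B * \<bar>y - c\<bar> / (x - c)\<^sup>2"
    and B0: "B \<ge> 0"
    and L2_contraction: "\<And>f. bounded_bounded_support f \<Longrightarrow>
      (\<integral>\<^sup>+x. ennreal ((cmod (LINT y|lebesgue. K x y * f y))\<^sup>2) \<partial>lebesgue) \<le> (\<integral>\<^sup>+x. ennreal ((cmod (f x))\<^sup>2) \<partial>lebesgue)"
begin

definition T :: "(real \<Rightarrow> complex) \<Rightarrow> real \<Rightarrow> complex" where
  "T f x = (LINT y|lebesgue. K x y * f y)"

lemma N0: "N \<ge> 0"
  using bounded[of 0 0] norm_ge_zero order_trans by blast

lemma K_measurable [measurable]: "K x \<in> borel_measurable lebesgue"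
  using borel_measurable_continuous_onI[OF continuous_snd[of x]]
  by (intro measurable_completion) simp

lemma K_mult_bounded:
  assumes "bounded_bounded_support f"
  shows "bounded_bounded_support (\<lambda>y. K x y * f y)"
  using assms bounded by (intro bounded_bounded_support_mult) auto

lemma K_mult_integrable:
  assumes "bounded_bounded_support f"
  shows "integrable lebesgue (\<lambda>y. K x y * f y)"
  by (intro bounded_bounded_support_integrable K_mult_bounded assms)

lemma T_add:
  assumes "bounded_bounded_support f" "bounded_bounded_support g"
  shows "T (\<lambda>x. f x + g x) x = T f x + T g x"
  unfolding T_def using K_mult_integrable[OF assms(1), of x] K_mult_integrable[OF assms(2), of x]
  by (simp add: distrib_left)

text \<open>Dominated convergence with the dominating function \<open>N * cmod (f y)\<close>.
  Continuity is what makes the exceptional sets of the oscillation argument open.\<close>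

lemma T_continuous:
  assumes f: "bounded_bounded_support f"
  shows "continuous_on UNIV (T f)"
proof -
  have "(\<lambda>n. T f (u n)) \<longlonglongrightarrow> T f x" if u: "u \<longlonglongrightarrow> x" for u x
    unfolding T_def
  proof (rule integral_dominated_convergence[where w = "\<lambda>y. N * cmod (f y)"])
    show "integrable lebesgue (\<lambda>y. N * cmod (f y))"
      using bounded_bounded_support_integrable[OF f] by auto
    show "AE y in lebesgue. (\<lambda>n. K (u n) y * f y) \<longlonglongrightarrow> K x y * f y"
    proof (intro AE_I2 tendsto_mult tendsto_const)
      fix y
      show "(\<lambda>n. K (u n) y) \<longlonglongrightarrow> K x y"
        using continuous_on_tendsto_compose[OF continuous_fst[of y] u] by simp
    qed
    show "AE y in lebesgue. norm (K (u n) y * f y) \<le> N * cmod (f y)" for n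
      using bounded by (intro AE_I2) (auto simp: norm_mult intro!: mult_right_mono)
  qed (use K_mult_bounded[OF f] bounded_bounded_support_measurable in auto)
  then show ?thesis
    by (auto simp: continuous_on_sequentially o_def)
qed

lemma T_measurable:
  assumes f: "bounded_bounded_support f"
  shows "T f \<in> borel_measurable lebesgue"
  using borel_measurable_continuous_onI[OF T_continuous[OF f]]
  by (intro measurable_completion) simp

lemma T_bounded:
  assumes f: "bounded_bounded_support f"
  shows "cmod (T f x) \<le> N * (LINT y|lebesgue. cmod (f y))"
proof -
  have "cmod (T f x) \<le> (LINT y|lebesgue. cmod (K x y * f y))"
    unfolding T_def by (rule integral_norm_bound)
  also have "\<dots> \<le> (LINT y|lebesgue. N * cmod (f y))"
  proof (rule integral_mono)
    show "integrable lebesgue (\<lambda>y. cmod (K x y * f y))" using K_mult_integrable[OF f] by auto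
    show "integrable lebesgue (\<lambda>y. N * cmod (f y))" using bounded_bounded_support_integrable[OF f] by auto
    show "cmod (K x y * f y) \<le> N * cmod (f y)" for y
      using bounded by (auto simp: norm_mult intro!: mult_right_mono)
  qed
  finally show ?thesis by simp
qed

text \<open>The mean value zero of \<open>b\<close> lets \<open>K x y\<close> be replaced by \<open>K x y - K x c\<close>.\<close>

lemma T_cancellation_tail:
  assumes b: "bounded_bounded_support b" and l: "l > 0"
    and supp: "\<And>y. y \<notin> {c - l / 2..c + l / 2} \<Longrightarrow> b y = 0" and zero: "(LINT y|lebesgue. b y) = 0"
  shows "(\<integral>\<^sup>+x\<in>{x. l \<le> \<bar>x - c\<bar>}. ennreal (cmod (T b x)) \<partial>lebesgue) \<le> ennreal (4 * B) * (\<integral>\<^sup>+y. ennreal (cmod (b y)) \<partial>lebesgue)"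
proof -
  have [measurable]: "b \<in> borel_measurable lebesgue" using b by (rule bounded_bounded_support_measurable)
  define \<beta> where "\<beta> = (\<integral>\<^sup>+y. ennreal (cmod (b y)) \<partial>lebesgue)"
  have pw: "ennreal (cmod (T b x)) \<le> ennreal (B * (l / 2) / (x - c)\<^sup>2) * \<beta>" if x: "l \<le> \<bar>x - c\<bar>" for x
  proof -
    have "T b x = (LINT y|lebesgue. (K x y - K x c) * b y)"
    proof -
      have "(LINT y|lebesgue. (K x y - K x c) * b y) = (LINT y|lebesgue. K x y * b y) - (LINT y|lebesgue. K x c * b y)"
        unfolding left_diff_distrib
        using K_mult_integrable[OF b] bounded_bounded_support_integrable[OF b] by (intro Bochner_Integration.integral_diff) auto
      then show ?thesis using zero by (simp add: T_def)
    qed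
    then have "ennreal (cmod (T b x)) \<le> (\<integral>\<^sup>+y. ennreal (cmod ((K x y - K x c) * b y)) \<partial>lebesgue)"
    proof -
      have "(\<lambda>y. (K x y - K x c) * b y) \<in> borel_measurable lebesgue" by measurable
      then have "ennreal (cmod (LINT y|lebesgue. (K x y - K x c) * b y)) \<le> (\<integral>\<^sup>+y. ennreal (cmod ((K x y - K x c) * b y)) \<partial>lebesgue)"
        by (intro integral_norm_bound_ennreal) (use K_mult_integrable[OF b] bounded_bounded_support_integrable[OF b] in \<open>auto simp: left_diff_distrib\<close>)
      then show ?thesis using \<open>T b x = _\<close> by simp
    qed
    also have "\<dots> \<le> (\<integral>\<^sup>+y. ennreal (B * (l / 2) / (x - c)\<^sup>2) * ennreal (cmod (b y)) \<partial>lebesgue)"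
    proof (intro nn_integral_mono)
      fix y
      show "ennreal (cmod ((K x y - K x c) * b y)) \<le> ennreal (B * (l / 2) / (x - c)\<^sup>2) * ennreal (cmod (b y))"
      proof (cases "y \<in> {c - l / 2..c + l / 2}")
        case True
        then have yc: "\<bar>y - c\<bar> \<le> l / 2" unfolding abs_le_iff atLeastAtMost_iff by linarith
        then have "cmod (K x y - K x c) \<le> B * \<bar>y - c\<bar> / (x - c)\<^sup>2" using x by (intro smooth_snd) auto
        also have "\<dots> \<le> B * (l / 2) / (x - c)\<^sup>2" using yc B0 by (intro divide_right_mono mult_left_mono) auto
        finally have "cmod ((K x y - K x c) * b y) \<le> B * (l / 2) / (x - c)\<^sup>2 * cmod (b y)"
          unfolding norm_mult by (intro mult_right_mono) auto
        then show ?thesis using B0 l by (simp add: ennreal_mult[symmetric] ennreal_leI)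
      qed (use supp in simp)
    qed
    also have "\<dots> = ennreal (B * (l / 2) / (x - c)\<^sup>2) * \<beta>"
      unfolding \<beta>_def by (intro nn_integral_cmult) measurable
    finally show ?thesis .
  qed
  have "(\<integral>\<^sup>+x\<in>{x. l \<le> \<bar>x - c\<bar>}. ennreal (cmod (T b x)) \<partial>lebesgue)
     \<le> (\<integral>\<^sup>+x. (ennreal (B * (l / 2)) * \<beta>) * (1 * ennreal (1 / (x - c)\<^sup>2) * indicator {x. l \<le> \<bar>x - c\<bar>} x) \<partial>lebesgue)"
  proof (intro nn_integral_mono)
    fix x
    show "ennreal (cmod (T b x)) * indicator {x. l \<le> \<bar>x - c\<bar>} x \<le> (ennreal (B * (l / 2)) * \<beta>) * (1 * ennreal (1 / (x - c)\<^sup>2) * indicator {x. l \<le> \<bar>x - c\<bar>} x)"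
    proof (cases "l \<le> \<bar>x - c\<bar>")
      case True
      have "ennreal (B * (l / 2) / (x - c)\<^sup>2) = ennreal (B * (l / 2)) * ennreal (1 / (x - c)\<^sup>2)"
        using B0 l by (subst ennreal_mult[symmetric]) auto
      then show ?thesis using pw[OF True] True by (simp add: mult_ac)
    qed simp
  qed
  also have "\<dots> = (ennreal (B * (l / 2)) * \<beta>) * (\<integral>\<^sup>+x\<in>{x. l \<le> \<bar>x - c\<bar>}. 1 * ennreal (1 / (x - c)\<^sup>2) \<partial>lebesgue)"
    by (intro nn_integral_cmult) measurable
  \<comment> \<open>The tail bound for the constant function 1, whose means are
    \<open>m = 1\<close>.\<close>
  also have "\<dots> \<le> (ennreal (B * (l / 2)) * \<beta>) * (ennreal (8 / l) * 1)"
    by (intro mult_left_mono nn_integral_inverse_square_tail l) (use l in auto)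
  also have "\<dots> = ennreal (4 * B) * \<beta>"
  proof -
    have "ennreal (B * (l / 2)) * ennreal (8 / l) = ennreal (4 * B)"
      using B0 l by (subst ennreal_mult[symmetric]) auto
    then show ?thesis by (metis mult.assoc mult.commute mult_1_right)
  qed
  finally show ?thesis unfolding \<beta>_def .
qed

end

text \<open>\<open>p\<close> is the good part: \<open>f\<close> is replaced by its average on each stopping interval.\<close>

lemma Calderon_Zygmund_decomposition:
  fixes f :: "real \<Rightarrow> complex"
  assumes f: "bounded_bounded_support f" and L: "L > 0" and t: "t > 0"
    and supp: "\<And>x. x \<notin> {a..<a + L} \<Longrightarrow> f x = 0"
    and avg: "(\<integral>\<^sup>+x. ennreal (cmod (f x)) \<partial>lebesgue) \<le> ennreal (t * L)"
  obtains I :: "(real \<times> real) set" and p :: "real \<Rightarrow> complex" where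
    "countable I" "disjoint_family_on (\<lambda>(c, l). {c..<c + l}) I"
    "\<And>c l. (c, l) \<in> I \<Longrightarrow> l > 0"
    "\<And>c l. (c, l) \<in> I \<Longrightarrow> ennreal (t * l) \<le> (\<integral>\<^sup>+x\<in>{c..<c + l}. ennreal (cmod (f x)) \<partial>lebesgue)"
    "bounded_bounded_support p" "AE x in lebesgue. cmod (p x) \<le> 2 * t"
    "(\<integral>\<^sup>+x. ennreal (cmod (p x)) \<partial>lebesgue) \<le> (\<integral>\<^sup>+x. ennreal (cmod (f x)) \<partial>lebesgue)"
    "\<And>x. x \<notin> (\<Union>(c, l)\<in>I. {c..<c + l}) \<Longrightarrow> p x = f x"
    "\<And>c l. (c, l) \<in> I \<Longrightarrow> (LINT x|lebesgue. indicator {c..<c + l} x * (f x - p x)) = 0"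
    "\<And>c l. (c, l) \<in> I \<Longrightarrow> (\<integral>\<^sup>+x. ennreal (cmod (indicator {c..<c + l} x * (f x - p x))) \<partial>lebesgue)
       \<le> 2 * (\<integral>\<^sup>+x\<in>{c..<c + l}. ennreal (cmod (f x)) \<partial>lebesgue)"
proof -
  obtain m where m: "m > 0" "\<And>x. cmod (f x) \<le> m" "\<And>x. m < \<bar>x\<bar> \<Longrightarrow> f x = 0" and [measurable]: "f \<in> borel_measurable lebesgue"
    using bounded_bounded_supportE[OF f] by blast
  define u where "u x = ennreal (cmod (f x))" for x
  have u[measurable]: "u \<in> borel_measurable lebesgue" unfolding u_def by measurable
  let ?Q = "{a..<a + L}"
  have "(\<integral>\<^sup>+x\<in>?Q. u x \<partial>lebesgue) = (\<integral>\<^sup>+x. ennreal (cmod (f x)) \<partial>lebesgue)"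
    using supp by (intro nn_integral_cong) (auto simp: u_def split: split_indicator)
  then have avg': "(\<integral>\<^sup>+x\<in>?Q. u x \<partial>lebesgue) \<le> ennreal (t * L)" using avg by simp
  obtain I where I: "countable I" "disjoint_family_on (\<lambda>(b, l). {b..<b + l}) I"
    and I3: "\<And>b l. (b, l) \<in> I \<Longrightarrow> l > 0 \<and> {b..<b + l} \<subseteq> ?Q \<and>
           ennreal (t * l) \<le> (\<integral>\<^sup>+x\<in>{b..<b + l}. u x \<partial>lebesgue) \<and>
           (\<integral>\<^sup>+x\<in>{b..<b + l}. u x \<partial>lebesgue) \<le> ennreal (2 * t * l)"
    and I5: "AE x in lebesgue. x \<in> ?Q - (\<Union>(b, l)\<in>I. {b..<b + l}) \<longrightarrow> u x \<le> ennreal t"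
    by (rule Calderon_Zygmund_stopping_intervals[OF L less_imp_le[OF t] u avg']) auto
  let ?D = "\<lambda>(b, l). {b..<b + l} :: real set"
  define J where "J = (\<Union>i\<in>I. ?D i)"
  have Jm[measurable]: "J \<in> sets lebesgue" unfolding J_def
    using I(1) by (intro sets.countable_UN'') auto
  have Jsub: "J \<subseteq> ?Q"
  proof
    fix x assume "x \<in> J"
    then obtain b l where "(b, l) \<in> I" "x \<in> {b..<b + l}" by (auto simp: J_def)
    then show "x \<in> ?Q" using I3[of b l] by blast
  qed
  define av where "av = (\<lambda>(b, l). (LINT x|lebesgue. indicator {b..<b + l} x * f x) / of_real l)"
  define p where "p x = (if x \<in> J then av (THE i. i \<in> I \<and> x \<in> ?D i) else f x)" for x
  have pD: "p x = av i" if "i \<in> I" "x \<in> ?D i" for x i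
  proof -
    have "(THE i. i \<in> I \<and> x \<in> ?D i) = i"
    proof (rule the_equality)
      fix j assume j: "j \<in> I \<and> x \<in> ?D j"
      show "j = i"
      proof (rule ccontr)
        assume "j \<noteq> i"
        then have "?D j \<inter> ?D i = {}" using I(2) j that by (intro disjoint_family_onD[OF I(2)]) auto
        then show False using j that by blast
      qed
    qed (use that in blast)
    moreover have "x \<in> J" using that by (auto simp: J_def)
    ultimately show ?thesis by (simp add: p_def)
  qed
  have pJ: "p x = f x" if "x \<notin> J" for x using that by (simp add: p_def)
  \<comment> \<open>The averages are dominated by the mean of \<open>|f|\<close>, which stopping
    keeps at most \<open>2 * t\<close>; the first form controls the L1 mass of \<open>p\<close>
    interval by interval.\<close>
  have avnorm: "ennreal (cmod (av (b, l))) * ennreal l \<le> (\<integral>\<^sup>+x\<in>{b..<b + l}. u x \<partial>lebesgue)"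
    "cmod (av (b, l)) \<le> 2 * t" if "(b, l) \<in> I" for b l
  proof -
    have l: "l > 0" using I3[OF that] by simp
    have "integrable lebesgue (\<lambda>x. indicator {b..<b + l} x * f x)"
      by (intro bounded_bounded_support_integrable bounded_bounded_support_indicator f) auto
    then have "ennreal (cmod (LINT x|lebesgue. indicator {b..<b + l} x * f x)) \<le> (\<integral>\<^sup>+x. ennreal (cmod (indicator {b..<b + l} x * f x)) \<partial>lebesgue)"
      by (rule integral_norm_bound_ennreal)
    also have "\<dots> = (\<integral>\<^sup>+x\<in>{b..<b + l}. u x \<partial>lebesgue)"
      by (intro nn_integral_cong) (auto simp: u_def split: split_indicator)
    finally have *: "ennreal (cmod (LINT x|lebesgue. indicator {b..<b + l} x * f x)) \<le> (\<integral>\<^sup>+x\<in>{b..<b + l}. u x \<partial>lebesgue)" .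
    have e: "cmod (av (b, l)) * l = cmod (LINT x|lebesgue. indicator {b..<b + l} x * f x)"
      using l by (simp add: av_def norm_divide)
    then show 1: "ennreal (cmod (av (b, l))) * ennreal l \<le> (\<integral>\<^sup>+x\<in>{b..<b + l}. u x \<partial>lebesgue)"
      using * l by (simp add: ennreal_mult[symmetric])
    have "ennreal (cmod (av (b, l)) * l) \<le> ennreal (2 * t * l)"
      using order_trans[OF 1] I3[OF that] l by (simp add: ennreal_mult)
    then show "cmod (av (b, l)) \<le> 2 * t" using l t by (simp add: ennreal_le_iff)
  qed
  have pbound: "cmod (p x) \<le> 2 * t" if "x \<in> J" for x
    using that pD avnorm(2) by (auto simp: J_def)
  \<comment> \<open>\<open>p\<close> is glued from countably many pieces: \<open>f\<close> off the
    stopping intervals and a constant on each of them.\<close>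
  have pm[measurable]: "p \<in> borel_measurable lebesgue"
  proof (rule measurable_piecewise_restrict[of "insert (- J) (?D ` I)"])
    show "countable (insert (- J) (?D ` I))" using I by simp
    fix \<Omega> assume \<Omega>: "\<Omega> \<in> insert (- J) (?D ` I)"
    then show "\<Omega> \<inter> space lebesgue \<in> sets lebesgue" using sets.compl_sets[OF Jm] by (auto simp: Compl_eq_Diff_UNIV)
    from \<Omega> consider "\<Omega> = - J" | i where "i \<in> I" "\<Omega> = ?D i" by auto
    then show "p \<in> measurable (restrict_space lebesgue \<Omega>) borel"
    proof cases
      case 1
      have "f \<in> measurable (restrict_space lebesgue \<Omega>) borel" by (rule measurable_restrict_space1) measurable
      then show ?thesis by (rule measurable_cong[THEN iffD1, rotated]) (auto simp: 1 pJ space_restrict_space)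
    next
      case 2
      have "(\<lambda>x. av i) \<in> measurable (restrict_space lebesgue \<Omega>) borel" by measurable
      then show ?thesis by (rule measurable_cong[THEN iffD1, rotated]) (use 2 pD in \<open>auto simp: space_restrict_space\<close>)
    qed
  qed (auto simp: J_def)
  have pB: "bounded_bounded_support p"
  proof (rule bounded_bounded_supportI[of _ "max m (2 * t)" "max m (\<bar>a\<bar> + L)"])
    show "cmod (p x) \<le> max m (2 * t)" for x
      using pbound[of x] pJ[of x] m(2)[of x] by (cases "x \<in> J") auto
    show "p x = 0" if "max m (\<bar>a\<bar> + L) < \<bar>x\<bar>" for x
    proof -
      have "x \<notin> ?Q" using that L by auto
      then have "x \<notin> J" using Jsub by blast
      then show ?thesis using pJ m(3)[of x] that by simp
    qed
  qed measurable
  have pint: "(\<integral>\<^sup>+x\<in>{b..<b + l}. ennreal (cmod (p x)) \<partial>lebesgue) \<le> (\<integral>\<^sup>+x\<in>{b..<b + l}. u x \<partial>lebesgue)" if "(b, l) \<in> I" for b l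
  proof -
    have "(\<integral>\<^sup>+x\<in>{b..<b + l}. ennreal (cmod (p x)) \<partial>lebesgue) = (\<integral>\<^sup>+x\<in>{b..<b + l}. ennreal (cmod (av (b, l))) \<partial>lebesgue)"
      using pD[OF that] by (intro nn_integral_cong) (auto split: split_indicator)
    also have "\<dots> = ennreal (cmod (av (b, l))) * emeasure lebesgue {b..<b + l}"
      by (rule nn_integral_cmult_indicator) auto
    also have "\<dots> = ennreal (cmod (av (b, l))) * ennreal l"
      using I3[OF that] emeasure_lebesgue_Ico[of l b] by simp
    finally show ?thesis using avnorm(1)[OF that] by simp
  qed
  have split: "(\<integral>\<^sup>+x. g x \<partial>lebesgue) = (\<integral>\<^sup>+x\<in>-J. g x \<partial>lebesgue) + (\<integral>\<^sup>+i. (\<integral>\<^sup>+x\<in>?D i. g x \<partial>lebesgue) \<partial>count_space I)"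
    if [measurable]: "g \<in> borel_measurable lebesgue" for g :: "real \<Rightarrow> ennreal"
  proof -
    have "(\<integral>\<^sup>+x. g x \<partial>lebesgue) = (\<integral>\<^sup>+x. g x * indicator (-J) x + g x * indicator J x \<partial>lebesgue)"
      by (intro nn_integral_cong) (auto split: split_indicator)
    also have "\<dots> = (\<integral>\<^sup>+x\<in>-J. g x \<partial>lebesgue) + (\<integral>\<^sup>+x\<in>J. g x \<partial>lebesgue)"
      by (rule nn_integral_add; measurable)
    also have "(\<integral>\<^sup>+x\<in>J. g x \<partial>lebesgue) = (\<integral>\<^sup>+i. (\<integral>\<^sup>+x\<in>?D i. g x \<partial>lebesgue) \<partial>count_space I)"
      unfolding J_def using I by (intro set_nn_integral_UN_countable) auto
    finally show ?thesis .
  qed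
  have "(\<integral>\<^sup>+x. ennreal (cmod (p x)) \<partial>lebesgue) \<le> (\<integral>\<^sup>+x. u x \<partial>lebesgue)"
  proof (subst (1 2) split)
    have "(\<integral>\<^sup>+x\<in>-J. ennreal (cmod (p x)) \<partial>lebesgue) = (\<integral>\<^sup>+x\<in>-J. u x \<partial>lebesgue)"
      by (intro nn_integral_cong) (auto simp: pJ u_def split: split_indicator)
    then show "(\<integral>\<^sup>+x\<in>-J. ennreal (cmod (p x)) \<partial>lebesgue) + (\<integral>\<^sup>+i. (\<integral>\<^sup>+x\<in>?D i. ennreal (cmod (p x)) \<partial>lebesgue) \<partial>count_space I)
      \<le> (\<integral>\<^sup>+x\<in>-J. u x \<partial>lebesgue) + (\<integral>\<^sup>+i. (\<integral>\<^sup>+x\<in>?D i. u x \<partial>lebesgue) \<partial>count_space I)"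
    proof (intro add_mono)
      show "(\<integral>\<^sup>+i. (\<integral>\<^sup>+x\<in>?D i. ennreal (cmod (p x)) \<partial>lebesgue) \<partial>count_space I)
        \<le> (\<integral>\<^sup>+i. (\<integral>\<^sup>+x\<in>?D i. u x \<partial>lebesgue) \<partial>count_space I)"
      proof (rule nn_integral_mono)
        fix i assume "i \<in> space (count_space I)"
        then show "(\<integral>\<^sup>+x\<in>?D i. ennreal (cmod (p x)) \<partial>lebesgue) \<le> (\<integral>\<^sup>+x\<in>?D i. u x \<partial>lebesgue)"
          using pint[of "fst i" "snd i"] by (simp add: case_prod_beta)
      qed
    qed simp
  qed measurable
  then have pL1: "(\<integral>\<^sup>+x. ennreal (cmod (p x)) \<partial>lebesgue) \<le> (\<integral>\<^sup>+x. ennreal (cmod (f x)) \<partial>lebesgue)"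
    by (simp add: u_def)
  \<comment> \<open>The exceptional null set comes from the region off the stopping intervals, where
    \<open>|f| \<le> t\<close> is known only almost everywhere; on the intervals the bound holds at
    every point.\<close>
  have pAE: "AE x in lebesgue. cmod (p x) \<le> 2 * t"
    using I5
  proof eventually_elim
    case (elim x)
    consider "x \<in> J" | "x \<in> ?Q - J" | "x \<notin> ?Q" by blast
    then show ?case
    proof cases
      case 2
      then have "u x \<le> ennreal t" using elim by (auto simp: J_def)
      then show ?thesis using 2 t by (auto simp: u_def pJ)
    next
      case 3
      then have "x \<notin> J" using Jsub by blast
      then show ?thesis using supp[OF 3] pJ[of x] t by simp
    qed (use pbound in auto)
  qed
  have "(LINT x|lebesgue. indicator {b..<b + l} x * (f x - p x)) = 0" if "(b, l) \<in> I" for b l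
  proof -
    have l: "l > 0" using I3[OF that] by simp
    have "(LINT x|lebesgue. indicator {b..<b + l} x * (f x - p x)) = (LINT x|lebesgue. indicator {b..<b + l} x * f x - indicator {b..<b + l} x * av (b, l))"
      using pD[OF that] by (intro Bochner_Integration.integral_cong) (auto split: split_indicator)
    also have "\<dots> = (LINT x|lebesgue. indicator {b..<b + l} x * f x) - (LINT x|lebesgue. indicator {b..<b + l} x * av (b, l))"
    proof (intro Bochner_Integration.integral_diff)
      show "integrable lebesgue (\<lambda>x. indicator {b..<b + l} x * f x)"
        by (intro bounded_bounded_support_integrable bounded_bounded_support_indicator f) auto
      show "integrable lebesgue (\<lambda>x. indicator {b..<b + l} x * av (b, l))"
      proof -
        have "integrable lebesgue (\<lambda>x. indicator {b..<b + l} x *\<^sub>R av (b, l))"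
          using l by (intro integrable_scaleR_left integrable_real_indicator) auto
        moreover have "(\<lambda>x. indicator {b..<b + l} x *\<^sub>R av (b, l)) = (\<lambda>x. indicator {b..<b + l} x * av (b, l))"
          by (auto simp: fun_eq_iff split: split_indicator)
        ultimately show ?thesis by simp
      qed
    qed
    also have "(LINT x|lebesgue. indicator {b..<b + l} x * av (b, l)) = of_real l * av (b, l)"
    proof -
      have "(LINT x|lebesgue. indicator {b..<b + l} x * av (b, l)) = (LINT x|lebesgue. indicator {b..<b + l} x *\<^sub>R av (b, l))"
        by (intro Bochner_Integration.integral_cong) (auto split: split_indicator)
      also have "\<dots> = measure lebesgue {b..<b + l} *\<^sub>R av (b, l)"
        by (subst integral_scaleR_left) (use l in \<open>auto intro!: integrable_real_indicator\<close>)
      also have "measure lebesgue {b..<b + l} = l" using l by (simp add: measure_def emeasure_lebesgue_Ico)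
      finally show ?thesis by (simp add: scaleR_conv_of_real)
    qed
    also have "\<dots> = (LINT x|lebesgue. indicator {b..<b + l} x * f x)" using l by (simp add: av_def)
    finally show ?thesis by simp
  qed
  moreover have "(\<integral>\<^sup>+x. ennreal (cmod (indicator {b..<b + l} x * (f x - p x))) \<partial>lebesgue)
       \<le> 2 * (\<integral>\<^sup>+x\<in>{b..<b + l}. ennreal (cmod (f x)) \<partial>lebesgue)" if "(b, l) \<in> I" for b l
  proof -
    have "(\<integral>\<^sup>+x. ennreal (cmod (indicator {b..<b + l} x * (f x - p x))) \<partial>lebesgue)
      \<le> (\<integral>\<^sup>+x. u x * indicator {b..<b + l} x + ennreal (cmod (p x)) * indicator {b..<b + l} x \<partial>lebesgue)"
    proof (intro nn_integral_mono)
      fix x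
      have "ennreal (cmod (f x - p x)) \<le> ennreal (cmod (f x)) + ennreal (cmod (p x))"
        by (simp add: ennreal_plus[symmetric] ennreal_leI norm_triangle_ineq4 del: ennreal_plus)
      then show "ennreal (cmod (indicator {b..<b + l} x * (f x - p x))) \<le> u x * indicator {b..<b + l} x + ennreal (cmod (p x)) * indicator {b..<b + l} x"
        by (auto simp: u_def split: split_indicator)
    qed
    also have "\<dots> = (\<integral>\<^sup>+x\<in>{b..<b + l}. u x \<partial>lebesgue) + (\<integral>\<^sup>+x\<in>{b..<b + l}. ennreal (cmod (p x)) \<partial>lebesgue)"
      by (rule nn_integral_add; measurable)
    also have "\<dots> \<le> (\<integral>\<^sup>+x\<in>{b..<b + l}. u x \<partial>lebesgue) + (\<integral>\<^sup>+x\<in>{b..<b + l}. u x \<partial>lebesgue)"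
      by (intro add_left_mono pint that)
    finally show ?thesis by (simp add: mult_2 u_def)
  qed
  ultimately show thesis
    using I I3 pB pAE pL1 pJ by (intro that[of I p]) (auto simp: u_def J_def)
qed

context smooth_kernel begin

text \<open>How the constant arises: the doubled stopping intervals have measure at most
  \<open>2 / t\<close> times the L1 norm; Chebyshev in L2 at height \<open>t / 2\<close>, with
  \<open>|p|^2 \<le> 2 * t * |p|\<close>, gives \<open>8 / t\<close>; Chebyshev in L1 at height
  \<open>t / 2\<close> for the bad part off the doubled intervals gives \<open>16 * B / t\<close>.
  The hypothesis \<open>avg\<close> says that the top interval does not stop.\<close>

lemma weak_type_one_one:
  assumes f: "bounded_bounded_support f" and L: "L > 0" and t: "t > 0"
    and supp: "\<And>x. x \<notin> {a..<a + L} \<Longrightarrow> f x = 0"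
    and avg: "(\<integral>\<^sup>+x. ennreal (cmod (f x)) \<partial>lebesgue) \<le> ennreal (t * L)"
  shows "emeasure lebesgue {x. t < cmod (T f x)} \<le> ennreal ((10 + 16 * B) / t) * (\<integral>\<^sup>+x. ennreal (cmod (f x)) \<partial>lebesgue)"
proof -
  define F where "F = (\<integral>\<^sup>+x. ennreal (cmod (f x)) \<partial>lebesgue)"
  have fm[measurable]: "f \<in> borel_measurable lebesgue" using f by (rule bounded_bounded_support_measurable)
  obtain I :: "(real \<times> real) set" and p :: "real \<Rightarrow> complex" where
    I: "countable I" "disjoint_family_on (\<lambda>(c, l). {c..<c + l}) I"
    and Il: "\<And>c l. (c, l) \<in> I \<Longrightarrow> l > 0"
    and It: "\<And>c l. (c, l) \<in> I \<Longrightarrow> ennreal (t * l) \<le> (\<integral>\<^sup>+x\<in>{c..<c + l}. ennreal (cmod (f x)) \<partial>lebesgue)"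
    and p: "bounded_bounded_support p" "AE x in lebesgue. cmod (p x) \<le> 2 * t"
      "(\<integral>\<^sup>+x. ennreal (cmod (p x)) \<partial>lebesgue) \<le> F"
    and pf: "\<And>x. x \<notin> (\<Union>(c, l)\<in>I. {c..<c + l}) \<Longrightarrow> p x = f x"
    and zero: "\<And>c l. (c, l) \<in> I \<Longrightarrow> (LINT x|lebesgue. indicator {c..<c + l} x * (f x - p x)) = 0"
    and bad: "\<And>c l. (c, l) \<in> I \<Longrightarrow> (\<integral>\<^sup>+x. ennreal (cmod (indicator {c..<c + l} x * (f x - p x))) \<partial>lebesgue)
       \<le> 2 * (\<integral>\<^sup>+x\<in>{c..<c + l}. ennreal (cmod (f x)) \<partial>lebesgue)"
    by (rule Calderon_Zygmund_decomposition[where a = a, OF f L t _ avg, folded F_def], erule supp, (rule that; assumption))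
  let ?D = "\<lambda>(c, l). {c..<c + l} :: real set"
  \<comment> \<open>The concentric interval of twice the length: off it the distance to the centre
    is at least \<open>l\<close>, as \<open>T_cancellation_tail\<close> demands for a function
    living within \<open>l / 2\<close> of the centre.\<close>
  let ?E = "\<lambda>(c, l). {c + l / 2 - l<..<c + l / 2 + l} :: real set"
  define b where "b x = f x - p x" for x
  have b: "bounded_bounded_support b" unfolding b_def by (rule bounded_bounded_support_diff[OF f p(1)])
  have bi: "bounded_bounded_support (\<lambda>x. indicator (?D i) x * b x)" for i
    by (rule bounded_bounded_support_indicator[OF b]) (auto split: prod.split)
  have Tf: "T f x = T p x + T b x" for x
    using T_add[OF p(1) b, of x] by (simp add: b_def)
  have [measurable]: "p \<in> borel_measurable lebesgue" "T p \<in> borel_measurable lebesgue" "T b \<in> borel_measurable lebesgue"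
    using p(1) b by (auto intro: bounded_bounded_support_measurable T_measurable)
  have Tbi[measurable]: "T (\<lambda>x. indicator (?D i) x * b x) \<in> borel_measurable lebesgue" for i
    using bi by (rule T_measurable)
  have sumD: "(\<integral>\<^sup>+i. (\<integral>\<^sup>+x\<in>?D i. ennreal (cmod (f x)) \<partial>lebesgue) \<partial>count_space I) \<le> F"
  proof -
    have "(\<integral>\<^sup>+i. (\<integral>\<^sup>+x\<in>?D i. ennreal (cmod (f x)) \<partial>lebesgue) \<partial>count_space I) = (\<integral>\<^sup>+x\<in>(\<Union>i\<in>I. ?D i). ennreal (cmod (f x)) \<partial>lebesgue)"
      using I by (intro set_nn_integral_UN_countable[symmetric]) auto
    also have "\<dots> \<le> F" unfolding F_def by (intro nn_integral_mono) (auto split: split_indicator)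
    finally show ?thesis .
  qed
  define J where "J = (\<Union>i\<in>I. ?E i)"
  have [measurable]: "J \<in> sets lebesgue" unfolding J_def
    using I(1) by (intro sets.countable_UN'') auto
  have "emeasure lebesgue J \<le> ennreal (2 / t) * F"
  proof -
    have "emeasure lebesgue J = (\<integral>\<^sup>+x. indicator J x \<partial>lebesgue)" by simp
    \<comment> \<open>Doubled intervals may overlap, so only countable subadditivity is
      available.\<close>
    also have "\<dots> \<le> (\<integral>\<^sup>+x. (\<integral>\<^sup>+i. indicator (?E i) x \<partial>count_space I) \<partial>lebesgue)"
    proof (intro nn_integral_mono)
      fix x show "indicator J x \<le> (\<integral>\<^sup>+i. (indicator (?E i) x :: ennreal) \<partial>count_space I)"
      proof (cases "x \<in> J")
        case True
        then obtain i where i: "i \<in> I" "x \<in> ?E i" by (auto simp: J_def)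
        have "(indicator (?E i) x :: ennreal) \<le> (\<integral>\<^sup>+i. indicator (?E i) x \<partial>count_space I)"
          by (rule nn_integral_ge_point[OF i(1)])
        then show ?thesis using i True by simp
      qed simp
    qed
    also have "\<dots> = (\<integral>\<^sup>+i. (\<integral>\<^sup>+x. indicator (?E i) x \<partial>lebesgue) \<partial>count_space I)"
      using I(1) by (intro nn_integral_count_space_nn_integral) (auto split: prod.split)
    also have "\<dots> \<le> (\<integral>\<^sup>+i. ennreal (2 / t) * (\<integral>\<^sup>+x\<in>?D i. ennreal (cmod (f x)) \<partial>lebesgue) \<partial>count_space I)"
    proof (rule nn_integral_mono)
      fix i assume "i \<in> space (count_space I)"
      then obtain c l where i: "i = (c, l)" and cl: "(c, l) \<in> I" by (cases i) auto
      have "(\<integral>\<^sup>+x. indicator (?E i) x \<partial>lebesgue) = ennreal (2 * l)"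
        using Il[OF cl] by (simp add: i)
      also
      have "ennreal (2 * l) = ennreal (2 / t) * ennreal (t * l)"
        using t Il[OF cl] by (subst ennreal_mult[symmetric]) auto
      also have "\<dots> \<le> ennreal (2 / t) * (\<integral>\<^sup>+x\<in>{c..<c + l}. ennreal (cmod (f x)) \<partial>lebesgue)"
        by (intro mult_left_mono It cl) simp
      finally show "(\<integral>\<^sup>+x. indicator (?E i) x \<partial>lebesgue) \<le> ennreal (2 / t) * (\<integral>\<^sup>+x\<in>?D i. ennreal (cmod (f x)) \<partial>lebesgue)"
        by (simp add: i)
    qed
    also have "\<dots> \<le> ennreal (2 / t) * F"
      using sumD by (subst nn_integral_cmult) (auto intro: mult_left_mono)
    finally show ?thesis .
  qed
  moreover have "emeasure lebesgue {x. t / 2 < cmod (T p x)} \<le> ennreal (8 / t) * F"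
  proof -
    have "(\<integral>\<^sup>+x. ennreal ((cmod (T p x))\<^sup>2) \<partial>lebesgue) \<le> (\<integral>\<^sup>+x. ennreal ((cmod (p x))\<^sup>2) \<partial>lebesgue)"
      unfolding T_def by (rule L2_contraction[OF p(1)])
    also have "\<dots> \<le> (\<integral>\<^sup>+x. ennreal (2 * t) * ennreal (cmod (p x)) \<partial>lebesgue)"
    proof (rule nn_integral_mono_AE)
      show "AE x in lebesgue. ennreal ((cmod (p x))\<^sup>2) \<le> ennreal (2 * t) * ennreal (cmod (p x))"
        using p(2)
      proof eventually_elim
        case (elim x)
        then have "(cmod (p x))\<^sup>2 \<le> 2 * t * cmod (p x)"
          unfolding power2_eq_square by (intro mult_right_mono) auto
        then show ?case using t by (subst ennreal_mult[symmetric]) (auto intro: ennreal_leI)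
      qed
    qed
    also have "\<dots> = ennreal (2 * t) * (\<integral>\<^sup>+x. ennreal (cmod (p x)) \<partial>lebesgue)" by (intro nn_integral_cmult) measurable
    also have "\<dots> \<le> ennreal (2 * t) * F" by (intro mult_left_mono p) simp
    finally have *: "(\<integral>\<^sup>+x. ennreal ((cmod (T p x))\<^sup>2) \<partial>lebesgue) \<le> ennreal (2 * t) * F" .
    have cheb: "1 \<le> ennreal (4 / t\<^sup>2) * ennreal ((cmod (T p x))\<^sup>2)" if "t / 2 < cmod (T p x)" for x
    proof -
      have "(t / 2)\<^sup>2 \<le> (cmod (T p x))\<^sup>2"
        using t that by (intro power_mono) auto
      then have "1 \<le> 4 * (cmod (T p x))\<^sup>2 / t\<^sup>2" using t by (subst le_divide_eq_1_pos) (auto simp: power_divide)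
      then have "ennreal 1 \<le> ennreal (4 / t\<^sup>2 * (cmod (T p x))\<^sup>2)" by (intro ennreal_leI) simp
      also have "\<dots> = ennreal (4 / t\<^sup>2) * ennreal ((cmod (T p x))\<^sup>2)" by (rule ennreal_mult'') simp
      finally show ?thesis by simp
    qed
    have "{x \<in> space lebesgue. 1 \<le> ennreal (4 / t\<^sup>2) * ennreal ((cmod (T p x))\<^sup>2)} \<in> sets lebesgue" by measurable
    then have "emeasure lebesgue {x. t / 2 < cmod (T p x)} \<le> emeasure lebesgue {x \<in> UNIV. 1 \<le> ennreal (4 / t\<^sup>2) * ennreal ((cmod (T p x))\<^sup>2)}"
      by (intro emeasure_mono) (use cheb in auto)
    also have "\<dots> \<le> ennreal (4 / t\<^sup>2) * (\<integral>\<^sup>+x. ennreal ((cmod (T p x))\<^sup>2) * indicator UNIV x \<partial>lebesgue)"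
      by (rule nn_integral_Markov_inequality) (measurable, simp)
    also have "\<dots> \<le> ennreal (4 / t\<^sup>2) * (ennreal (2 * t) * F)"
      using * by (intro mult_left_mono) auto
    also have "\<dots> = ennreal (8 / t) * F"
    proof -
      have "ennreal (4 / t\<^sup>2) * ennreal (2 * t) = ennreal (8 / t)"
        using t by (subst ennreal_mult[symmetric]) (auto simp: power2_eq_square)
      then show ?thesis by (simp add: mult.assoc[symmetric])
    qed
    finally show ?thesis .
  qed
  \<comment> \<open>Off \<open>J\<close> each bad piece is seen only from outside its own doubled
    interval, so after the countable triangle inequality the pieces can be estimated one by
    one.\<close>
  moreover have "emeasure lebesgue {x. x \<notin> J \<and> t / 2 < cmod (T b x)} \<le> ennreal (16 * B / t) * F"
  proof -
    have "(\<integral>\<^sup>+x\<in>-J. ennreal (cmod (T b x)) \<partial>lebesgue)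
      \<le> (\<integral>\<^sup>+x. (\<integral>\<^sup>+i. ennreal (cmod (T (\<lambda>x. indicator (?D i) x * b x) x)) * indicator (- ?E i) x \<partial>count_space I) \<partial>lebesgue)"
    proof (intro nn_integral_mono)
      fix x
      show "ennreal (cmod (T b x)) * indicator (-J) x
        \<le> (\<integral>\<^sup>+i. ennreal (cmod (T (\<lambda>x. indicator (?D i) x * b x) x)) * indicator (- ?E i) x \<partial>count_space I)"
      proof (cases "x \<in> J")
        case False
        have "ennreal (cmod (T b x)) \<le> (\<integral>\<^sup>+i. ennreal (cmod (LINT y|lebesgue. indicator (?D i) y *\<^sub>R (K x y * b y))) \<partial>count_space I)"
          unfolding T_def
        proof (rule norm_integral_UN_countable_le)
          show "K x y * b y = 0" if "y \<notin> (\<Union>i\<in>I. ?D i)" for y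
            using pf[OF that] by (simp add: b_def)
        qed (use I K_mult_integrable[OF b] in auto)
        also have "\<dots> = (\<integral>\<^sup>+i. ennreal (cmod (T (\<lambda>x. indicator (?D i) x * b x) x)) * indicator (- ?E i) x \<partial>count_space I)"
        proof (intro nn_integral_cong)
          fix i assume "i \<in> space (count_space I)"
          then have "x \<notin> ?E i" using False by (auto simp: J_def)
          moreover have "(LINT y|lebesgue. indicator (?D i) y *\<^sub>R (K x y * b y)) = T (\<lambda>x. indicator (?D i) x * b x) x"
            unfolding T_def by (intro Bochner_Integration.integral_cong) (auto split: split_indicator)
          ultimately show "ennreal (cmod (LINT y|lebesgue. indicator (?D i) y *\<^sub>R (K x y * b y))) = ennreal (cmod (T (\<lambda>x. indicator (?D i) x * b x) x)) * indicator (- ?E i) x"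
            by simp
        qed
        finally show ?thesis using False by simp
      qed simp
    qed
    also have "\<dots> = (\<integral>\<^sup>+i. (\<integral>\<^sup>+x\<in>- ?E i. ennreal (cmod (T (\<lambda>x. indicator (?D i) x * b x) x)) \<partial>lebesgue) \<partial>count_space I)"
    proof (rule nn_integral_count_space_nn_integral[OF I(1)])
      fix i
      have "- ?E i \<in> sets lebesgue" by (cases i) auto
      then show "(\<lambda>x. ennreal (cmod (T (\<lambda>x. indicator (?D i) x * b x) x)) * indicator (- ?E i) x) \<in> borel_measurable lebesgue"
        by measurable
    qed
    also have "\<dots> \<le> (\<integral>\<^sup>+i. ennreal (8 * B) * (\<integral>\<^sup>+x\<in>?D i. ennreal (cmod (f x)) \<partial>lebesgue) \<partial>count_space I)"
    proof (rule nn_integral_mono)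
      fix i assume "i \<in> space (count_space I)"
      then obtain c l where i: "i = (c, l)" "(c, l) \<in> I" by (cases i) auto
      have l: "l > 0" using Il[OF i(2)] .
      have "(\<integral>\<^sup>+x\<in>- ?E i. ennreal (cmod (T (\<lambda>x. indicator (?D i) x * b x) x)) \<partial>lebesgue)
        = (\<integral>\<^sup>+x\<in>{x. l \<le> \<bar>x - (c + l / 2)\<bar>}. ennreal (cmod (T (\<lambda>x. indicator (?D i) x * b x) x)) \<partial>lebesgue)"
        by (intro nn_integral_cong) (auto simp: i split: split_indicator)
      also have "\<dots> \<le> ennreal (4 * B) * (\<integral>\<^sup>+y. ennreal (cmod (indicator (?D i) y * b y)) \<partial>lebesgue)"
        by (rule T_cancellation_tail[OF bi l]) (use zero[OF i(2)] in \<open>auto simp: i b_def split: split_indicator\<close>)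
      also have "\<dots> \<le> ennreal (4 * B) * (2 * (\<integral>\<^sup>+x\<in>?D i. ennreal (cmod (f x)) \<partial>lebesgue))"
        using bad[OF i(2)] by (intro mult_left_mono) (auto simp: i b_def)
      also have "\<dots> = ennreal (8 * B) * (\<integral>\<^sup>+x\<in>?D i. ennreal (cmod (f x)) \<partial>lebesgue)"
      proof -
        have "ennreal (4 * B) * ennreal 2 = ennreal (8 * B)" using B0 by (subst ennreal_mult[symmetric]) auto
        then show ?thesis by (simp add: mult.assoc[symmetric])
      qed
      finally show "(\<integral>\<^sup>+x\<in>- ?E i. ennreal (cmod (T (\<lambda>x. indicator (?D i) x * b x) x)) \<partial>lebesgue) \<le> ennreal (8 * B) * (\<integral>\<^sup>+x\<in>?D i. ennreal (cmod (f x)) \<partial>lebesgue)" .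
    qed
    also have "\<dots> \<le> ennreal (8 * B) * F"
      using sumD by (subst nn_integral_cmult) (auto intro: mult_left_mono)
    finally have *: "(\<integral>\<^sup>+x\<in>-J. ennreal (cmod (T b x)) \<partial>lebesgue) \<le> ennreal (8 * B) * F" .
    have cheb: "1 \<le> ennreal (2 / t) * ennreal (cmod (T b x))" if "t / 2 < cmod (T b x)" for x
    proof -
      have "ennreal 1 \<le> ennreal (2 / t * cmod (T b x))" using t that by (intro ennreal_leI) (simp add: field_simps)
      also have "\<dots> = ennreal (2 / t) * ennreal (cmod (T b x))" by (rule ennreal_mult'') simp
      finally show ?thesis by simp
    qed
    have "{x \<in> space lebesgue. x \<in> - J \<and> 1 \<le> ennreal (2 / t) * ennreal (cmod (T b x))} \<in> sets lebesgue" by measurable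
    then have "emeasure lebesgue {x. x \<notin> J \<and> t / 2 < cmod (T b x)} \<le> emeasure lebesgue ({x \<in> - J. 1 \<le> ennreal (2 / t) * ennreal (cmod (T b x))})"
      by (intro emeasure_mono) (use cheb in auto)
    also have "\<dots> \<le> ennreal (2 / t) * (\<integral>\<^sup>+x\<in>-J. ennreal (cmod (T b x)) \<partial>lebesgue)"
    proof (rule nn_integral_Markov_inequality)
      show "- J \<in> sets lebesgue" using sets.compl_sets[OF \<open>J \<in> sets lebesgue\<close>] by (simp add: Compl_eq_Diff_UNIV)
      show "(\<lambda>x. ennreal (cmod (T b x)) * indicator (- J) x) \<in> borel_measurable lebesgue" by measurable
    qed
    also have "\<dots> \<le> ennreal (2 / t) * (ennreal (8 * B) * F)"
      by (intro mult_left_mono *) auto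
    also have "\<dots> = ennreal (16 * B / t) * F"
    proof -
      have "ennreal (2 / t) * ennreal (8 * B) = ennreal (16 * B / t)"
        using t B0 by (subst ennreal_mult[symmetric]) auto
      then show ?thesis by (simp add: mult.assoc[symmetric])
    qed
    finally show ?thesis .
  qed
  moreover have "emeasure lebesgue {x. t < cmod (T f x)} \<le> emeasure lebesgue {x. t / 2 < cmod (T p x)} +
     (emeasure lebesgue J + emeasure lebesgue {x. x \<notin> J \<and> t / 2 < cmod (T b x)})"
  proof -
    have "{x. t < cmod (T f x)} \<subseteq> {x. t / 2 < cmod (T p x)} \<union> (J \<union> {x. x \<notin> J \<and> t / 2 < cmod (T b x)})"
    proof
      fix x assume "x \<in> {x. t < cmod (T f x)}"
      then have "t < cmod (T p x) + cmod (T b x)"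
        using norm_triangle_ineq[of "T p x" "T b x"] by (simp add: Tf)
      then show "x \<in> {x. t / 2 < cmod (T p x)} \<union> (J \<union> {x. x \<notin> J \<and> t / 2 < cmod (T b x)})" by auto
    qed
    moreover have m1: "{x. t / 2 < cmod (T p x)} \<in> sets lebesgue"
    proof -
      have "{x \<in> space lebesgue. t / 2 < cmod (T p x)} \<in> sets lebesgue" by measurable
      then show ?thesis by simp
    qed
    moreover have m2: "{x. x \<notin> J \<and> t / 2 < cmod (T b x)} \<in> sets lebesgue"
    proof -
      have "{x \<in> space lebesgue. x \<notin> J \<and> t / 2 < cmod (T b x)} \<in> sets lebesgue" by measurable
      then show ?thesis by simp
    qed
    ultimately have "emeasure lebesgue {x. t < cmod (T f x)} \<le> emeasure lebesgue ({x. t / 2 < cmod (T p x)} \<union> (J \<union> {x. x \<notin> J \<and> t / 2 < cmod (T b x)}))"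
      by (intro emeasure_mono sets.Un) (auto simp: \<open>J \<in> _\<close>)
    also have "\<dots> \<le> emeasure lebesgue {x. t / 2 < cmod (T p x)} + (emeasure lebesgue J + emeasure lebesgue {x. x \<notin> J \<and> t / 2 < cmod (T b x)})"
      using m1 m2 \<open>J \<in> sets lebesgue\<close> by (intro order_trans[OF emeasure_subadditive] add_left_mono emeasure_subadditive sets.Un)
    finally show ?thesis .
  qed
  ultimately have "emeasure lebesgue {x. t < cmod (T f x)} \<le> ennreal (8 / t) * F + (ennreal (2 / t) * F + ennreal (16 * B / t) * F)"
    by (meson add_mono order_trans)
  also have "\<dots> = ennreal ((10 + 16 * B) / t) * F"
    using t B0 unfolding distrib_right[symmetric] by (simp add: ennreal_plus[symmetric] add_divide_distrib del: ennreal_plus)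
  finally show ?thesis by (simp add: F_def)
qed

end

section \<open>Local oscillation of singular integrals and the bilinear maximal bound\<close>

lemma Compl_Ico_sets_lebesgue: "- {a..<b::real} \<in> sets lebesgue"
  using sets.compl_sets[of "{a..<b}" lebesgue] by (simp add: Compl_eq_Diff_UNIV)

context smooth_kernel begin

text \<open>\<open>72 = 3 * 24\<close>: a near piece has L1 norm at most
  \<open>3 * L * \<nu>\<close>, so the weak-type bound at height \<open>weak_const * \<nu>\<close>
  leaves a set of measure at most \<open>L / 24\<close>; three pieces give the \<open>L / 8\<close>
  that the oscillation lemma asks for.\<close>

definition weak_const :: real where "weak_const = 72 * (10 + 16 * B)"

text \<open>Three near pieces, each cut at \<open>weak_const\<close>, and the far part, whose
  oscillation is at most \<open>4 * B\<close>, all in units of the maximal function.\<close>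

definition osc_const :: real where "osc_const = 3 * weak_const + 4 * B"

lemma weak_const_ge: "weak_const \<ge> 3" using B0 by (simp add: weak_const_def)

lemma osc_const_pos: "osc_const > 0" using B0 weak_const_ge by (simp add: osc_const_def)

text \<open>Off the tripled interval the kernel varies by at most \<open>B * (L / 2)\<close> over
  the squared distance of \<open>y\<close> to the centre. Every interval of radius at least
  \<open>L\<close> about the centre contains \<open>z\<close>, so its mean of \<open>|f|\<close> is
  at most the maximal function at \<open>z\<close>, and the tail sums to
  \<open>B * (L / 2) * (8 / L) = 4 * B\<close>.\<close>

lemma T_far_oscillation:
  assumes f: "bounded_bounded_support f" and L: "L > 0" and x: "x \<in> {a..<a + L}" and z: "z \<in> {a..<a + L}"
  defines "fo \<equiv> \<lambda>y. indicator (- {a - L..<a + 2 * L}) y * f y"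
  shows "ennreal (cmod (T fo x - T fo (a + L / 2))) \<le> ennreal (4 * B) * maximal_op (\<lambda>y. ennreal (cmod (f y))) z"
proof -
  let ?c = "a + L / 2" and ?M = "maximal_op (\<lambda>y. ennreal (cmod (f y))) z"
  have [measurable]: "f \<in> borel_measurable lebesgue" using f by (rule bounded_bounded_support_measurable)
  have cS: "- {a - L..<a + 2 * L} \<in> sets lebesgue"
    by (rule Compl_Ico_sets_lebesgue)
  have fo: "bounded_bounded_support fo"
    unfolding fo_def by (rule bounded_bounded_support_indicator[OF f cS])
  have [measurable]: "fo \<in> borel_measurable lebesgue" using fo by (rule bounded_bounded_support_measurable)
  have "T fo x - T fo ?c = (LINT y|lebesgue. (K x y - K ?c y) * fo y)"
    unfolding T_def left_diff_distrib
    by (intro Bochner_Integration.integral_diff[symmetric] K_mult_integrable fo)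
  moreover have "integrable lebesgue (\<lambda>y. (K x y - K ?c y) * fo y)"
    unfolding left_diff_distrib by (intro Bochner_Integration.integrable_diff K_mult_integrable fo)
  ultimately have "ennreal (cmod (T fo x - T fo ?c)) \<le> (\<integral>\<^sup>+y. ennreal (cmod ((K x y - K ?c y) * fo y)) \<partial>lebesgue)"
    using integral_norm_bound_ennreal by metis
  also have "\<dots> \<le> (\<integral>\<^sup>+y. ennreal (B * (L / 2)) * (ennreal (cmod (f y)) * ennreal (1 / (y - ?c)\<^sup>2) * indicator {y. L \<le> \<bar>y - ?c\<bar>} y) \<partial>lebesgue)"
  proof (rule nn_integral_mono)
    fix y
    show "ennreal (cmod ((K x y - K ?c y) * fo y)) \<le> ennreal (B * (L / 2)) * (ennreal (cmod (f y)) * ennreal (1 / (y - ?c)\<^sup>2) * indicator {y. L \<le> \<bar>y - ?c\<bar>} y)"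
    proof (cases "y \<in> {a - L..<a + 2 * L}")
      case False
      then have y: "L \<le> \<bar>y - ?c\<bar>" using L by (auto simp: abs_real_def field_simps)
      have xc: "\<bar>x - ?c\<bar> \<le> L / 2" using x by (auto simp: abs_le_iff field_simps)
      have "cmod (K x y - K ?c y) \<le> B * \<bar>x - ?c\<bar> / (y - ?c)\<^sup>2" using y xc by (intro smooth_fst) auto
      also have "\<dots> \<le> B * (L / 2) / (y - ?c)\<^sup>2" using xc B0 by (intro divide_right_mono mult_left_mono) auto
      finally have "cmod ((K x y - K ?c y) * fo y) \<le> B * (L / 2) / (y - ?c)\<^sup>2 * cmod (f y)"
        using False B0 L unfolding norm_mult fo_def by (intro mult_mono) auto
      then have "ennreal (cmod ((K x y - K ?c y) * fo y)) \<le> ennreal (B * (L / 2) * (cmod (f y) * (1 / (y - ?c)\<^sup>2)))"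
        by (intro ennreal_leI) (simp add: mult_ac)
      also have "\<dots> = ennreal (B * (L / 2)) * (ennreal (cmod (f y)) * ennreal (1 / (y - ?c)\<^sup>2))"
        using B0 L by (simp only: ennreal_mult[symmetric] norm_ge_zero zero_le_divide_1_iff zero_le_power2
          zero_le_mult_iff less_imp_le half_gt_zero_iff simp_thms)
      finally show ?thesis using y by simp
    qed (simp add: fo_def)
  qed
  also have "\<dots> = ennreal (B * (L / 2)) * (\<integral>\<^sup>+y\<in>{y. L \<le> \<bar>y - ?c\<bar>}. ennreal (cmod (f y)) * ennreal (1 / (y - ?c)\<^sup>2) \<partial>lebesgue)"
    by (intro nn_integral_cmult) measurable
  also have "\<dots> \<le> ennreal (B * (L / 2)) * (ennreal (8 / L) * ?M)"
  proof (intro mult_left_mono nn_integral_inverse_square_tail L)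
    fix s assume s: "L \<le> s"
    show "(\<integral>\<^sup>+y\<in>{?c - s..?c + s}. ennreal (cmod (f y)) \<partial>lebesgue) \<le> ennreal (2 * s) * ?M"
      using set_nn_integral_le_maximal_op[of "?c - s" "?c + s" z "{?c - s..?c + s}" "\<lambda>y. ennreal (cmod (f y))"] s z L
      by (auto simp: field_simps)
  qed auto
  also have "\<dots> = ennreal (4 * B) * ?M"
  proof -
    have "ennreal (B * (L / 2)) * ennreal (8 / L) = ennreal (4 * B)"
      using B0 L by (subst ennreal_mult[symmetric]) auto
    then show ?thesis by (simp add: mult.assoc[symmetric])
  qed
  finally show ?thesis .
qed

text \<open>\<open>f\<close> is cut into its restrictions to the interval, to the two neighbours of
  the same length and to the rest. Each near piece lives on an interval of length \<open>L\<close>,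
  the format of the weak-type bound; the comparison constant is \<open>T\<close> of the far part,
  evaluated at the centre.\<close>

lemma T_oscillation:
  assumes f: "bounded_bounded_support f" and L: "L > 0" and \<nu>: "\<nu> > 0" and z: "z \<in> {a..<a + L}"
    and M: "maximal_op (\<lambda>y. ennreal (cmod (f y))) z \<le> ennreal \<nu>"
  defines "fo \<equiv> \<lambda>y. indicator (- {a - L..<a + 2 * L}) y * f y"
  shows "emeasure lebesgue {x \<in> {a..<a + L}. osc_const * \<nu> < cmod (T f x - T fo (a + L / 2))} \<le> ennreal (L / 8)"
proof -
  have [measurable]: "f \<in> borel_measurable lebesgue" using f by (rule bounded_bounded_support_measurable)
  define fi where "fi b = (\<lambda>y. indicator {b..<b + L} y * f y)" for b
  have fi: "bounded_bounded_support (fi b)" for b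
    unfolding fi_def by (rule bounded_bounded_support_indicator[OF f]) auto
  have cS: "- {a - L..<a + 2 * L} \<in> sets lebesgue"
    by (rule Compl_Ico_sets_lebesgue)
  have fo: "bounded_bounded_support fo"
    unfolding fo_def by (rule bounded_bounded_support_indicator[OF f cS])
  have dec: "f = (\<lambda>y. fi (a - L) y + (fi a y + (fi (a + L) y + fo y)))"
    using L by (auto simp: fun_eq_iff fi_def fo_def split: split_indicator)
  have Tf: "T f x = T (fi (a - L)) x + (T (fi a) x + (T (fi (a + L)) x + T fo x))" for x
    by (subst dec) (simp add: T_add fi fo bounded_bounded_support_add)
  define X where "X b = {x. weak_const * \<nu> < cmod (T (fi b) x)}" for b
  have Xm: "X b \<in> sets lebesgue" for b
  proof -
    note T_measurable[OF fi[of b], measurable]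
    have "{x \<in> space lebesgue. weak_const * \<nu> < cmod (T (fi b) x)} \<in> sets lebesgue" by measurable
    then show ?thesis by (simp add: X_def)
  qed
  have wn: "weak_const * \<nu> > 0" using weak_const_ge \<nu> by simp
  have small: "emeasure lebesgue (X b) \<le> ennreal (L / 24)" if b: "a - L \<le> b" "b + L \<le> a + 2 * L" for b
  proof -
    have "(\<integral>\<^sup>+x. ennreal (cmod (fi b x)) \<partial>lebesgue) = (\<integral>\<^sup>+x\<in>{b..<b + L}. ennreal (cmod (f x)) \<partial>lebesgue)"
      by (intro nn_integral_cong) (auto simp: fi_def split: split_indicator)
    also have "\<dots> \<le> ennreal (a + 2 * L - (a - L)) * maximal_op (\<lambda>y. ennreal (cmod (f y))) z"
      using b z L by (intro set_nn_integral_le_maximal_op) auto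
    also have "\<dots> \<le> ennreal (3 * L) * ennreal \<nu>"
      using L M by (intro mult_mono ennreal_leI) auto
    also have "\<dots> = ennreal (3 * L * \<nu>)" using L \<nu> by (simp add: ennreal_mult)
    finally have int: "(\<integral>\<^sup>+x. ennreal (cmod (fi b x)) \<partial>lebesgue) \<le> ennreal (3 * L * \<nu>)" .
    \<comment> \<open>This meets the requirement of the weak-type bound that the top interval does
      not stop at height \<open>weak_const * \<nu>\<close>.\<close>
    have "3 * L * \<nu> \<le> weak_const * \<nu> * L"
      using weak_const_ge L \<nu> by (simp add: mult_ac)
    then have "(\<integral>\<^sup>+x. ennreal (cmod (fi b x)) \<partial>lebesgue) \<le> ennreal (weak_const * \<nu> * L)"
      using int by (meson ennreal_leI order_trans)
    then have "emeasure lebesgue (X b) \<le> ennreal ((10 + 16 * B) / (weak_const * \<nu>)) * (\<integral>\<^sup>+x. ennreal (cmod (fi b x)) \<partial>lebesgue)"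
      unfolding X_def by (rule weak_type_one_one[where a = b, OF fi L wn, rotated]) (auto simp: fi_def)
    also have "\<dots> \<le> ennreal ((10 + 16 * B) / (weak_const * \<nu>)) * ennreal (3 * L * \<nu>)"
      by (intro mult_left_mono int) simp
    also have "\<dots> = ennreal (L / 24)"
      using B0 \<nu> L wn by (subst ennreal_mult[symmetric]) (auto simp: weak_const_def field_simps add_nonneg_eq_0_iff intro!: divide_nonneg_pos)
    finally show ?thesis .
  qed
  have far: "cmod (T fo x - T fo (a + L / 2)) \<le> 4 * B * \<nu>" if "x \<in> {a..<a + L}" for x
  proof -
    have "ennreal (cmod (T fo x - T fo (a + L / 2))) \<le> ennreal (4 * B) * ennreal \<nu>"
      using T_far_oscillation[OF f L that z] M unfolding fo_def[symmetric]
      by (meson mult_left_mono order_trans zero_le)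
    then show ?thesis using B0 \<nu> by (simp add: ennreal_mult[symmetric])
  qed
  have "{x \<in> {a..<a + L}. osc_const * \<nu> < cmod (T f x - T fo (a + L / 2))} \<subseteq> X (a - L) \<union> (X a \<union> X (a + L))"
  proof (rule subsetI, rule ccontr)
    fix x assume x: "x \<in> {x \<in> {a..<a + L}. osc_const * \<nu> < cmod (T f x - T fo (a + L / 2))}"
      and "x \<notin> X (a - L) \<union> (X a \<union> X (a + L))"
    then have "cmod (T (fi (a - L)) x) \<le> weak_const * \<nu>" "cmod (T (fi a) x) \<le> weak_const * \<nu>" "cmod (T (fi (a + L)) x) \<le> weak_const * \<nu>"
      by (auto simp: X_def)
    moreover have "cmod (T fo x - T fo (a + L / 2)) \<le> 4 * B * \<nu>" using far x by auto
    moreover have "T f x - T fo (a + L / 2) = T (fi (a - L)) x + (T (fi a) x + (T (fi (a + L)) x + (T fo x - T fo (a + L / 2))))"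
      using Tf[of x] by simp
    ultimately have "cmod (T f x - T fo (a + L / 2)) \<le> weak_const * \<nu> + (weak_const * \<nu> + (weak_const * \<nu> + 4 * B * \<nu>))"
      by (simp only:) (intro norm_triangle_le add_mono order_refl | assumption)+
    also have "\<dots> = osc_const * \<nu>" by (simp add: osc_const_def algebra_simps)
    finally show False using x by auto
  qed
  then have "emeasure lebesgue {x \<in> {a..<a + L}. osc_const * \<nu> < cmod (T f x - T fo (a + L / 2))} \<le> emeasure lebesgue (X (a - L) \<union> (X a \<union> X (a + L)))"
    by (intro emeasure_mono sets.Un Xm)
  also have "\<dots> \<le> emeasure lebesgue (X (a - L)) + (emeasure lebesgue (X a) + emeasure lebesgue (X (a + L)))"
    by (intro order_trans[OF emeasure_subadditive] add_left_mono emeasure_subadditive sets.Un Xm)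
  also have "\<dots> \<le> ennreal (L / 24) + (ennreal (L / 24) + ennreal (L / 24))"
    using small[of "a - L"] small[of a] small[of "a + L"] L by (intro add_mono) auto
  also have "\<dots> = ennreal (L / 24 + (L / 24 + L / 24))"
  proof -
    have "0 \<le> L / 24" using L by simp
    then show ?thesis by (simp only: ennreal_plus add_nonneg_nonneg)
  qed
  also have "L / 24 + (L / 24 + L / 24) = L / 8" by simp
  finally show ?thesis .
qed

text \<open>The shift by \<open>\<eta>\<close> keeps the heights strictly positive and strictly above the infimum of the maximal function.\<close>

lemma T_maximal_duality_bound:
  fixes g :: "real \<Rightarrow> ennreal"
  assumes f: "bounded_bounded_support f" and gm[measurable]: "g \<in> borel_measurable lebesgue"
    and g: "\<And>x. g x \<le> ennreal m" "\<And>x. m < \<bar>x\<bar> \<Longrightarrow> g x = 0"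
  shows "(\<integral>\<^sup>+x. ennreal (cmod (T f x)) * g x \<partial>lebesgue) \<le>
    ennreal (6 * osc_const) * (\<integral>\<^sup>+x. maximal_op (\<lambda>y. ennreal (cmod (f y))) x * maximal_op g x \<partial>lebesgue)"
proof -
  obtain r where r: "r > 0" "\<And>x. cmod (f x) \<le> r" "\<And>x. r < \<bar>x\<bar> \<Longrightarrow> f x = 0" and [measurable]: "f \<in> borel_measurable lebesgue"
    using bounded_bounded_supportE[OF f] by blast
  define R where "R = max \<bar>m\<bar> r + 1"
  have R: "R > 0" "\<bar>m\<bar> < R" "r < R" using r by (auto simp: R_def)
  define Mf where "Mf = maximal_op (\<lambda>y. ennreal (cmod (f y)))"
  have [measurable]: "Mf \<in> borel_measurable lebesgue" by (simp add: Mf_def)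
  have Mfr: "Mf x \<le> ennreal r" for x unfolding Mf_def using r by (intro maximal_op_le ennreal_leI)
  have Mgm: "maximal_op g x \<le> ennreal \<bar>m\<bar>" for x
    using g(1) by (intro maximal_op_le) (meson abs_ge_self ennreal_leI order_trans)
  have [measurable]: "T f \<in> borel_measurable lebesgue" by (rule T_measurable[OF f])
  \<comment> \<open>Integration is confined to \<open>[-R, R)\<close>, where \<open>g\<close> lives:
    the extra term \<open>\<eta>\<close> times \<open>maximal_op g\<close> is in general not
    integrable over the line.\<close>
  have main: "(\<integral>\<^sup>+x. ennreal (cmod (T f x)) * g x \<partial>lebesgue) \<le>
    ennreal (6 * osc_const) * (\<integral>\<^sup>+x\<in>{-R..<R}. (Mf x + ennreal \<eta>) * maximal_op g x \<partial>lebesgue)" if \<eta>: "\<eta> > 0" for \<eta>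
  proof -
    define \<nu> where "\<nu> a L = enn2real (INF x\<in>{a..<a + L}. Mf x) + \<eta>" for a L
    define \<alpha> where "\<alpha> a L = osc_const * \<nu> a L" for a L
    define c where "c a L = T (\<lambda>y. indicator (- {a - L..<a + 2 * L}) y * f y) (a + L / 2)" for a L
    have Inf: "ennreal (enn2real (INF x\<in>{a..<a + L}. Mf x)) = (INF x\<in>{a..<a + L}. Mf x)" "(INF x\<in>{a..<a + L}. Mf x) \<le> ennreal r"
      if "L > 0" for a L
    proof -
      show le: "(INF x\<in>{a..<a + L}. Mf x) \<le> ennreal r"
        using that Mfr[of a] by (intro INF_lower2[of a]) auto
      then have "(INF x\<in>{a..<a + L}. Mf x) < top" by (meson ennreal_less_top order_le_less_trans)
      then show "ennreal (enn2real (INF x\<in>{a..<a + L}. Mf x)) = (INF x\<in>{a..<a + L}. Mf x)" by simp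
    qed
    have \<nu>0: "\<nu> a L > 0" for a L using \<eta> by (simp add: \<nu>_def add_nonneg_pos)
    have \<nu>e: "ennreal (\<nu> a L) = (INF x\<in>{a..<a + L}. Mf x) + ennreal \<eta>" if "L > 0" for a L
      unfolding \<nu>_def using Inf(1)[OF that, of a] \<eta> by simp
    \<comment> \<open>\<open>H\<close> involves \<open>N\<close> and the size of \<open>f\<close>;
      it only has to be finite and is absent from the conclusion.\<close>
    define H where "H = Max {N * (LINT y|lebesgue. cmod (f y)), osc_const * (r + \<eta>), \<bar>m\<bar>}"
    have H: "N * (LINT y|lebesgue. cmod (f y)) \<le> H" "osc_const * (r + \<eta>) \<le> H" "\<bar>m\<bar> \<le> H" by (auto simp: H_def)
    have bound: "(\<integral>\<^sup>+x\<in>{a..<a + L}. ennreal (cmod (T f x - c a L)) * g x \<partial>lebesgue)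
           \<le> 6 * (\<integral>\<^sup>+x\<in>{a..<a + L}. (ennreal osc_const * (Mf x + ennreal \<eta>)) * maximal_op g x \<partial>lebesgue)" if "L > 0" for a L
    proof (rule local_oscillation_bound[where \<alpha> = \<alpha> and H = H, OF T_continuous[OF f] gm])
      fix a L :: real assume L: "L > 0"
      show "emeasure lebesgue {x \<in> {a..<a + L}. \<alpha> a L < cmod (T f x - c a L)} \<le> ennreal (L / 8)"
      proof -
        have "(INF x\<in>{a..<a + L}. Mf x) < ennreal (\<nu> a L)"
          using Inf[OF L, of a] \<eta> unfolding \<nu>_def by (metis add.commute enn2real_nonneg ennreal_less_iff less_add_same_cancel2)
        then obtain z where "z \<in> {a..<a + L}" "Mf z < ennreal (\<nu> a L)"
          unfolding INF_less_iff by blast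
        then show ?thesis unfolding \<alpha>_def c_def
          by (intro T_oscillation[OF f L \<nu>0]) (auto simp: Mf_def)
      qed
      show "\<alpha> a L \<le> \<alpha> b l" if l: "l > 0" "{b..<b + l} \<subseteq> {a..<a + L}" for b l
      proof -
        have "(INF x\<in>{a..<a + L}. Mf x) \<le> (INF x\<in>{b..<b + l}. Mf x)" using l by (intro INF_superset_mono) auto
        then have "enn2real (INF x\<in>{a..<a + L}. Mf x) \<le> enn2real (INF x\<in>{b..<b + l}. Mf x)"
          using Inf(2)[OF l(1), of b] by (intro enn2real_mono) (auto simp: order_le_less_trans)
        then show ?thesis using osc_const_pos by (simp add: \<alpha>_def \<nu>_def)
      qed
      show "ennreal (\<alpha> a L) \<le> ennreal osc_const * (Mf x + ennreal \<eta>)" if "x \<in> {a..<a + L}" for x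
      proof -
        have "ennreal (\<alpha> a L) = ennreal osc_const * ((INF x\<in>{a..<a + L}. Mf x) + ennreal \<eta>)"
          unfolding \<alpha>_def using osc_const_pos \<nu>0[of a L] \<nu>e[OF L] by (subst ennreal_mult) auto
        also have "\<dots> \<le> ennreal osc_const * (Mf x + ennreal \<eta>)"
          using that by (intro mult_left_mono add_right_mono INF_lower) auto
        finally show ?thesis .
      qed
      show "(\<integral>\<^sup>+y\<in>{a..<a + L}. g y \<partial>lebesgue) \<le> ennreal L * maximal_op g x" if "x \<in> {a..<a + L}" for x
        using set_nn_integral_le_maximal_op[of a "a + L" x "{a..<a + L}" g] that L
        by (auto simp: subset_iff)
      show "0 \<le> \<alpha> a L" using osc_const_pos \<nu>0[of a L] by (simp add: \<alpha>_def)
      have "\<nu> a L \<le> r + \<eta>"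
        using Inf[OF L, of a] r(1) unfolding \<nu>_def by (metis add_right_mono ennreal_le_iff less_imp_le)
      then show "\<alpha> a L \<le> H"
        using osc_const_pos H(2) unfolding \<alpha>_def by (meson mult_left_mono less_imp_le order_trans)
    next
      fix a L
      have "cmod (c a L) \<le> N * (LINT y|lebesgue. cmod (indicator (- {a - L..<a + 2 * L}) y * f y))"
        unfolding c_def
      proof (intro T_bounded bounded_bounded_support_indicator f)
        show "- {a - L..<a + 2 * L} \<in> sets lebesgue"
          by (rule Compl_Ico_sets_lebesgue)
      qed
      also have "\<dots> \<le> N * (LINT y|lebesgue. cmod (f y))"
        using bounded_bounded_support_integrable[OF f] N0
        by (intro mult_left_mono integral_mono_AE' AE_I2) (auto split: split_indicator)
      finally show "cmod (c a L) \<le> H" using H(1) by simp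
    next
      show "cmod (T f x) \<le> H" for x using T_bounded[OF f, of x] H(1) by simp
      show "g x \<le> ennreal H" for x using g(1)[of x] H(3) by (meson abs_ge_self ennreal_leI order_trans)
    qed (use that in measurable)
    \<comment> \<open>The tripled intervals of \<open>[-R, 0)\<close> and \<open>[0, R)\<close> both
      contain the support of \<open>f\<close>, so the far part vanishes and the oscillation about
      the constant is \<open>T f\<close> itself.\<close>
    have c0: "c (-R) R = 0" "c 0 R = 0"
    proof -
      have "(\<lambda>y. indicator (- {-R - R..<-R + 2 * R}) y * f y) = (\<lambda>_. 0)" "(\<lambda>y. indicator (- {0 - R..<0 + 2 * R}) y * f y) = (\<lambda>_. 0)"
        using r(3) R by (auto simp: fun_eq_iff split: split_indicator)
      then show "c (-R) R = 0" "c 0 R = 0" unfolding c_def by (simp_all only: T_def) auto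
    qed
    let ?V = "\<lambda>x. (ennreal osc_const * (Mf x + ennreal \<eta>)) * maximal_op g x"
    have sp: "(\<integral>\<^sup>+x\<in>{-R..<R}. F x \<partial>lebesgue) = (\<integral>\<^sup>+x\<in>{-R..<0}. F x \<partial>lebesgue) + (\<integral>\<^sup>+x\<in>{0..<R}. F x \<partial>lebesgue)"
      if [measurable]: "F \<in> borel_measurable lebesgue" for F :: "real \<Rightarrow> ennreal"
    proof -
      have "(\<integral>\<^sup>+x\<in>{-R..<R}. F x \<partial>lebesgue) = (\<integral>\<^sup>+x. F x * indicator {-R..<0} x + F x * indicator {0..<R} x \<partial>lebesgue)"
        using R(1) by (intro nn_integral_cong) (auto split: split_indicator)
      also have "\<dots> = (\<integral>\<^sup>+x\<in>{-R..<0}. F x \<partial>lebesgue) + (\<integral>\<^sup>+x\<in>{0..<R}. F x \<partial>lebesgue)"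
        by (rule nn_integral_add; measurable)
      finally show ?thesis .
    qed
    have "(\<integral>\<^sup>+x. ennreal (cmod (T f x)) * g x \<partial>lebesgue) = (\<integral>\<^sup>+x\<in>{-R..<R}. ennreal (cmod (T f x)) * g x \<partial>lebesgue)"
    proof (intro nn_integral_cong)
      fix x show "ennreal (cmod (T f x)) * g x = ennreal (cmod (T f x)) * g x * indicator {-R..<R} x"
      proof (cases "x \<in> {-R..<R}")
        case False
        then have "m < \<bar>x\<bar>" using R by auto
        then show ?thesis using g(2)[of x] by simp
      qed simp
    qed
    also have "\<dots> = (\<integral>\<^sup>+x\<in>{-R..<0}. ennreal (cmod (T f x)) * g x \<partial>lebesgue) + (\<integral>\<^sup>+x\<in>{0..<R}. ennreal (cmod (T f x)) * g x \<partial>lebesgue)"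
      by (rule sp) measurable
    also have "\<dots> \<le> 6 * (\<integral>\<^sup>+x\<in>{-R..<0}. ?V x \<partial>lebesgue) + 6 * (\<integral>\<^sup>+x\<in>{0..<R}. ?V x \<partial>lebesgue)"
      using bound[OF R(1), of "-R"] bound[OF R(1), of 0] by (intro add_mono) (auto simp: c0)
    also have "\<dots> = 6 * (\<integral>\<^sup>+x\<in>{-R..<R}. ?V x \<partial>lebesgue)"
      by (subst sp; (measurable; fail | rule distrib_left[symmetric]))
    also have "(\<integral>\<^sup>+x\<in>{-R..<R}. ?V x \<partial>lebesgue) = ennreal osc_const * (\<integral>\<^sup>+x\<in>{-R..<R}. (Mf x + ennreal \<eta>) * maximal_op g x \<partial>lebesgue)"
      by (subst nn_integral_cmult[symmetric]; (measurable; fail | simp only: mult.assoc))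
    also have "6 * (ennreal osc_const * (\<integral>\<^sup>+x\<in>{-R..<R}. (Mf x + ennreal \<eta>) * maximal_op g x \<partial>lebesgue))
      = ennreal (6 * osc_const) * (\<integral>\<^sup>+x\<in>{-R..<R}. (Mf x + ennreal \<eta>) * maximal_op g x \<partial>lebesgue)"
      using osc_const_pos by (subst ennreal_mult) (auto simp: mult.assoc)
    finally show ?thesis .
  qed
  show ?thesis unfolding Mf_def[symmetric]
  proof (rule ennreal_le_epsilon)
    fix e :: real assume e: "e > 0"
    \<comment> \<open>With \<open>\<eta> = e / D\<close> the error is at most \<open>e\<close>: it
      is \<open>\<eta>\<close> times \<open>|m|\<close>, a bound for \<open>maximal_op g\<close>,
      times the length \<open>2 * R\<close> and the constant in front.\<close>
    define D where "D = 6 * osc_const * (\<bar>m\<bar> * (2 * R)) + 1"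
    have D: "D > 0" unfolding D_def using osc_const_pos R by (intro add_nonneg_pos) auto
    define \<eta> where "\<eta> = e / D"
    have \<eta>: "\<eta> > 0" using e D by (simp add: \<eta>_def)
    have "(\<integral>\<^sup>+x\<in>{-R..<R}. (Mf x + ennreal \<eta>) * maximal_op g x \<partial>lebesgue)
      \<le> (\<integral>\<^sup>+x. Mf x * maximal_op g x + ennreal (\<eta> * \<bar>m\<bar>) * indicator {-R..<R} x \<partial>lebesgue)"
    proof (rule nn_integral_mono)
      fix x
      have "ennreal \<eta> * maximal_op g x \<le> ennreal (\<eta> * \<bar>m\<bar>)"
        using mult_left_mono[OF Mgm[of x], of "ennreal \<eta>"] \<eta> by (simp add: ennreal_mult)
      then show "(Mf x + ennreal \<eta>) * maximal_op g x * indicator {-R..<R} x \<le> Mf x * maximal_op g x + ennreal (\<eta> * \<bar>m\<bar>) * indicator {-R..<R} x"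
        by (auto simp: distrib_right add_mono split: split_indicator)
    qed
    also have "\<dots> = (\<integral>\<^sup>+x. Mf x * maximal_op g x \<partial>lebesgue) + ennreal (\<eta> * \<bar>m\<bar>) * emeasure lebesgue {-R..<R}"
      by (subst nn_integral_add) (measurable, simp add: nn_integral_cmult_indicator)
    also have "emeasure lebesgue {-R..<R} = ennreal (2 * R)" using R(1) emeasure_lebesgue_Ico[of "2 * R" "-R"] by simp
    finally have "(\<integral>\<^sup>+x. ennreal (cmod (T f x)) * g x \<partial>lebesgue) \<le> ennreal (6 * osc_const) *
      ((\<integral>\<^sup>+x. Mf x * maximal_op g x \<partial>lebesgue) + ennreal (\<eta> * \<bar>m\<bar>) * ennreal (2 * R))"
      using main[OF \<eta>] by (meson mult_left_mono order_trans zero_le)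
    also have "\<dots> = ennreal (6 * osc_const) * (\<integral>\<^sup>+x. Mf x * maximal_op g x \<partial>lebesgue) + ennreal (\<eta> * (6 * osc_const * (\<bar>m\<bar> * (2 * R))))"
      using osc_const_pos \<eta> R(1) by (simp add: distrib_left ennreal_mult[symmetric] mult_ac)
    also have "\<eta> * (6 * osc_const * (\<bar>m\<bar> * (2 * R))) \<le> \<eta> * D"
      using \<eta> by (intro mult_left_mono) (auto simp: D_def)
    also have "\<eta> * D = e" using D by (simp add: \<eta>_def)
    finally show "(\<integral>\<^sup>+x. ennreal (cmod (T f x)) * g x \<partial>lebesgue) \<le> ennreal (6 * osc_const) * (\<integral>\<^sup>+x. Mf x * maximal_op g x \<partial>lebesgue) + ennreal e"
      by (simp add: ennreal_leI add_left_mono)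
  qed
qed

end

section \<open>Banach function norms and duality\<close>

text \<open>The weights \<open>2 ^ n\<close> are summable against \<open>(1/4) ^ n\<close> and still
  strong enough: a.e. finiteness of the weighted sum bounds the increments by a multiple of
  \<open>sqrt (1/2) ^ n\<close>, so the given sequence itself converges a.e.\<close>

lemma AE_convergent_fast_L2_Cauchy:
  fixes s :: "nat \<Rightarrow> 'a \<Rightarrow> 'b::{banach, second_countable_topology}"
  assumes [measurable]: "\<And>n. s n \<in> borel_measurable M"
    and fast: "\<And>n. (\<integral>\<^sup>+x. ennreal ((norm (s (Suc n) x - s n x))\<^sup>2) \<partial>M) \<le> ennreal (c * (1/4) ^ n)"
  shows "AE x in M. convergent (\<lambda>n. s n x)"
proof -
  let ?f = "\<lambda>n x. ennreal (2 ^ n) * ennreal ((norm (s (Suc n) x - s n x))\<^sup>2)"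
  have "(\<integral>\<^sup>+x. (\<Sum>n. ?f n x) \<partial>M) = (\<Sum>n. \<integral>\<^sup>+x. ?f n x \<partial>M)"
    by (intro nn_integral_suminf) measurable
  also have "\<dots> = (\<Sum>n. ennreal (2 ^ n) * (\<integral>\<^sup>+x. ennreal ((norm (s (Suc n) x - s n x))\<^sup>2) \<partial>M))"
    by (intro suminf_cong nn_integral_cmult) measurable
  also have "\<dots> \<le> (\<Sum>n. ennreal (max 0 c) * ennreal ((1/2) ^ n))"
  proof (intro suminf_le)
    fix n
    have "ennreal (2 ^ n) * (\<integral>\<^sup>+x. ennreal ((norm (s (Suc n) x - s n x))\<^sup>2) \<partial>M) \<le> ennreal (2 ^ n) * ennreal (max 0 c * (1/4) ^ n)"
      by (intro mult_left_mono order_trans[OF fast] ennreal_leI mult_right_mono) auto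
    also have "\<dots> = ennreal (max 0 c) * ennreal ((1/2) ^ n)"
    proof -
      have "(2::real) ^ n * (max 0 c * (1/4) ^ n) = max 0 c * (1/2) ^ n"
        by (simp add: power_mult_distrib[symmetric] mult.left_commute)
      then show ?thesis by (simp add: ennreal_mult[symmetric])
    qed
    finally show "ennreal (2 ^ n) * (\<integral>\<^sup>+x. ennreal ((norm (s (Suc n) x - s n x))\<^sup>2) \<partial>M) \<le> ennreal (max 0 c) * ennreal ((1/2) ^ n)" .
  qed auto
  also have "\<dots> = ennreal (max 0 c) * 2" by (simp add: suminf_half_ennreal)
  also have "\<dots> < \<infinity>" by (simp add: ennreal_mult_less_top)
  finally have "AE x in M. (\<Sum>n. ?f n x) \<noteq> \<infinity>"
    by (intro nn_integral_noteq_infinite) auto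
  then show ?thesis
  proof eventually_elim
    case (elim x)
    then obtain r where r: "(\<Sum>n. ?f n x) = ennreal r" "r \<ge> 0" by (cases "\<Sum>n. ?f n x") auto
    have b: "norm (s (Suc n) x - s n x) \<le> sqrt r * sqrt (1/2) ^ n" for n
    proof -
      have "?f n x = (\<Sum>n\<in>{n}. ?f n x)" by simp
      also have "\<dots> \<le> ennreal r" unfolding r(1)[symmetric] by (intro sum_le_suminf) auto
      finally have "2 ^ n * (norm (s (Suc n) x - s n x))\<^sup>2 \<le> r"
        using r(2) by (simp add: ennreal_mult[symmetric])
      then have "(norm (s (Suc n) x - s n x))\<^sup>2 \<le> r * (1/2) ^ n"
        by (simp add: field_simps power_divide)
      then have "norm (s (Suc n) x - s n x) \<le> sqrt (r * (1/2) ^ n)" by (rule real_le_rsqrt)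
      then show ?thesis by (simp add: real_sqrt_mult real_sqrt_power)
    qed
    have "summable (\<lambda>n. sqrt r * sqrt (1/2) ^ n)"
      by (intro summable_mult summable_geometric) (simp add: real_sqrt_lt_1_iff)
    then have "summable (\<lambda>n. s (Suc n) x - s n x)"
      by (rule summable_comparison_test'[where N = 0]) (rule b)
    then have "(\<lambda>n. s n x - s 0 x) \<longlonglongrightarrow> (\<Sum>k. s (Suc k) x - s k x)"
      by (subst sum_lessThan_telescope[symmetric]) (rule summable_LIMSEQ)
    then have "(\<lambda>n. (s n x - s 0 x) + s 0 x) \<longlonglongrightarrow> (\<Sum>k. s (Suc k) x - s k x) + s 0 x"
      by (intro tendsto_add tendsto_const)
    then show ?case by (auto intro: convergentI)
  qed
qed

locale function_space =
  fixes \<rho> :: "(real \<Rightarrow> ennreal) \<Rightarrow> ennreal"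
  assumes function_norm: "banach_function_norm \<rho>"
begin

lemma zero_iff: "f \<in> borel_measurable lebesgue \<Longrightarrow> \<rho> f = 0 \<longleftrightarrow> (AE x in lebesgue. f x = 0)"
  using function_norm unfolding banach_function_norm_def by blast

lemma scale: "f \<in> borel_measurable lebesgue \<Longrightarrow> a \<ge> 0 \<Longrightarrow> \<rho> (\<lambda>x. ennreal a * f x) = ennreal a * \<rho> f"
  using function_norm unfolding banach_function_norm_def by blast

lemma triangle: "f \<in> borel_measurable lebesgue \<Longrightarrow> g \<in> borel_measurable lebesgue \<Longrightarrow> \<rho> (\<lambda>x. f x + g x) \<le> \<rho> f + \<rho> g"
  using function_norm unfolding banach_function_norm_def by blast

lemma mono_AE: "f \<in> borel_measurable lebesgue \<Longrightarrow> g \<in> borel_measurable lebesgue \<Longrightarrow>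
    AE x in lebesgue. g x \<le> f x \<Longrightarrow> \<rho> g \<le> \<rho> f"
  using function_norm unfolding banach_function_norm_def by blast

lemma mono: "f \<in> borel_measurable lebesgue \<Longrightarrow> g \<in> borel_measurable lebesgue \<Longrightarrow>
    (\<And>x. g x \<le> f x) \<Longrightarrow> \<rho> g \<le> \<rho> f"
  by (intro mono_AE AE_I2)

lemma monotone_limit:
  assumes "\<And>n. fs n \<in> borel_measurable lebesgue" "F \<in> borel_measurable lebesgue"
    and "AE x in lebesgue. incseq (\<lambda>n. fs n x) \<and> (\<lambda>n. fs n x) \<longlonglongrightarrow> F x"
  shows "(\<lambda>n. \<rho> (fs n)) \<longlonglongrightarrow> \<rho> F"
  using function_norm assms unfolding banach_function_norm_def by blast

lemma finite_indicator: "E \<in> sets lebesgue \<Longrightarrow> emeasure lebesgue E < \<infinity> \<Longrightarrow> \<rho> (indicator E) < \<infinity>"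
  using function_norm unfolding banach_function_norm_def by blast

lemma local_L1:
  assumes "E \<in> sets lebesgue" "emeasure lebesgue E < \<infinity>"
  obtains C where "\<And>f. f \<in> borel_measurable lebesgue \<Longrightarrow> (\<integral>\<^sup>+x\<in>E. f x \<partial>lebesgue) \<le> ennreal C * \<rho> f"
proof -
  have "\<exists>C::real. \<forall>f\<in>borel_measurable lebesgue. (\<integral>\<^sup>+x\<in>E. f x \<partial>lebesgue) \<le> ennreal C * \<rho> f"
    using function_norm assms unfolding banach_function_norm_def by blast
  then show ?thesis using that by blast
qed

lemma cong_AE:
  assumes "f \<in> borel_measurable lebesgue" "g \<in> borel_measurable lebesgue" "AE x in lebesgue. f x = g x"
  shows "\<rho> f = \<rho> g"
proof (rule antisym)
  show "\<rho> f \<le> \<rho> g" using assms(3) by (intro mono_AE assms) auto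
  show "\<rho> g \<le> \<rho> f" using assms(3) by (intro mono_AE assms) auto
qed

text \<open>The lower envelopes \<open>INF k\<in>{n..}. fs k x\<close> increase to the limit, so the
  monotone form of the axiom applies to them.\<close>

lemma Fatou:
  assumes [measurable]: "\<And>n. fs n \<in> borel_measurable lebesgue" "F \<in> borel_measurable lebesgue"
    and lim: "AE x in lebesgue. (\<lambda>n. fs n x) \<longlonglongrightarrow> F x" and le: "\<And>n. \<rho> (fs n) \<le> A"
  shows "\<rho> F \<le> A"
proof -
  let ?g = "\<lambda>n x. INF k\<in>{n..}. fs k x"
  have "AE x in lebesgue. incseq (\<lambda>n. ?g n x) \<and> (\<lambda>n. ?g n x) \<longlonglongrightarrow> F x"
    using lim
  proof eventually_elim
    case (elim x)
    have inc: "incseq (\<lambda>n. ?g n x)" by (auto simp: incseq_def intro!: INF_superset_mono)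
    then have "(\<lambda>n. ?g n x) \<longlonglongrightarrow> (SUP n. ?g n x)" by (rule LIMSEQ_SUP)
    moreover have "(SUP n. ?g n x) = F x"
      using lim_imp_Liminf[OF _ elim] by (simp add: liminf_SUP_INF)
    ultimately show ?case using inc by simp
  qed
  then have "(\<lambda>n. \<rho> (?g n)) \<longlonglongrightarrow> \<rho> F" by (intro monotone_limit) measurable
  moreover have "\<rho> (?g n) \<le> A" for n
    by (rule order_trans[OF mono le[of n]]) (measurable, auto intro: INF_lower)
  ultimately show ?thesis by (intro LIMSEQ_le_const2[of _ "\<rho> F"]) auto
qed

lemma convex_le:
  assumes "f \<in> borel_measurable lebesgue" "g \<in> borel_measurable lebesgue" "\<rho> f \<le> A" "\<rho> g \<le> A" "0 \<le> s" "s \<le> 1"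
  shows "\<rho> (\<lambda>x. ennreal (1 - s) * f x + ennreal s * g x) \<le> A"
proof -
  note [measurable] = assms(1,2)
  have "\<rho> (\<lambda>x. ennreal (1 - s) * f x + ennreal s * g x) \<le> \<rho> (\<lambda>x. ennreal (1 - s) * f x) + \<rho> (\<lambda>x. ennreal s * g x)"
    by (rule triangle) measurable
  also have "\<dots> = ennreal (1 - s) * \<rho> f + ennreal s * \<rho> g" using assms by (simp add: scale)
  also have "\<dots> \<le> ennreal (1 - s) * A + ennreal s * A" by (intro add_mono mult_left_mono assms) auto
  also have "\<dots> = A" using assms(5,6) unfolding distrib_right[symmetric] by (simp add: ennreal_plus[symmetric] del: ennreal_plus)
  finally show ?thesis .
qed

text \<open>Scaling \<open>u\<close> to norm one makes it a competitor in the supremum defining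
  \<open>assoc_norm\<close>; norm zero, where scaling is impossible, means \<open>u = 0\<close>
  a.e.\<close>

lemma Hoelder:
  assumes [measurable]: "u \<in> borel_measurable lebesgue" "v \<in> borel_measurable lebesgue" and fin: "\<rho> u < \<infinity>"
  shows "(\<integral>\<^sup>+x. u x * v x \<partial>lebesgue) \<le> \<rho> u * assoc_norm \<rho> v"
proof (cases "\<rho> u = 0")
  case True
  then have "AE x in lebesgue. u x = 0" using zero_iff by simp
  then have "(\<integral>\<^sup>+x. u x * v x \<partial>lebesgue) = (\<integral>\<^sup>+(x::real). 0 \<partial>lebesgue)" 
    by (intro nn_integral_cong_AE) auto
  then show ?thesis by simp
next
  case False
  obtain r where r: "\<rho> u = ennreal r" "r > 0" using fin False by (cases "\<rho> u") (auto simp: less_le)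
  have "\<rho> (\<lambda>x. ennreal (1 / r) * u x) = 1" using r by (subst scale) (auto simp: ennreal_mult[symmetric])
  then have "(\<integral>\<^sup>+x. (ennreal (1 / r) * u x) * v x \<partial>lebesgue) \<le> assoc_norm \<rho> v"
    unfolding assoc_norm_def by (intro SUP_upper) auto
  then have "ennreal r * (\<integral>\<^sup>+x. (ennreal (1 / r) * u x) * v x \<partial>lebesgue) \<le> \<rho> u * assoc_norm \<rho> v"
    unfolding r(1) by (rule mult_left_mono) simp
  also have "(\<integral>\<^sup>+x. (ennreal (1 / r) * u x) * v x \<partial>lebesgue) = ennreal (1 / r) * (\<integral>\<^sup>+x. u x * v x \<partial>lebesgue)"
    by (subst nn_integral_cmult[symmetric]; (measurable; fail | simp only: mult.assoc))
  finally show ?thesis using r(2) by (simp add: mult.assoc[symmetric] ennreal_mult[symmetric])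
qed

end

context function_space begin

text \<open>The duality \<open>\<rho>'' = \<rho>\<close>: a separating functional is the difference between \<open>h\<close> and its projection
  in \<open>L\<^sup>2\<close> onto the convex set of those \<open>b\<close> with \<open>0 \<le> b \<le> h\<close> and \<open>\<rho> b \<le> A\<close>.\<close>

lemma Lorentz_Luxemburg_bounded:
  fixes h :: "real \<Rightarrow> real"
  assumes hm[measurable]: "h \<in> borel_measurable lebesgue" and h: "\<And>x. 0 \<le> h x" "\<And>x. h x \<le> r" "\<And>x. r < \<bar>x\<bar> \<Longrightarrow> h x = 0"
    and r: "r \<ge> 0" and A: "A > 0"
    and dual: "\<And>g m. g \<in> borel_measurable lebesgue \<Longrightarrow> (\<And>x. g x \<le> ennreal m) \<Longrightarrow> (\<And>x. m < \<bar>x\<bar> \<Longrightarrow> g x = 0) \<Longrightarrow>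
       (\<integral>\<^sup>+x. ennreal (h x) * g x \<partial>lebesgue) \<le> ennreal A * assoc_norm \<rho> g"
  shows "\<rho> (\<lambda>x. ennreal (h x)) \<le> ennreal A"
proof -
  let ?E = "{-r..r}"
  have bint: "integrable lebesgue f" if "f \<in> borel_measurable lebesgue" "\<And>x. \<bar>f x\<bar> \<le> M" "\<And>x. x \<notin> ?E \<Longrightarrow> f x = 0" for f :: "real \<Rightarrow> real" and M
  proof (rule Bochner_Integration.integrable_bound)
    show "integrable lebesgue (\<lambda>x. indicator ?E x * M)"
      using r by (intro integrable_mult_left integrable_real_indicator) auto
    show "AE x in lebesgue. norm (f x) \<le> norm (indicator ?E x * M)"
    proof (intro AE_I2)
      fix x show "norm (f x) \<le> norm (indicator ?E x * M)"
        using that(2)[of x] that(3)[of x] by (cases "x \<in> ?E") (auto simp del: atLeastAtMost_iff)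
    qed
  qed (rule that)
  define \<B> where "\<B> = {b \<in> borel_measurable lebesgue. (\<forall>x. 0 \<le> b x \<and> b x \<le> h x) \<and> \<rho> (\<lambda>x. ennreal (b x)) \<le> ennreal A}"
  have hE: "h x = 0" if "x \<notin> ?E" for x using that h(3)[of x] by (auto simp: abs_real_def split: if_splits)
  have BE: "b x = 0" if "b \<in> \<B>" "x \<notin> ?E" for b x
  proof -
    have "0 \<le> b x" "b x \<le> h x" using that(1) by (auto simp: \<B>_def)
    then show ?thesis using hE[OF that(2)] by simp
  qed
  have Br: "0 \<le> b x" "b x \<le> r" "b x \<le> h x" "b \<in> borel_measurable lebesgue" "\<rho> (\<lambda>x. ennreal (b x)) \<le> ennreal A" if "b \<in> \<B>" for b x
    using that h(2)[of x] by (auto simp: \<B>_def intro: order_trans)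
  define J where "J b = (LINT x|lebesgue. (h x - b x)\<^sup>2)" for b
  have sqint: "integrable lebesgue (\<lambda>x. (u x - v x)\<^sup>2)"
    if "u \<in> borel_measurable lebesgue" "v \<in> borel_measurable lebesgue" "\<And>x. \<bar>u x\<bar> \<le> M" "\<And>x. \<bar>v x\<bar> \<le> M" "\<And>x. x \<notin> ?E \<Longrightarrow> u x = 0" "\<And>x. x \<notin> ?E \<Longrightarrow> v x = 0"
    for u v :: "real \<Rightarrow> real" and M
  proof (rule bint[of _ "(2 * M)\<^sup>2"])
    show "(\<lambda>x. (u x - v x)\<^sup>2) \<in> borel_measurable lebesgue" using that by measurable
    show "\<bar>(u x - v x)\<^sup>2\<bar> \<le> (2 * M)\<^sup>2" for x
    proof -
      have "\<bar>u x - v x\<bar> \<le> 2 * M" using that(3)[of x] that(4)[of x] by linarith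
      then have "\<bar>u x - v x\<bar>\<^sup>2 \<le> (2 * M)\<^sup>2" by (intro power_mono) auto
      then show ?thesis by simp
    qed
  qed (use that in auto)
  have habs: "\<bar>h x\<bar> \<le> r" for x using h[of x] by simp
  have Babs: "\<bar>b x\<bar> \<le> r" if "b \<in> \<B>" for b x using Br(1,2)[OF that, of x] by simp
  have Jint: "integrable lebesgue (\<lambda>x. (h x - b x)\<^sup>2)" if "b \<in> \<B>" for b
    by (rule sqint[of _ _ r]) (use that hE BE Br(4) habs Babs in auto)
  have J0: "J b \<ge> 0" for b unfolding J_def by (rule Bochner_Integration.integral_nonneg) simp
  have zB: "(\<lambda>_. 0) \<in> \<B>" using h A by (auto simp: \<B>_def zero_iff[THEN iffD2])
  define d where "d = (INF b\<in>\<B>. J b)"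
  have bdd: "bdd_below (J ` \<B>)" using J0 by (auto intro: bdd_belowI[of _ 0])
  have dle: "d \<le> J b" if "b \<in> \<B>" for b unfolding d_def by (rule cINF_lower[OF bdd that])
  have "\<exists>b\<in>\<B>. J b < d + (1/4) ^ n" for n :: nat
  proof -
    have "(INF b\<in>\<B>. J b) < d + (1/4) ^ n" by (simp add: d_def)
    then show ?thesis using cINF_less_iff[OF _ bdd] zB by blast
  qed
  then obtain b where b: "\<And>n. b n \<in> \<B>" "\<And>n. J (b n) < d + (1/4) ^ n" by metis
  note bm[measurable] = Br(4)[OF b(1)]
  \<comment> \<open>A minimising sequence with excess \<open>(1/4) ^ n\<close> is Cauchy by the
    parallelogram law: the midpoint is again admissible, hence \<open>d \<le> J ?m\<close>, and
    \<open>2 * (1/4) ^ n + 2 * (1/4) ^ Suc n \<le> 4 * (1/4) ^ n\<close>.\<close>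
  have conv: "AE x in lebesgue. convergent (\<lambda>n. b n x)"
  proof (rule AE_convergent_fast_L2_Cauchy[where c = 4])
    fix n
    let ?m = "\<lambda>x. (b n x + b (Suc n) x) / 2"
    have mB: "?m \<in> \<B>"
      unfolding \<B>_def
    proof (intro CollectI conjI allI)
      have "\<rho> (\<lambda>x. ennreal (1 - 1/2) * ennreal (b n x) + ennreal (1/2) * ennreal (b (Suc n) x)) \<le> ennreal A"
        using Br(5)[OF b(1)] by (intro convex_le) auto
      moreover have "ennreal (1 - 1/2) * ennreal (b n x) + ennreal (1/2) * ennreal (b (Suc n) x) = ennreal (?m x)" for x
      proof -
        have cvx: "ennreal (1 - s) * ennreal u + ennreal s * ennreal v = ennreal ((1 - s) * u + s * v)"
          if "0 \<le> s" "s \<le> 1" "0 \<le> u" "0 \<le> v" for s u v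
          using that by (simp add: ennreal_mult)
        have e: "(1 - 1/2) * b n x + 1/2 * b (Suc n) x = ?m x" by simp
        show ?thesis
          using cvx[of "1/2" "b n x" "b (Suc n) x"] Br(1)[OF b(1), of n x] Br(1)[OF b(1), of "Suc n" x]
          unfolding e by linarith
      qed
      ultimately show "\<rho> (\<lambda>x. ennreal (?m x)) \<le> ennreal A" by simp
      show "0 \<le> ?m x" "?m x \<le> h x" for x
        using Br(1,3)[OF b(1), of n x] Br(1,3)[OF b(1), of "Suc n" x] by auto
    qed measurable
    have int: "integrable lebesgue (\<lambda>x. (b (Suc n) x - b n x)\<^sup>2)"
      by (rule sqint[of _ _ r]) (use b(1) BE Babs in auto)
    have "(LINT x|lebesgue. (b (Suc n) x - b n x)\<^sup>2)
      = (LINT x|lebesgue. 2 * (h x - b n x)\<^sup>2 + 2 * (h x - b (Suc n) x)\<^sup>2 - 4 * (h x - ?m x)\<^sup>2)"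
      by (intro Bochner_Integration.integral_cong) (auto simp: power2_eq_square field_simps)
    also have "\<dots> = 2 * J (b n) + 2 * J (b (Suc n)) - 4 * J ?m"
      unfolding J_def using Jint[OF b(1)[of n]] Jint[OF b(1)[of "Suc n"]] Jint[OF mB] by simp
    also have "\<dots> \<le> 4 * (1/4) ^ n"
    proof -
      have "0 \<le> (1/4::real) ^ n" by simp
      then show ?thesis using b(2)[of n] b(2)[of "Suc n"] dle[OF mB] unfolding power_Suc by linarith
    qed
    finally have "(LINT x|lebesgue. (b (Suc n) x - b n x)\<^sup>2) \<le> 4 * (1/4) ^ n" .
    then show "(\<integral>\<^sup>+x. ennreal ((norm (b (Suc n) x - b n x))\<^sup>2) \<partial>lebesgue) \<le> ennreal (4 * (1/4) ^ n)"
      by (subst nn_integral_eq_integral) (use int in \<open>auto intro: ennreal_leI\<close>)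
  qed measurable
  \<comment> \<open>Clamping to \<open>[0, h x]\<close> repairs the null set where
    \<open>lim\<close> is arbitrary, so that \<open>p\<close> satisfies the pointwise conditions
    everywhere.\<close>
  define p where "p x = min (h x) (max 0 (lim (\<lambda>n. b n x)))" for x
  have pm[measurable]: "p \<in> borel_measurable lebesgue" unfolding p_def by measurable
  have p0: "0 \<le> p x" "p x \<le> h x" for x using h(1)[of x] by (auto simp: p_def)
  have plim: "AE x in lebesgue. (\<lambda>n. b n x) \<longlonglongrightarrow> p x"
    using conv
  proof eventually_elim
    case (elim x)
    then have l: "(\<lambda>n. b n x) \<longlonglongrightarrow> lim (\<lambda>n. b n x)" by (simp add: convergent_LIMSEQ_iff)
    have "0 \<le> lim (\<lambda>n. b n x)" using Br(1)[OF b(1)] by (intro LIMSEQ_le_const[OF l]) auto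
    moreover have "lim (\<lambda>n. b n x) \<le> h x" using Br(3)[OF b(1)] by (intro LIMSEQ_le_const2[OF l]) auto
    ultimately show ?case using l by (simp add: p_def)
  qed
  have pB: "p \<in> \<B>"
  proof -
    have "\<rho> (\<lambda>x. ennreal (p x)) \<le> ennreal A"
      by (rule Fatou[of "\<lambda>n x. ennreal (b n x)"]) (use plim Br(5)[OF b(1)] in \<open>auto elim!: eventually_mono intro: tendsto_ennrealI\<close>)
    then show ?thesis using p0 pm by (simp add: \<B>_def)
  qed
  have Jp: "J p \<le> J q" if "q \<in> \<B>" for q
  proof -
    have "(\<lambda>n. J (b n)) \<longlonglongrightarrow> J p"
      unfolding J_def
    proof (rule integral_dominated_convergence[where w = "\<lambda>x. indicator ?E x * r\<^sup>2"])
      show "integrable lebesgue (\<lambda>x. indicator ?E x * r\<^sup>2)"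
        using r by (intro integrable_mult_left integrable_real_indicator) auto
      show "AE x in lebesgue. (\<lambda>n. (h x - b n x)\<^sup>2) \<longlonglongrightarrow> (h x - p x)\<^sup>2"
        using plim by eventually_elim (intro tendsto_intros)
      show "AE x in lebesgue. norm ((h x - b n x)\<^sup>2) \<le> indicator ?E x * r\<^sup>2" for n
      proof (intro AE_I2)
        fix x show "norm ((h x - b n x)\<^sup>2) \<le> indicator ?E x * r\<^sup>2"
        proof (cases "x \<in> ?E")
          case True
          have "(h x - b n x)\<^sup>2 \<le> r\<^sup>2" using Br(1,3)[OF b(1), of n x] h(2)[of x] by (intro power_mono) auto
          then show ?thesis using True by simp
        qed (use hE BE[OF b(1)] in simp)
      qed
    qed measurable
    moreover have "(\<lambda>n. d + (1/4) ^ n) \<longlonglongrightarrow> d + 0" by (intro tendsto_intros LIMSEQ_realpow_zero) auto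
    ultimately have "J p \<le> d + 0" by (rule LIMSEQ_le) (use b(2) in \<open>auto intro: less_imp_le\<close>)
    then show ?thesis using dle[OF that] by simp
  qed
  define g where "g x = h x - p x" for x
  have [measurable]: "g \<in> borel_measurable lebesgue" unfolding g_def by measurable
  have g: "0 \<le> g x" "g x \<le> r" "x \<notin> ?E \<Longrightarrow> g x = 0" for x
    using p0[of x] h(2)[of x] hE[of x] by (auto simp: g_def)
  have gabs: "\<bar>g x\<bar> \<le> r" for x using g[of x] by simp
  have pabs: "\<bar>p x\<bar> \<le> r" for x using Babs[OF pB] .
  have pE: "x \<notin> ?E \<Longrightarrow> p x = 0" for x using BE[OF pB] .
  have gpint: "integrable lebesgue (\<lambda>x. g x * p x)"
  proof (rule bint[of _ "r * r"])
    show "\<bar>g x * p x\<bar> \<le> r * r" for x unfolding abs_mult using gabs pabs r by (intro mult_mono) auto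
  qed (use g pE in auto)
  \<comment> \<open>The variational inequality of the projection, for competitors \<open>c\<close>
    that may exceed \<open>h\<close>.\<close>
  have var: "(LINT x|lebesgue. g x * c x) \<le> (LINT x|lebesgue. g x * p x)"
    if cm[measurable]: "c \<in> borel_measurable lebesgue" and c: "\<And>x. 0 \<le> c x" "\<And>x. c x \<le> M" "\<And>x. x \<notin> ?E \<Longrightarrow> c x = 0"
      and cA: "\<rho> (\<lambda>x. ennreal (c x)) \<le> ennreal A" for c M
  proof -
    have M0: "M \<ge> 0" using c(1)[of 0] c(2)[of 0] by simp
    have cabs: "\<bar>c x\<bar> \<le> max M r" "\<bar>p x\<bar> \<le> max M r" for x using c[of x] pabs[of x] by auto
    have gcint: "integrable lebesgue (\<lambda>x. g x * c x)"
    proof (rule bint[of _ "r * M"])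
      show "\<bar>g x * c x\<bar> \<le> r * M" for x unfolding abs_mult using gabs c r by (intro mult_mono) auto
    qed (use g c in auto)
    have cpint: "integrable lebesgue (\<lambda>x. (c x - p x)\<^sup>2)"
      by (rule sqint[of _ _ "max M r"]) (use cabs c pE in auto)
    have gint: "integrable lebesgue (\<lambda>x. (g x)\<^sup>2)"
      unfolding g_def by (rule Jint[OF pB])
    define \<delta> where "\<delta> = (LINT x|lebesgue. g x * c x) - (LINT x|lebesgue. g x * p x)"
    define S where "S = (LINT x|lebesgue. (c x - p x)\<^sup>2)"
    have key: "2 * \<delta> \<le> s * S" if s: "0 < s" "s \<le> 1" for s
    proof -
      \<comment> \<open>The segment from \<open>p\<close> to \<open>c\<close> may rise above
        \<open>h\<close>; cutting it off at \<open>h\<close> keeps it admissible by the lattice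
        property and can only decrease the distance to \<open>h\<close>.\<close>
      define q where "q x = min (h x) ((1 - s) * p x + s * c x)" for x
      have qm[measurable]: "q \<in> borel_measurable lebesgue" unfolding q_def by measurable
      have nn: "0 \<le> (1 - s) * p x + s * c x" for x using s p0[of x] c[of x] by (intro add_nonneg_nonneg mult_nonneg_nonneg) auto
      have q0: "0 \<le> q x" "q x \<le> h x" for x using h(1)[of x] nn[of x] by (auto simp: q_def)
      have "\<rho> (\<lambda>x. ennreal (q x)) \<le> \<rho> (\<lambda>x. ennreal (1 - s) * ennreal (p x) + ennreal s * ennreal (c x))"
      proof (rule mono)
        fix x
        have "ennreal (q x) \<le> ennreal ((1 - s) * p x + s * c x)" by (intro ennreal_leI) (simp add: q_def)
        also have "\<dots> = ennreal (1 - s) * ennreal (p x) + ennreal s * ennreal (c x)"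
          using s p0[of x] c(1)[of x] by (simp add: ennreal_mult)
        finally show "ennreal (q x) \<le> ennreal (1 - s) * ennreal (p x) + ennreal s * ennreal (c x)" .
      qed measurable
      also have "\<dots> \<le> ennreal A" by (rule convex_le) (use Br(5)[OF pB] cA s in auto)
      finally have qB: "q \<in> \<B>" using q0 qm by (simp add: \<B>_def)
      have "J p \<le> J q" by (rule Jp[OF qB])
      also have "\<dots> \<le> (LINT x|lebesgue. (g x)\<^sup>2 - 2 * s * (g x * c x - g x * p x) + s\<^sup>2 * (c x - p x)\<^sup>2)"
        unfolding J_def
      proof (rule integral_mono)
        fix x
        have "(h x - q x)\<^sup>2 \<le> (h x - ((1 - s) * p x + s * c x))\<^sup>2"
          unfolding q_def by (auto simp: min_def)
        also have "\<dots> = (g x)\<^sup>2 - 2 * s * (g x * c x - g x * p x) + s\<^sup>2 * (c x - p x)\<^sup>2"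
          by (simp add: g_def power2_eq_square algebra_simps)
        finally show "(h x - q x)\<^sup>2 \<le> (g x)\<^sup>2 - 2 * s * (g x * c x - g x * p x) + s\<^sup>2 * (c x - p x)\<^sup>2" .
      qed (use Jint[OF qB] gint gcint gpint cpint in auto)
      also have "\<dots> = J p - 2 * s * \<delta> + s\<^sup>2 * S"
        using gint gcint gpint cpint by (simp add: J_def \<delta>_def S_def g_def[symmetric])
      finally have "s * (2 * \<delta>) \<le> s * (s * S)" by (simp add: power2_eq_square)
      then show ?thesis using s by simp
    qed
    have "\<delta> \<le> 0"
    proof (rule ccontr)
      assume "\<not> \<delta> \<le> 0"
      then have \<delta>: "\<delta> > 0" by simp
      have S0: "S \<ge> 0" unfolding S_def by (rule Bochner_Integration.integral_nonneg) simp
      \<comment> \<open>Small enough for \<open>s * S \<le> \<delta>\<close>, against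
        \<open>2 * \<delta> \<le> s * S\<close>; the 1 in the denominator covers
        \<open>S = 0\<close>.\<close>
      define s where "s = min 1 (\<delta> / (S + 1))"
      have s: "0 < s" "s \<le> 1" "s \<le> \<delta> / (S + 1)" using \<delta> S0 by (auto simp: s_def)
      have "s * S \<le> \<delta> / (S + 1) * (S + 1)" using s S0 \<delta> by (intro mult_mono) auto
      also have "\<dots> = \<delta>" using S0 by simp
      finally show False using key[OF s(1,2)] \<delta> by simp
    qed
    then show ?thesis by (simp add: \<delta>_def)
  qed
  define I where "I = (LINT x|lebesgue. g x * p x)"
  \<comment> \<open>By \<open>var\<close> the functional given by \<open>g\<close> is at most
    \<open>I\<close> on functions of norm at most \<open>A\<close>, hence at most
    \<open>I / A\<close> on the unit ball.\<close>
  have dualg: "ennreal A * assoc_norm \<rho> (\<lambda>x. ennreal (g x)) \<le> ennreal I"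
  proof -
    have "(\<integral>\<^sup>+x. f x * ennreal (g x) \<partial>lebesgue) \<le> ennreal (I / A)"
      if fm[measurable]: "f \<in> borel_measurable lebesgue" and f1: "\<rho> f \<le> 1" for f
    proof -
      \<comment> \<open>\<open>var\<close> accepts only bounded functions vanishing off
        \<open>?E\<close>; the truncations increase to \<open>A * f\<close> there, and
        \<open>g\<close> vanishes elsewhere.\<close>
      define c where "c n x = A * enn2real (min (f x) (of_nat n)) * indicator ?E x" for n :: nat and x
      have cm[measurable]: "c n \<in> borel_measurable lebesgue" for n unfolding c_def by measurable
      have fe: "ennreal (enn2real (min (f x) (of_nat n))) = min (f x) (of_nat n)" for n :: nat and x
        by (intro ennreal_enn2real) (auto simp: min_less_iff_disj ennreal_of_nat_eq_real_of_nat)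
      have cE: "ennreal (c n x) = ennreal A * (min (f x) (of_nat n) * indicator ?E x)" for n x
        unfolding c_def using A fe[of x n] by (auto simp: ennreal_mult split: split_indicator)
      have "(\<integral>\<^sup>+x. (min (f x) (of_nat n) * indicator ?E x) * ennreal (g x) \<partial>lebesgue) \<le> ennreal (I / A)" for n :: nat
      proof -
        have cn: "0 \<le> c n x" "c n x \<le> A * real n" "x \<notin> ?E \<Longrightarrow> c n x = 0" for x
        proof -
          have "enn2real (min (f x) (of_nat n)) \<le> real n"
            by (rule enn2real_leI) (auto simp: ennreal_of_nat_eq_real_of_nat)
          then show "c n x \<le> A * real n" using A by (auto simp: c_def split: split_indicator)
        qed (use A in \<open>auto simp: c_def\<close>)
        have "(LINT x|lebesgue. g x * c n x) \<le> I"
          unfolding I_def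
        proof (rule var)
          show "0 \<le> c n x" "c n x \<le> A * real n" for x by (rule cn)+
          show "c n x = 0" if "x \<notin> ?E" for x by (rule cn(3)[OF that])
          have "\<rho> (\<lambda>x. ennreal (c n x)) = ennreal A * \<rho> (\<lambda>x. min (f x) (of_nat n) * indicator ?E x)"
            unfolding cE using A by (intro scale) auto
          also have "\<dots> \<le> ennreal A * \<rho> f"
            by (intro mult_left_mono mono) (auto split: split_indicator)
          also have "\<dots> \<le> ennreal A * 1" by (intro mult_left_mono f1) auto
          finally show "\<rho> (\<lambda>x. ennreal (c n x)) \<le> ennreal A" by simp
        qed measurable
        moreover have "integrable lebesgue (\<lambda>x. g x * c n x)"
        proof (rule bint[of _ "r * (A * real n)"])
          show "\<bar>g x * c n x\<bar> \<le> r * (A * real n)" for x unfolding abs_mult using gabs cn[of x] r by (intro mult_mono) auto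
        qed (use g in auto)
        ultimately have "(\<integral>\<^sup>+x. ennreal (g x * c n x) \<partial>lebesgue) \<le> ennreal I"
          using g(1) cn(1) by (subst nn_integral_eq_integral) (auto intro: ennreal_leI)
        also have "(\<integral>\<^sup>+x. ennreal (g x * c n x) \<partial>lebesgue) = (\<integral>\<^sup>+x. ennreal A * ((min (f x) (of_nat n) * indicator ?E x) * ennreal (g x)) \<partial>lebesgue)"
        proof (intro nn_integral_cong)
          fix x
          have "ennreal (g x * c n x) = ennreal (c n x) * ennreal (g x)" using g(1)[of x] cn(1)[of x] by (simp add: ennreal_mult mult.commute)
          then show "ennreal (g x * c n x) = ennreal A * ((min (f x) (of_nat n) * indicator ?E x) * ennreal (g x))"
            by (simp add: cE mult.assoc)
        qed
        also have "\<dots> = ennreal A * (\<integral>\<^sup>+x. (min (f x) (of_nat n) * indicator ?E x) * ennreal (g x) \<partial>lebesgue)"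
          by (intro nn_integral_cmult) measurable
        finally have "ennreal (1 / A) * (ennreal A * (\<integral>\<^sup>+x. (min (f x) (of_nat n) * indicator ?E x) * ennreal (g x) \<partial>lebesgue)) \<le> ennreal (1 / A) * ennreal I"
          by (rule mult_left_mono) simp
        also have "ennreal (1 / A) * ennreal I = ennreal (I / A)" using A by (simp add: ennreal_mult'[symmetric])
        finally show ?thesis using A by (simp add: mult.assoc[symmetric] ennreal_mult[symmetric])
      qed
      moreover have "(\<integral>\<^sup>+x. f x * ennreal (g x) \<partial>lebesgue) = (SUP n. \<integral>\<^sup>+x. (min (f x) (of_nat n) * indicator ?E x) * ennreal (g x) \<partial>lebesgue)"
      proof -
        have "(\<integral>\<^sup>+x. f x * ennreal (g x) \<partial>lebesgue) = (\<integral>\<^sup>+x. (SUP n. (min (f x) (of_nat n) * indicator ?E x) * ennreal (g x)) \<partial>lebesgue)"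
        proof (intro nn_integral_cong)
          fix x
          have "(SUP n. min (f x) (of_nat n)) = f x"
            by (simp add: inf_min[symmetric] inf_SUP[symmetric] ennreal_SUP_of_nat_eq_top)
          then have "f x * ennreal (g x) = (SUP n. min (f x) (of_nat n)) * ennreal (g x)" by simp
          also have "\<dots> = (SUP n. min (f x) (of_nat n) * ennreal (g x))" by (rule SUP_mult_right_ennreal)
          finally show "f x * ennreal (g x) = (SUP n. (min (f x) (of_nat n) * indicator ?E x) * ennreal (g x))"
            using g(3)[of x] by (cases "x \<in> ?E") auto
        qed
        also have "\<dots> = (SUP n. \<integral>\<^sup>+x. (min (f x) (of_nat n) * indicator ?E x) * ennreal (g x) \<partial>lebesgue)"
          by (intro nn_integral_monotone_convergence_SUP)
             (auto simp: incseq_def le_fun_def intro!: mult_right_mono min.mono)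
        finally show ?thesis .
      qed
      ultimately show ?thesis by (simp add: SUP_le_iff)
    qed
    then have "assoc_norm \<rho> (\<lambda>x. ennreal (g x)) \<le> ennreal (I / A)"
      unfolding assoc_norm_def by (intro SUP_least) auto
    then have "ennreal A * assoc_norm \<rho> (\<lambda>x. ennreal (g x)) \<le> ennreal A * ennreal (I / A)" by (rule mult_left_mono) simp
    then show ?thesis using A by (simp add: ennreal_mult'[symmetric])
  qed
  have "(\<integral>\<^sup>+x. ennreal (h x) * ennreal (g x) \<partial>lebesgue) \<le> ennreal I"
  \<comment> \<open>The hypothesis on \<open>h\<close> is tested with \<open>g\<close> and bounds
    the integral of \<open>h * g\<close> by \<open>I\<close>. As \<open>h = p + g\<close>, this
    integral equals \<open>I + J p\<close>, so \<open>J p = 0\<close>.\<close>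
  proof (rule order_trans[OF dual[of _ r] dualg])
    fix x assume "r < \<bar>x\<bar>"
    then have "x \<notin> ?E" by auto
    then show "ennreal (g x) = 0" using g(3) by simp
  qed (use g in \<open>auto intro: ennreal_leI\<close>)
  moreover have "(\<integral>\<^sup>+x. ennreal (h x) * ennreal (g x) \<partial>lebesgue) = ennreal (I + J p)"
  proof -
    have "(\<integral>\<^sup>+x. ennreal (h x) * ennreal (g x) \<partial>lebesgue) = (\<integral>\<^sup>+x. ennreal (g x * p x + (g x)\<^sup>2) \<partial>lebesgue)"
      using h(1) g(1) by (intro nn_integral_cong) (auto simp: ennreal_mult[symmetric] g_def power2_eq_square algebra_simps)
    also have "\<dots> = ennreal (LINT x|lebesgue. g x * p x + (g x)\<^sup>2)"
      using gpint Jint[OF pB] g(1) p0 by (intro nn_integral_eq_integral) (auto simp: g_def)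
    also have "(LINT x|lebesgue. g x * p x + (g x)\<^sup>2) = I + J p"
      using gpint Jint[OF pB] by (simp add: I_def J_def g_def)
    finally show ?thesis .
  qed
  moreover have "I \<ge> 0" unfolding I_def using g(1) p0 by (intro Bochner_Integration.integral_nonneg) auto
  ultimately have "J p \<le> 0" by simp
  then have "J p = 0" using J0[of p] by simp
  then have "AE x in lebesgue. (h x - p x)\<^sup>2 = 0"
    unfolding J_def using Jint[OF pB] by (subst (asm) integral_nonneg_eq_0_iff_AE) auto
  then have "\<rho> (\<lambda>x. ennreal (h x)) = \<rho> (\<lambda>x. ennreal (p x))"
    by (intro cong_AE) auto
  then show ?thesis using Br(5)[OF pB] by simp
qed

text \<open>Cut off at height \<open>n\<close> and to \<open>[-n, n]\<close>: the truncations lie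
  below \<open>h\<close> and inherit the dual bound, and Fatou removes the truncation.\<close>

lemma Lorentz_Luxemburg:
  fixes h :: "real \<Rightarrow> ennreal"
  assumes hm[measurable]: "h \<in> borel_measurable lebesgue" and A: "A > 0"
    and dual: "\<And>g m. g \<in> borel_measurable lebesgue \<Longrightarrow> (\<And>x. g x \<le> ennreal m) \<Longrightarrow> (\<And>x. m < \<bar>x\<bar> \<Longrightarrow> g x = 0) \<Longrightarrow>
       (\<integral>\<^sup>+x. h x * g x \<partial>lebesgue) \<le> ennreal A * assoc_norm \<rho> g"
  shows "\<rho> h \<le> ennreal A"
proof -
  define k where "k n x = enn2real (min (h x) (of_nat n)) * indicator {-real n..real n} x" for n :: nat and x
  have [measurable]: "k n \<in> borel_measurable lebesgue" for n unfolding k_def by measurable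
  have ke: "ennreal (k n x) = min (h x) (of_nat n) * indicator {-real n..real n} x" for n x
  proof -
    have "ennreal (enn2real (min (h x) (of_nat n))) = min (h x) (of_nat n)"
      by (intro ennreal_enn2real) (auto simp: min_less_iff_disj ennreal_of_nat_eq_real_of_nat)
    then show ?thesis by (auto simp: k_def split: split_indicator)
  qed
  have le: "ennreal (k n x) \<le> h x" for n x unfolding ke by (auto split: split_indicator)
  show ?thesis
  proof (rule Fatou[of "\<lambda>n x. ennreal (k n x)"])
    show "\<rho> (\<lambda>x. ennreal (k n x)) \<le> ennreal A" for n
    proof (rule Lorentz_Luxemburg_bounded[of _ "real n", OF _ _ _ _ _ A])
      show "0 \<le> k n x" for x by (simp add: k_def)
      show "k n x \<le> real n" for x
      proof -
        have "enn2real (min (h x) (of_nat n)) \<le> real n"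
          by (rule enn2real_leI) (auto simp: ennreal_of_nat_eq_real_of_nat)
        then show ?thesis by (auto simp: k_def split: split_indicator)
      qed
      show "k n x = 0" if "real n < \<bar>x\<bar>" for x using that by (auto simp: k_def split: split_indicator)
      fix g :: "real \<Rightarrow> ennreal" and m :: real
      assume g: "g \<in> borel_measurable lebesgue" "\<And>x. g x \<le> ennreal m" "\<And>x. m < \<bar>x\<bar> \<Longrightarrow> g x = 0"
      have "(\<integral>\<^sup>+x. ennreal (k n x) * g x \<partial>lebesgue) \<le> (\<integral>\<^sup>+x. h x * g x \<partial>lebesgue)"
        by (intro nn_integral_mono mult_right_mono le) auto
      also have "\<dots> \<le> ennreal A * assoc_norm \<rho> g" by (rule dual[OF g])
      finally show "(\<integral>\<^sup>+x. ennreal (k n x) * g x \<partial>lebesgue) \<le> ennreal A * assoc_norm \<rho> g" .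
    qed auto
    show "AE x in lebesgue. (\<lambda>n. ennreal (k n x)) \<longlonglongrightarrow> h x"
    proof (intro AE_I2)
      fix x
      have inc: "incseq (\<lambda>n. ennreal (k n x))"
        unfolding incseq_def ke by (auto intro: min.coboundedI2 of_nat_mono split: split_indicator)
      have "h x \<le> (SUP n. ennreal (k n x))"
      proof -
        obtain N where N: "\<bar>x\<bar> \<le> real N" using real_arch_simple by blast
        have "(SUP n. min (h x) (of_nat n)) = h x"
          by (simp add: inf_min[symmetric] inf_SUP[symmetric] ennreal_SUP_of_nat_eq_top)
        moreover have "(SUP n. min (h x) (of_nat n)) \<le> (SUP n. ennreal (k n x))"
        proof (rule SUP_least)
          fix n :: nat
          have "min (h x) (of_nat n) \<le> ennreal (k (max n N) x)"
          proof -
            have "x \<in> {- real (max n N)..real (max n N)}" using N by auto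
            then show ?thesis unfolding ke by (auto intro: min.coboundedI2 of_nat_mono)
          qed
          also have "\<dots> \<le> (SUP n. ennreal (k n x))" by (rule SUP_upper) simp
          finally show "min (h x) (of_nat n) \<le> (SUP n. ennreal (k n x))" .
        qed
        ultimately show ?thesis by simp
      qed
      then have "(SUP n. ennreal (k n x)) = h x" using le by (intro antisym SUP_least) auto
      then show "(\<lambda>n. ennreal (k n x)) \<longlonglongrightarrow> h x" using LIMSEQ_SUP[OF inc] by simp
    qed
  qed measurable
qed

end

section \<open>Orthonormal expansions\<close>

text \<open>The squared norm as an extended value, so that estimates can be stated before membership
  in L2 is known.\<close>

definition L2sq :: "(real \<Rightarrow> complex) \<Rightarrow> ennreal" where
  "L2sq f = (\<integral>\<^sup>+x. ennreal ((cmod (f x))\<^sup>2) \<partial>lebesgue)"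

lemma in_L2_iff: "in_L2 f \<longleftrightarrow> f \<in> borel_measurable lebesgue \<and> L2sq f < \<infinity>"
  by (simp add: in_L2_def L2sq_def)

lemma in_L2_measurable: "in_L2 f \<Longrightarrow> f \<in> borel_measurable lebesgue"
  by (simp add: in_L2_def)

lemma L2sq_add_le:
  assumes "f \<in> borel_measurable lebesgue" "g \<in> borel_measurable lebesgue"
  shows "L2sq (\<lambda>x. f x + g x) \<le> 2 * L2sq f + 2 * L2sq g"
proof -
  note [measurable] = assms
  have "L2sq (\<lambda>x. f x + g x) \<le> (\<integral>\<^sup>+x. 2 * ennreal ((cmod (f x))\<^sup>2) + 2 * ennreal ((cmod (g x))\<^sup>2) \<partial>lebesgue)"
    unfolding L2sq_def
  proof (rule nn_integral_mono)
    fix x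
    have "(cmod (f x + g x))\<^sup>2 \<le> (cmod (f x) + cmod (g x))\<^sup>2"
      by (intro power_mono norm_triangle_ineq) auto
    also have "\<dots> \<le> 2 * (cmod (f x))\<^sup>2 + 2 * (cmod (g x))\<^sup>2"
      using zero_le_power2[of "cmod (f x) - cmod (g x)"] by (simp add: power2_eq_square algebra_simps)
    finally have "ennreal ((cmod (f x + g x))\<^sup>2) \<le> ennreal (2 * (cmod (f x))\<^sup>2 + 2 * (cmod (g x))\<^sup>2)"
      by (rule ennreal_leI)
    then show "ennreal ((cmod (f x + g x))\<^sup>2) \<le> 2 * ennreal ((cmod (f x))\<^sup>2) + 2 * ennreal ((cmod (g x))\<^sup>2)"
      by (simp add: ennreal_mult)
  qed
  also have "\<dots> = 2 * L2sq f + 2 * L2sq g"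
    unfolding L2sq_def by (subst nn_integral_add) (auto simp: nn_integral_cmult)
  finally show ?thesis .
qed

lemma L2sq_cmult:
  assumes "f \<in> borel_measurable lebesgue"
  shows "L2sq (\<lambda>x. a * f x) = ennreal ((cmod a)\<^sup>2) * L2sq f"
  using assms unfolding L2sq_def
  by (subst nn_integral_cmult[symmetric]) (auto simp: norm_mult power_mult_distrib ennreal_mult)

lemma L2sq_diff_le:
  assumes "f \<in> borel_measurable lebesgue" "g \<in> borel_measurable lebesgue"
  shows "L2sq (\<lambda>x. f x - g x) \<le> 2 * L2sq f + 2 * L2sq g"
  using L2sq_add_le[of f "\<lambda>x. - 1 * g x"] L2sq_cmult[of g "-1"] assms by simp

lemma L2sq_eq_0_iff:
  assumes "f \<in> borel_measurable lebesgue"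
  shows "L2sq f = 0 \<longleftrightarrow> (AE x in lebesgue. f x = 0)"
  unfolding L2sq_def using assms by (subst nn_integral_0_iff_AE) auto

lemma in_L2_add: "in_L2 f \<Longrightarrow> in_L2 g \<Longrightarrow> in_L2 (\<lambda>x. f x + g x)"
  using L2sq_add_le[of f g] unfolding in_L2_iff
  by (auto simp: ennreal_mult_less_top intro: order_le_less_trans)

lemma in_L2_cmult: "in_L2 f \<Longrightarrow> in_L2 (\<lambda>x. a * f x)"
  unfolding in_L2_iff by (auto simp: L2sq_cmult ennreal_mult_less_top)

lemma in_L2_sum:
  assumes "finite G" "\<And>i. i \<in> G \<Longrightarrow> in_L2 (f i)"
  shows "in_L2 (\<lambda>x. \<Sum>i\<in>G. f i x)"
  using assms
proof (induction G)
  case empty then show ?case by (simp add: in_L2_def)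
next
  case (insert i G)
  then show ?case by (simp add: in_L2_add)
qed

lemma borel_measurable_cnj [measurable]: "cnj \<in> borel_measurable borel"
  by (intro borel_measurable_continuous_onI continuous_intros)

lemma in_L2_mult_integrable:
  assumes "in_L2 f" "in_L2 g"
  shows "integrable lebesgue (\<lambda>x. f x * cnj (g x))"
proof (rule Bochner_Integration.integrable_bound)
  note [measurable] = in_L2_measurable[OF assms(1)] in_L2_measurable[OF assms(2)]
  have "integrable lebesgue (\<lambda>x. (cmod (f x))\<^sup>2)" "integrable lebesgue (\<lambda>x. (cmod (g x))\<^sup>2)"
    using assms unfolding in_L2_def by (auto intro!: integrableI_nonneg)
  then show "integrable lebesgue (\<lambda>x. (cmod (f x))\<^sup>2 + (cmod (g x))\<^sup>2)" by simp
  show "AE x in lebesgue. norm (f x * cnj (g x)) \<le> norm ((cmod (f x))\<^sup>2 + (cmod (g x))\<^sup>2)"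
  proof (intro AE_I2)
    fix x
    have "2 * (cmod (f x) * cmod (g x)) \<le> (cmod (f x))\<^sup>2 + (cmod (g x))\<^sup>2"
      using zero_le_power2[of "cmod (f x) - cmod (g x)"] by (simp add: power2_eq_square algebra_simps)
    moreover have "0 \<le> cmod (f x) * cmod (g x)" by simp
    ultimately have "cmod (f x) * cmod (g x) \<le> (cmod (f x))\<^sup>2 + (cmod (g x))\<^sup>2" by linarith
    then show "norm (f x * cnj (g x)) \<le> norm ((cmod (f x))\<^sup>2 + (cmod (g x))\<^sup>2)"
      by (simp add: norm_mult)
  qed
  show "(\<lambda>x. f x * cnj (g x)) \<in> borel_measurable lebesgue" by measurable
qed

lemma l2_inner_add_left: "in_L2 f \<Longrightarrow> in_L2 g \<Longrightarrow> in_L2 h \<Longrightarrow> l2_inner (\<lambda>x. f x + g x) h = l2_inner f h + l2_inner g h"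
  unfolding l2_inner_def by (simp add: distrib_right in_L2_mult_integrable)

lemma l2_inner_cmult_left: "l2_inner (\<lambda>x. a * f x) h = a * l2_inner f h"
  unfolding l2_inner_def by (simp add: mult.assoc)

lemma l2_inner_cnj: "cnj (l2_inner f g) = l2_inner g f"
  using Bochner_Integration.integral_cnj[of lebesgue "\<lambda>x. f x * cnj (g x)"]
  unfolding l2_inner_def by (simp add: mult.commute)

lemma l2_inner_sum_left:
  assumes "finite G" "\<And>i. i \<in> G \<Longrightarrow> in_L2 (f i)" "in_L2 h"
  shows "l2_inner (\<lambda>x. \<Sum>i\<in>G. f i x) h = (\<Sum>i\<in>G. l2_inner (f i) h)"
  using assms
proof (induction G)
  case empty then show ?case by (simp add: l2_inner_def)
next
  case (insert i G)
  then show ?case by (simp add: l2_inner_add_left in_L2_sum)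
qed

lemma l2_inner_self:
  assumes "in_L2 f"
  shows "L2sq f = ennreal (Re (l2_inner f f))" "Re (l2_inner f f) \<ge> 0"
proof -
  have "integrable lebesgue (\<lambda>x. (cmod (f x))\<^sup>2)"
    using assms unfolding in_L2_def by (auto intro!: integrableI_nonneg)
  moreover have e: "l2_inner f f = of_real (LINT x|lebesgue. (cmod (f x))\<^sup>2)"
    unfolding l2_inner_def complex_norm_square[symmetric] by (rule integral_complex_of_real)
  ultimately show "L2sq f = ennreal (Re (l2_inner f f))" unfolding L2sq_def
    by (subst nn_integral_eq_integral) auto
  show "Re (l2_inner f f) \<ge> 0" unfolding e by simp
qed

locale orthonormal_family =
  fixes e :: "'i \<Rightarrow> real \<Rightarrow> complex"
  assumes e_measurable: "\<And>i. e i \<in> borel_measurable lebesgue"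
    and orthonormal: "\<And>i j. l2_inner (e i) (e j) = (if i = j then 1 else 0)"
begin

text \<open>A non-integrable function has integral 0, so \<open>l2_inner (e i) (e i) = 1\<close> forces square integrability.\<close>

lemma e_L2: "in_L2 (e i)"
proof -
  have "integrable lebesgue (\<lambda>x. e i x * cnj (e i x))"
    using orthonormal[of i i] not_integrable_integral_eq unfolding l2_inner_def by fastforce
  then have "integrable lebesgue (\<lambda>x. cmod (e i x * cnj (e i x)))" by (rule integrable_norm)
  then have "integrable lebesgue (\<lambda>x. (cmod (e i x))\<^sup>2)" by (simp add: norm_mult power2_eq_square)
  then have "(\<integral>\<^sup>+x. ennreal (norm ((cmod (e i x))\<^sup>2)) \<partial>lebesgue) < \<infinity>" by (simp only: integrable_iff_bounded)
  then show ?thesis unfolding in_L2_def using e_measurable by simp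
qed

definition comb :: "('i \<Rightarrow> complex) \<Rightarrow> 'i set \<Rightarrow> real \<Rightarrow> complex" where
  "comb a G x = (\<Sum>i\<in>G. a i * e i x)"

lemma comb_L2: "finite G \<Longrightarrow> in_L2 (comb a G)"
  unfolding comb_def by (intro in_L2_sum in_L2_cmult e_L2)

lemma inner_comb: "finite G \<Longrightarrow> in_L2 f \<Longrightarrow> l2_inner (comb a G) f = (\<Sum>i\<in>G. a i * l2_inner (e i) f)"
  unfolding comb_def by (subst l2_inner_sum_left) (auto intro: in_L2_cmult e_L2 simp: l2_inner_cmult_left)

lemma inner_comb_e: "finite G \<Longrightarrow> l2_inner (comb a G) (e j) = (if j \<in> G then a j else 0)"
  by (simp add: inner_comb e_L2 orthonormal if_distrib cong: if_cong)

lemma L2sq_comb: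
  assumes G: "finite G"
  shows "L2sq (comb a G) = ennreal (\<Sum>i\<in>G. (cmod (a i))\<^sup>2)"
proof -
  have "l2_inner (comb a G) (comb a G) = (\<Sum>i\<in>G. a i * cnj (l2_inner (comb a G) (e i)))"
    using G by (simp add: inner_comb comb_L2 l2_inner_cnj)
  also have "\<dots> = (\<Sum>i\<in>G. of_real ((cmod (a i))\<^sup>2))"
    using G by (intro sum.cong) (auto simp: inner_comb_e complex_norm_square[symmetric])
  finally have "Re (l2_inner (comb a G) (comb a G)) = (\<Sum>i\<in>G. (cmod (a i))\<^sup>2)" by simp
  then show ?thesis using l2_inner_self[OF comb_L2[OF G]] by simp
qed

text \<open>With \<open>p\<close> the projection onto the span, the squared norm of
  \<open>f - p\<close> is that of \<open>f\<close> minus the sum, because the inner products of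
  \<open>p\<close> with \<open>f\<close>, of \<open>f\<close> with \<open>p\<close> and of
  \<open>p\<close> with itself all equal this sum.\<close>

lemma Bessel:
  assumes f: "in_L2 f" and G: "finite G"
  shows "ennreal (\<Sum>i\<in>G. (cmod (l2_inner f (e i)))\<^sup>2) \<le> L2sq f"
proof -
  define c where "c i = l2_inner f (e i)" for i
  define p where "p = comb c G"
  have p: "in_L2 p" unfolding p_def by (rule comb_L2[OF G])
  have mp: "in_L2 (\<lambda>x. - 1 * p x)" by (rule in_L2_cmult[OF p])
  have q: "in_L2 (\<lambda>x. f x + - 1 * p x)" by (rule in_L2_add[OF f mp])
  have pf: "l2_inner p f = of_real (\<Sum>i\<in>G. (cmod (c i))\<^sup>2)"
  proof -
    have "l2_inner p f = (\<Sum>i\<in>G. c i * cnj (c i))"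
      unfolding p_def by (simp add: inner_comb G f c_def l2_inner_cnj)
    then show ?thesis by (simp add: complex_norm_square[symmetric])
  qed
  have fp: "l2_inner f p = of_real (\<Sum>i\<in>G. (cmod (c i))\<^sup>2)"
    using pf by (metis complex_cnj_complex_of_real l2_inner_cnj)
  have pp: "Re (l2_inner p p) = (\<Sum>i\<in>G. (cmod (c i))\<^sup>2)"
    using l2_inner_self[OF p] L2sq_comb[OF G, of c] unfolding p_def[symmetric]
    by (metis ennreal_inj sum_nonneg zero_le_power2)
  have left: "l2_inner (\<lambda>x. f x + - 1 * p x) h = l2_inner f h - l2_inner p h" if "in_L2 h" for h
    using l2_inner_add_left[OF f mp that] l2_inner_cmult_left[of "-1" p h] by simp
  have "l2_inner (\<lambda>x. f x + - 1 * p x) (\<lambda>x. f x + - 1 * p x)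
     = cnj (l2_inner f f - l2_inner p f) - cnj (l2_inner f p - l2_inner p p)"
    by (subst left[OF q]) (simp add: left[OF f, symmetric] left[OF p, symmetric] l2_inner_cnj)
  then have "0 \<le> Re (l2_inner f f) - (\<Sum>i\<in>G. (cmod (c i))\<^sup>2)"
    using l2_inner_self(2)[OF q] by (simp add: pf fp pp)
  then show ?thesis using l2_inner_self(1)[OF f] by (simp add: c_def ennreal_leI)
qed

lemma comb_diff:
  assumes "finite G" "finite H"
  shows "comb a G x - comb a H x = comb a (G - H) x - comb a (H - G) x"
proof -
  have "comb a G x = comb a (G \<inter> H) x + comb a (G - H) x" if "finite G" for G H
  proof -
    have "(\<Sum>i\<in>(G \<inter> H) \<union> (G - H). a i * e i x) = comb a (G \<inter> H) x + comb a (G - H) x"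
      using that unfolding comb_def by (intro sum.union_disjoint) auto
    then show ?thesis by (simp add: comb_def Int_Diff_Un)
  qed
  from this[OF assms(1), of H] this[OF assms(2), of G] show ?thesis by (simp add: Int_commute)
qed

text \<open>The difference is a combination over the symmetric difference of the index sets, with
  the sign changed on \<open>H - G\<close>, which leaves the moduli alone.\<close>

lemma L2sq_comb_diff:
  assumes G: "finite G" and H: "finite H"
  shows "L2sq (\<lambda>x. comb a G x - comb a H x) = ennreal (\<Sum>i\<in>(G - H) \<union> (H - G). (cmod (a i))\<^sup>2)"
proof -
  have "comb a G x - comb a H x = comb (\<lambda>i. if i \<in> G then a i else - a i) ((G - H) \<union> (H - G)) x" for x
  proof -
    have "comb (\<lambda>i. if i \<in> G then a i else - a i) ((G - H) \<union> (H - G)) x =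
       (\<Sum>i\<in>G - H. (if i \<in> G then a i else - a i) * e i x) + (\<Sum>i\<in>H - G. (if i \<in> G then a i else - a i) * e i x)"
      unfolding comb_def using G H by (intro sum.union_disjoint) auto
    also have "\<dots> = comb a (G - H) x + (\<Sum>i\<in>H - G. - (a i * e i x))"
      unfolding comb_def by (intro arg_cong2[of _ _ _ _ "(+)"] sum.cong) auto
    finally show ?thesis unfolding comb_diff[OF G H] by (simp add: sum_negf comb_def)
  qed
  then show ?thesis using G H L2sq_comb[of "(G - H) \<union> (H - G)" "\<lambda>i. if i \<in> G then a i else - a i"]
    by (simp add: if_distrib[of cmod] cong: if_cong)
qed

text \<open>Square-summable coefficients make the net of finite partial sums Cauchy. Besides the
  unconditional L2 limit, a sequence of index sets with a.e. convergence is returned, since the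
  Fatou property of a function norm works with pointwise limits.\<close>

lemma unconditional_L2_limit:
  assumes bdd: "\<And>G. finite G \<Longrightarrow> (\<Sum>i\<in>G. (cmod (a i))\<^sup>2) \<le> S"
  obtains g H where "in_L2 g" "\<And>n. finite (H n)" "AE x in lebesgue. (\<lambda>n. comb a (H n) x) \<longlonglongrightarrow> g x"
    "\<And>\<epsilon>. \<epsilon> > 0 \<Longrightarrow> \<exists>F. finite F \<and> (\<forall>G. finite G \<and> F \<subseteq> G \<longrightarrow> L2sq (\<lambda>x. g x - comb a G x) < ennreal \<epsilon>)"
proof -
  have "(\<lambda>i. (cmod (a i))\<^sup>2) summable_on UNIV"
    by (intro nonneg_bdd_above_summable_on bdd_aboveI[of _ S]) (auto intro: bdd)
  then obtain s where s: "((\<lambda>i. (cmod (a i))\<^sup>2) has_sum s) UNIV" by (auto simp: summable_on_def)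
  have "\<exists>F. finite F \<and> (\<forall>G. finite G \<and> F \<subseteq> G \<longrightarrow> \<bar>(\<Sum>i\<in>G. (cmod (a i))\<^sup>2) - s\<bar> < (1/4) ^ n / 2)" for n :: nat
  proof -
    have "eventually (\<lambda>G. dist (\<Sum>i\<in>G. (cmod (a i))\<^sup>2) s < (1/4) ^ n / 2) (finite_subsets_at_top UNIV)"
      using s unfolding has_sum_def by (rule tendstoD) simp
    then show ?thesis unfolding eventually_finite_subsets_at_top by (auto simp: dist_real_def)
  qed
  then obtain F where F: "\<And>n. finite (F n)"
    "\<And>n G. finite G \<Longrightarrow> F n \<subseteq> G \<Longrightarrow> \<bar>(\<Sum>i\<in>G. (cmod (a i))\<^sup>2) - s\<bar> < (1/4) ^ n / 2" by metis
  \<comment> \<open>The sums over \<open>F n\<close> and over its union with \<open>G\<close> are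
    both within \<open>(1/4) ^ n / 2\<close> of \<open>s\<close>, so a finite set disjoint from
    \<open>F n\<close> carries at most \<open>(1/4) ^ n\<close>.\<close>
  have tail: "(\<Sum>i\<in>G. (cmod (a i))\<^sup>2) \<le> (1/4) ^ n" if "finite G" "G \<inter> F n = {}" for G n
  proof -
    have "(\<Sum>i\<in>G \<union> F n. (cmod (a i))\<^sup>2) = (\<Sum>i\<in>G. (cmod (a i))\<^sup>2) + (\<Sum>i\<in>F n. (cmod (a i))\<^sup>2)"
      using that F(1) by (intro sum.union_disjoint) auto
    moreover have "\<bar>(\<Sum>i\<in>G \<union> F n. (cmod (a i))\<^sup>2) - s\<bar> < (1/4) ^ n / 2" "\<bar>(\<Sum>i\<in>F n. (cmod (a i))\<^sup>2) - s\<bar> < (1/4) ^ n / 2"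
      using F(2)[of "G \<union> F n" n] F(2)[of "F n" n] F(1)[of n] that(1) by blast+
    ultimately show ?thesis by linarith
  qed
  define H where "H n = (\<Union>m\<le>n. F m)" for n
  have Hf: "finite (H n)" for n unfolding H_def using F(1) by auto
  have FH: "F m \<subseteq> H n" if "m \<le> n" for m n using that by (auto simp: H_def)
  have diff: "L2sq (\<lambda>x. comb a G x - comb a G' x) \<le> ennreal ((1/4) ^ n)"
    if "finite G" "finite G'" "F n \<subseteq> G" "F n \<subseteq> G'" for G G' n
    unfolding L2sq_comb_diff[OF that(1,2)] using that by (intro ennreal_leI tail) auto
  have cm[measurable]: "comb a G \<in> borel_measurable lebesgue" for G
    unfolding comb_def using e_measurable by measurable
  have conv: "AE x in lebesgue. convergent (\<lambda>n. comb a (H n) x)"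
  proof (rule AE_convergent_fast_L2_Cauchy[where c = 1])
    fix n
    show "(\<integral>\<^sup>+x. ennreal ((norm (comb a (H (Suc n)) x - comb a (H n) x))\<^sup>2) \<partial>lebesgue) \<le> ennreal (1 * (1/4) ^ n)"
      using diff[of "H (Suc n)" "H n" n] Hf FH by (simp add: L2sq_def)
  qed measurable
  define g where "g x = lim (\<lambda>n. comb a (H n) x)" for x
  have [measurable]: "g \<in> borel_measurable lebesgue" unfolding g_def by measurable
  have lim: "AE x in lebesgue. (\<lambda>n. comb a (H n) x) \<longlonglongrightarrow> g x"
    using conv by eventually_elim (simp add: g_def convergent_LIMSEQ_iff)
  \<comment> \<open>Fatou along \<open>H m\<close>, whose partial sums are eventually within
    \<open>(1/4) ^ n\<close>, in squared norm, of the one over \<open>G\<close>.\<close>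
  have close: "L2sq (\<lambda>x. g x - comb a G x) \<le> ennreal ((1/4) ^ n)" if G: "finite G" "F n \<subseteq> G" for G n
  proof -
    have "L2sq (\<lambda>x. g x - comb a G x) = (\<integral>\<^sup>+x. liminf (\<lambda>m. ennreal ((cmod (comb a (H m) x - comb a G x))\<^sup>2)) \<partial>lebesgue)"
      unfolding L2sq_def
    proof (intro nn_integral_cong_AE, use lim in eventually_elim)
      fix x assume "(\<lambda>n. comb a (H n) x) \<longlonglongrightarrow> g x"
      then have "(\<lambda>m. ennreal ((cmod (comb a (H m) x - comb a G x))\<^sup>2)) \<longlonglongrightarrow> ennreal ((cmod (g x - comb a G x))\<^sup>2)"
        by (intro tendsto_ennrealI tendsto_intros)
      then show "ennreal ((cmod (g x - comb a G x))\<^sup>2) = liminf (\<lambda>m. ennreal ((cmod (comb a (H m) x - comb a G x))\<^sup>2))"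
        by (intro lim_imp_Liminf[symmetric]) auto
    qed
    also have "\<dots> \<le> liminf (\<lambda>m. L2sq (\<lambda>x. comb a (H m) x - comb a G x))"
      unfolding L2sq_def by (rule nn_integral_liminf) measurable
    also have "\<dots> \<le> ennreal ((1/4) ^ n)"
    proof (rule Liminf_le)
      show "\<forall>\<^sub>F m in sequentially. L2sq (\<lambda>x. comb a (H m) x - comb a G x) \<le> ennreal ((1/4) ^ n)"
        using eventually_ge_at_top[of n] by eventually_elim (use diff[of _ G n] Hf FH G in blast)
    qed simp
    finally show ?thesis .
  qed
  have "in_L2 g"
  proof -
    have "L2sq (\<lambda>x. (g x - comb a (F 0) x) + comb a (F 0) x) \<le> 2 * L2sq (\<lambda>x. g x - comb a (F 0) x) + 2 * L2sq (comb a (F 0))"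
      by (rule L2sq_add_le) measurable
    also have "\<dots> < \<infinity>"
    proof -
      have "L2sq (\<lambda>x. g x - comb a (F 0) x) < \<infinity>"
        using close[OF F(1) order_refl, of 0] by (rule order_le_less_trans) simp
      then show ?thesis using comb_L2[OF F(1), of a 0] unfolding in_L2_iff by (simp add: ennreal_mult_less_top)
    qed
    finally show ?thesis by (simp add: in_L2_iff)
  qed
  moreover have "\<exists>F. finite F \<and> (\<forall>G. finite G \<and> F \<subseteq> G \<longrightarrow> L2sq (\<lambda>x. g x - comb a G x) < ennreal \<epsilon>)" if "\<epsilon> > 0" for \<epsilon> :: real
  proof -
    obtain n where n: "(1/4) ^ n < \<epsilon>" using real_arch_pow_inv[OF \<open>\<epsilon> > 0\<close>, of "1/4"] by auto
    then have "ennreal ((1/4) ^ n) < ennreal \<epsilon>" using that by (intro ennreal_lessI)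
    then show ?thesis using F(1)[of n] close[of _ n] by (meson order_le_less_trans)
  qed
  ultimately show thesis using that Hf lim by blast
qed

end

section \<open>Kernels of wavelet multipliers\<close>

text \<open>A lower Riemann sum over disjoint cells. It turns discrete sums of values of
  \<open>W\<close> into integrals, once with cells of length 1/2 and once with dyadic cells.\<close>

lemma sum_mult_emeasure_le_nn_integral:
  assumes "finite F" "disjoint_family_on A F" "\<And>i. i \<in> F \<Longrightarrow> A i \<in> sets M"
    and le: "\<And>i x. i \<in> F \<Longrightarrow> x \<in> A i \<Longrightarrow> c i \<le> f x"
  shows "(\<Sum>i\<in>F. c i * emeasure M (A i)) \<le> (\<integral>\<^sup>+x. f x \<partial>M)"
proof -
  have "(\<Sum>i\<in>F. c i * emeasure M (A i)) = (\<integral>\<^sup>+x. (\<Sum>i\<in>F. c i * indicator (A i) x) \<partial>M)"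
    using assms(3) by (subst nn_integral_sum) (auto simp: nn_integral_cmult_indicator)
  also have "\<dots> \<le> (\<integral>\<^sup>+x. f x \<partial>M)"
  proof (rule nn_integral_mono)
    fix x
    show "(\<Sum>i\<in>F. c i * indicator (A i) x) \<le> f x"
    proof (cases "\<exists>j\<in>F. x \<in> A j")
      case True
      then obtain j where j: "j \<in> F" "x \<in> A j" by blast
      have "(\<Sum>i\<in>F. c i * indicator (A i) x) = (\<Sum>i\<in>F. if i = j then c i else 0)"
      proof (intro sum.cong refl)
        fix i assume i: "i \<in> F"
        have "x \<notin> A i" if "i \<noteq> j" using disjoint_family_onD[OF assms(2) i j(1) that] j by auto
        then show "c i * indicator (A i) x = (if i = j then c i else 0)" using j by auto
      qed
      then show ?thesis using j le assms(1) by simp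
    next
      case False
      then have "(\<Sum>i\<in>F. c i * indicator (A i) x) = 0" by (intro sum.neutral) auto
      then show ?thesis by simp
    qed
  qed
  finally show ?thesis .
qed

section \<open>Decay of the wavelet, summed over translates and scales\<close>

locale decaying_wavelet =
  fixes \<psi> \<psi>' :: "real \<Rightarrow> complex" and W :: "real \<Rightarrow> real"
  assumes deriv: "\<And>x. (\<psi> has_vector_derivative \<psi>' x) (at x)"
    and majorant: "radial_decr_L1_majorant W \<psi>"
    and majorant': "radial_decr_L1_majorant W \<psi>'"
    and moment: "set_integrable lborel {0..} (\<lambda>s. s * W s)"
begin

lemma W_decr: "0 \<le> s \<Longrightarrow> s \<le> t \<Longrightarrow> W t \<le> W s"
  using majorant by (auto simp: radial_decr_L1_majorant_def)

lemma W_pos: "0 \<le> s \<Longrightarrow> 0 < W s"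
  using majorant by (auto simp: radial_decr_L1_majorant_def)

lemma \<psi>_continuous: "continuous_on UNIV \<psi>"
  using deriv has_vector_derivative_continuous continuous_at_imp_continuous_on by blast

text \<open>The pointwise bound at \<open>|x| / 2\<close> instead of \<open>|x|\<close> absorbs the possible jumps of \<open>W\<close>.\<close>

lemma \<psi>_bound: "cmod (\<psi> x) \<le> W (\<bar>x\<bar> / 2)"
proof (rule ccontr)
  assume "\<not> ?thesis"
  then have x: "W (\<bar>x\<bar> / 2) < cmod (\<psi> x)" by simp
  let ?U = "{y. W (\<bar>x\<bar> / 2) < cmod (\<psi> y)} \<inter> (if x = 0 then UNIV else {y. \<bar>x\<bar> / 2 < \<bar>y\<bar>})"
  have op: "open ?U"
    by (auto intro!: open_Int open_Collect_less continuous_intros \<psi>_continuous)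
  have "x \<in> ?U" using x by auto
  then have "\<not> negligible ?U" using open_not_negligible[OF op] by blast
  moreover have "negligible ?U"
  proof -
    have "AE y in lebesgue. cmod (\<psi> y) \<le> W \<bar>y\<bar>" using majorant by (auto simp: radial_decr_L1_majorant_def)
    then obtain N where N: "{y. \<not> cmod (\<psi> y) \<le> W \<bar>y\<bar>} \<subseteq> N" "N \<in> null_sets lebesgue"
      by (auto elim!: AE_E simp: null_sets_def)
    have "?U \<subseteq> N"
    proof
      fix y assume y: "y \<in> ?U"
      then have "\<bar>x\<bar> / 2 \<le> \<bar>y\<bar>" by (auto split: if_splits)
      then have "W \<bar>y\<bar> \<le> W (\<bar>x\<bar> / 2)" by (intro W_decr) auto
      then have "\<not> cmod (\<psi> y) \<le> W \<bar>y\<bar>" using y by auto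
      then show "y \<in> N" using N by auto
    qed
    moreover have "negligible N" using N(2) by (simp add: negligible_iff_null_sets)
    ultimately show ?thesis by (rule negligible_subset[rotated])
  qed
  ultimately show False by simp
qed

lemma W_abs_integrable: "(\<lambda>\<xi>. W \<bar>\<xi> - k\<bar>) integrable_on {a..b}"
proof (rule measurable_bounded_by_integrable_imp_integrable)
  have "(\<lambda>s. indicator {0..} s *\<^sub>R W s) \<in> borel_measurable lborel"
    using majorant unfolding radial_decr_L1_majorant_def set_integrable_def by (auto dest: borel_measurable_integrable)
  then have [measurable]: "(\<lambda>s. indicator {0..} s *\<^sub>R W s) \<in> borel_measurable borel" by simp
  have "(\<lambda>\<xi>. (\<lambda>s. indicator {0..} s *\<^sub>R W s) \<bar>\<xi> - k\<bar>) \<in> borel_measurable borel" by measurable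
  then have "(\<lambda>\<xi>. W \<bar>\<xi> - k\<bar>) \<in> borel_measurable borel" by simp
  then have "(\<lambda>\<xi>. W \<bar>\<xi> - k\<bar>) \<in> borel_measurable lebesgue" by (intro measurable_completion) simp
  then show "(\<lambda>\<xi>. W \<bar>\<xi> - k\<bar>) \<in> borel_measurable (lebesgue_on {a..b})" by (rule measurable_restrict_space1)
  show "(\<lambda>\<xi>. W 0) integrable_on {a..b}" by (rule integrable_const_ivl)
  show "norm (W \<bar>\<xi> - k\<bar>) \<le> W 0" for \<xi> using W_decr[of 0 "\<bar>\<xi> - k\<bar>"] W_pos[of "\<bar>\<xi> - k\<bar>"] by simp
qed auto

text \<open>The derivative exists everywhere, so the fundamental theorem holds for the gauge
  integral; on the null set where the majorant fails the integrand is replaced by 0, which leaves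
  the integral unchanged and makes the bound pointwise.\<close>

lemma \<psi>_diff_le_integral:
  assumes "a \<le> b"
  shows "cmod (\<psi> (b - k) - \<psi> (a - k)) \<le> integral {a..b} (\<lambda>\<xi>. W \<bar>\<xi> - k\<bar>)"
proof -
  have "AE y in lebesgue. cmod (\<psi>' y) \<le> W \<bar>y\<bar>" using majorant' by (auto simp: radial_decr_L1_majorant_def)
  then obtain N where N: "{y. \<not> cmod (\<psi>' y) \<le> W \<bar>y\<bar>} \<subseteq> N" "N \<in> null_sets lebesgue"
    by (auto elim!: AE_E simp: null_sets_def)
  define \<phi> where "\<phi> y = (if y \<in> N then 0 else \<psi>' y)" for y
  have "(\<psi>' has_integral (\<psi> (b - k) - \<psi> (a - k))) {a - k..b - k}"
    by (rule fundamental_theorem_of_calculus) (use assms has_vector_derivative_at_within[OF deriv] in auto)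
  then have "(\<phi> has_integral (\<psi> (b - k) - \<psi> (a - k))) {a - k..b - k}"
  proof (rule has_integral_spike[rotated 2, where S = N])
    show "negligible N" using N(2) by (simp add: negligible_iff_null_sets)
  qed (auto simp: \<phi>_def)
  then have "((\<lambda>\<xi>. \<phi> (\<xi> - k)) has_integral (\<psi> (b - k) - \<psi> (a - k))) {a..b}"
    using has_integral_shift_Icc_real[of \<phi> "- k" "\<psi> (b - k) - \<psi> (a - k)" a b] by (simp add: o_def)
  then have "integral {a..b} (\<lambda>\<xi>. \<phi> (\<xi> - k)) = \<psi> (b - k) - \<psi> (a - k)" "(\<lambda>\<xi>. \<phi> (\<xi> - k)) integrable_on {a..b}"
    by (auto simp: has_integral_iff)
  moreover have "norm (integral {a..b} (\<lambda>\<xi>. \<phi> (\<xi> - k))) \<le> integral {a..b} (\<lambda>\<xi>. W \<bar>\<xi> - k\<bar>)"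
  proof (rule integral_norm_bound_integral)
    show "norm (\<phi> (\<xi> - k)) \<le> W \<bar>\<xi> - k\<bar>" for \<xi>
      using N(1) W_pos[of "\<bar>\<xi> - k\<bar>"] by (auto simp: \<phi>_def)
  qed (use calculation W_abs_integrable in auto)
  ultimately show ?thesis by simp
qed

definition W_mass :: real where "W_mass = enn2real (\<integral>\<^sup>+s\<in>{0..}. ennreal (W s) \<partial>lborel)"
definition W_moment :: real where "W_moment = enn2real (\<integral>\<^sup>+s\<in>{0..}. ennreal (s * W s) \<partial>lborel)"
text \<open>The factor 2 counts the integers on the two sides of the centre; the bracket is the
  bound of \<open>sum_W_half_integers\<close> for one side.\<close>

definition translates_bound :: real where "translates_bound = 2 * (W 0 + 2 * W_mass)"

lemma set_integrable_nn_integral_finite: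
  fixes f :: "real \<Rightarrow> real"
  assumes "set_integrable lborel A f" "\<And>x. x \<in> A \<Longrightarrow> f x \<ge> 0"
  shows "(\<integral>\<^sup>+x\<in>A. ennreal (f x) \<partial>lborel) < \<infinity>"
proof -
  have "(\<integral>\<^sup>+x\<in>A. ennreal (f x) \<partial>lborel) = (\<integral>\<^sup>+x. ennreal (norm (indicator A x *\<^sub>R f x)) \<partial>lborel)"
    using assms(2) by (intro nn_integral_cong) (auto split: split_indicator)
  then show ?thesis using assms(1) unfolding set_integrable_def integrable_iff_bounded by simp
qed

lemma W_mass: "(\<integral>\<^sup>+s\<in>{0..}. ennreal (W s) \<partial>lborel) = ennreal W_mass" "W_mass \<ge> 0"
  using set_integrable_nn_integral_finite[of "{0..}" W] majorant W_pos
  by (auto simp: W_mass_def radial_decr_L1_majorant_def less_imp_le)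

lemma W_moment: "(\<integral>\<^sup>+s\<in>{0..}. ennreal (s * W s) \<partial>lborel) = ennreal W_moment" "W_moment \<ge> 0"
  using set_integrable_nn_integral_finite[of "{0..}" "\<lambda>s. s * W s"] moment W_pos
  by (auto simp: W_moment_def less_imp_le)

text \<open>By monotonicity \<open>W (real m / 2)\<close> lies below \<open>W\<close> on the cell of
  length 1/2 to the left of \<open>real m / 2\<close>. The cells are disjoint, so the sum is at most
  \<open>W_mass\<close> divided by 1/2. Only \<open>m = 0\<close> has no such cell in the
  half-line.\<close>

lemma sum_W_half_integers:
  assumes "finite M"
  shows "(\<Sum>m\<in>M. W (real m / 2)) \<le> W 0 + 2 * W_mass"
proof -
  let ?A = "\<lambda>m. {(real m - 1) / 2..<real m / 2}"
  have "(\<Sum>m\<in>M - {0}. ennreal (W (real m / 2)) * emeasure lborel (?A m)) \<le> (\<integral>\<^sup>+s. ennreal (W s) * indicator {0..} s \<partial>lborel)"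
  proof (rule sum_mult_emeasure_le_nn_integral)
    show "disjoint_family_on ?A (M - {0})"
      unfolding disjoint_family_on_def
    proof (intro ballI impI)
      fix m n :: nat assume "m \<noteq> n"
      then have "real m + 1 \<le> real n \<or> real n + 1 \<le> real m" by linarith
      then show "?A m \<inter> ?A n = {}" by auto
    qed
    fix m s assume "m \<in> M - {0}" "s \<in> ?A m"
    then have "0 \<le> s" "s \<le> real m / 2" by auto
    then show "ennreal (W (real m / 2)) \<le> ennreal (W s) * indicator {0..} s"
      using W_decr by (auto intro: ennreal_leI)
  qed (use assms in auto)
  also have "\<dots> = ennreal W_mass" by (rule W_mass)
  also have "(\<Sum>m\<in>M - {0}. ennreal (W (real m / 2)) * emeasure lborel (?A m)) = ennreal (\<Sum>m\<in>M - {0}. W (real m / 2) / 2)"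
  proof -
    have "ennreal (W (real m / 2)) * emeasure lborel (?A m) = ennreal (W (real m / 2) / 2)" for m
    proof -
      have "emeasure lborel (?A m) = ennreal (1 / 2)" by (simp add: field_simps)
      then have "ennreal (W (real m / 2)) * emeasure lborel (?A m) = ennreal (W (real m / 2)) * ennreal (1 / 2)" by simp
      also have "\<dots> = ennreal (W (real m / 2) * (1 / 2))" using W_pos[of "real m / 2"] by (intro ennreal_mult[symmetric]) auto
      finally show ?thesis by simp
    qed
    then show ?thesis using W_pos by (simp add: sum_ennreal less_imp_le)
  qed
  finally have "(\<Sum>m\<in>M - {0}. W (real m / 2) / 2) \<le> W_mass" using W_mass(2) by simp
  then have "(\<Sum>m\<in>M - {0}. W (real m / 2)) \<le> 2 * W_mass" by (simp add: sum_divide_distrib[symmetric])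
  moreover have "(\<Sum>m\<in>M. W (real m / 2)) \<le> W 0 + (\<Sum>m\<in>M - {0}. W (real m / 2))"
    using assms W_pos[of 0] by (cases "0 \<in> M") (auto simp: sum.remove)
  ultimately show ?thesis by simp
qed

text \<open>The integer parts of the distances to \<open>u\<close> are distinct among the integers
  on one side of \<open>u\<close>, so rounding the distances down reduces each side to a sum over
  distinct half-integers.\<close>

lemma sum_W_translates:
  fixes F :: "int set"
  assumes F: "finite F"
  shows "(\<Sum>k\<in>F. W (\<bar>u - of_int k\<bar> / 2)) \<le> translates_bound"
proof -
  have *: "(\<Sum>k\<in>G. W (\<bar>u - of_int k\<bar> / 2)) \<le> W 0 + 2 * W_mass"
    if G: "finite G" and inj: "inj_on (\<lambda>k. nat \<lfloor>\<bar>u - of_int k\<bar>\<rfloor>) G" for G :: "int set"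
  proof -
    have "(\<Sum>k\<in>G. W (\<bar>u - of_int k\<bar> / 2)) \<le> (\<Sum>k\<in>G. W (real (nat \<lfloor>\<bar>u - of_int k\<bar>\<rfloor>) / 2))"
    proof (intro sum_mono W_decr)
      fix k :: int
      have "real (nat \<lfloor>\<bar>u - of_int k\<bar>\<rfloor>) \<le> \<bar>u - of_int k\<bar>" by (simp add: of_nat_floor)
      then show "real (nat \<lfloor>\<bar>u - of_int k\<bar>\<rfloor>) / 2 \<le> \<bar>u - of_int k\<bar> / 2" by simp
    qed simp
    also have "\<dots> = (\<Sum>m\<in>(\<lambda>k. nat \<lfloor>\<bar>u - of_int k\<bar>\<rfloor>) ` G. W (real m / 2))"
      using inj by (simp add: sum.reindex)
    also have "\<dots> \<le> W 0 + 2 * W_mass" using G by (intro sum_W_half_integers) auto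
    finally show ?thesis .
  qed
  have "(\<Sum>k\<in>{k\<in>F. of_int k \<le> u}. W (\<bar>u - of_int k\<bar> / 2)) \<le> W 0 + 2 * W_mass"
  proof (rule *)
    show "inj_on (\<lambda>k. nat \<lfloor>\<bar>u - of_int k\<bar>\<rfloor>) {k\<in>F. of_int k \<le> u}"
    proof (rule inj_onI, clarsimp)
      fix k l :: int assume kl: "of_int k \<le> u" "of_int l \<le> u" "nat (\<lfloor>u\<rfloor> - k) = nat (\<lfloor>u\<rfloor> - l)"
      then have "k \<le> \<lfloor>u\<rfloor>" "l \<le> \<lfloor>u\<rfloor>" by (auto simp: le_floor_iff)
      then show "k = l" using kl(3) by simp
    qed
  qed (use F in auto)
  moreover have "(\<Sum>k\<in>{k\<in>F. \<not> of_int k \<le> u}. W (\<bar>u - of_int k\<bar> / 2)) \<le> W 0 + 2 * W_mass"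
  proof (rule *)
    show "inj_on (\<lambda>k. nat \<lfloor>\<bar>u - of_int k\<bar>\<rfloor>) {k\<in>F. \<not> of_int k \<le> u}"
    proof (rule inj_onI)
      fix k l :: int assume kl: "k \<in> {k\<in>F. \<not> of_int k \<le> u}" "l \<in> {k\<in>F. \<not> of_int k \<le> u}"
        "nat \<lfloor>\<bar>u - of_int k\<bar>\<rfloor> = nat \<lfloor>\<bar>u - of_int l\<bar>\<rfloor>"
      have e: "\<lfloor>\<bar>u - of_int k\<bar>\<rfloor> = k + \<lfloor>- u\<rfloor>" if "\<not> of_int k \<le> u" for k :: int
      proof -
        have "\<bar>u - of_int k\<bar> = of_int k + (- u)" using that by simp
        moreover have "\<lfloor>of_int k + (- u)\<rfloor> = k + \<lfloor>- u\<rfloor>" by (subst floor_add2) auto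
        ultimately show ?thesis by simp
      qed
      have "\<lfloor>\<bar>u - of_int k\<bar>\<rfloor> = \<lfloor>\<bar>u - of_int l\<bar>\<rfloor>" using kl(3) by (subst (asm) eq_nat_nat_iff) auto
      then show "k = l" using e[of k] e[of l] kl by simp
    qed
  qed (use F in auto)
  moreover have "(\<Sum>k\<in>F. W (\<bar>u - of_int k\<bar> / 2)) = (\<Sum>k\<in>{k\<in>F. of_int k \<le> u}. W (\<bar>u - of_int k\<bar> / 2)) + (\<Sum>k\<in>{k\<in>F. \<not> of_int k \<le> u}. W (\<bar>u - of_int k\<bar> / 2))"
    using F by (subst sum.union_disjoint[symmetric]) (auto intro: sum.cong)
  ultimately show ?thesis by (simp add: translates_bound_def)
qed

lemma translates_bound_nonneg: "translates_bound \<ge> 0"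
  using W_pos[of 0] W_mass(2) by (simp add: translates_bound_def)

text \<open>The derivative bound is integrated over the segment; summing the translates under the
  integral leaves the uniform bound for translates of \<open>W\<close>, so the number of translates
  does not matter.\<close>

lemma sum_\<psi>_diff_translates:
  fixes F :: "int set"
  assumes F: "finite F"
  shows "(\<Sum>k\<in>F. cmod (\<psi> (v - of_int k) - \<psi> (w - of_int k))) \<le> translates_bound * \<bar>v - w\<bar>"
proof -
  have *: "(\<Sum>k\<in>F. cmod (\<psi> (b - of_int k) - \<psi> (a - of_int k))) \<le> translates_bound * (b - a)" if "a \<le> b" for a b
  proof -
    have "(\<Sum>k\<in>F. cmod (\<psi> (b - of_int k) - \<psi> (a - of_int k))) \<le> (\<Sum>k\<in>F. integral {a..b} (\<lambda>\<xi>. W \<bar>\<xi> - of_int k\<bar>))"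
      by (intro sum_mono \<psi>_diff_le_integral that)
    also have "\<dots> = integral {a..b} (\<lambda>\<xi>. \<Sum>k\<in>F. W \<bar>\<xi> - of_int k\<bar>)"
      using F by (intro integral_sum[symmetric] W_abs_integrable)
    also have "\<dots> \<le> integral {a..b} (\<lambda>\<xi>. translates_bound)"
    proof (rule integral_le)
      show "(\<lambda>\<xi>. \<Sum>k\<in>F. W \<bar>\<xi> - of_int k\<bar>) integrable_on {a..b}" using F by (intro integrable_sum W_abs_integrable)
      fix \<xi>
      have "(\<Sum>k\<in>F. W \<bar>\<xi> - of_int k\<bar>) \<le> (\<Sum>k\<in>F. W (\<bar>\<xi> - of_int k\<bar> / 2))" by (intro sum_mono W_decr) auto
      also have "\<dots> \<le> translates_bound" by (rule sum_W_translates[OF F])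
      finally show "(\<Sum>k\<in>F. W \<bar>\<xi> - of_int k\<bar>) \<le> translates_bound" .
    qed (rule integrable_const_ivl)
    also have "\<dots> = translates_bound * (b - a)" using that by simp
    finally show ?thesis .
  qed
  show ?thesis using *[of v w] *[of w v] by (cases "w \<le> v") (auto simp: norm_minus_commute)
qed

lemma \<psi>_diff_far:
  assumes m: "m \<ge> 0" and far: "\<And>\<xi>. min v w \<le> \<xi> \<Longrightarrow> \<xi> \<le> max v w \<Longrightarrow> m \<le> \<bar>\<xi> - k\<bar>"
  shows "cmod (\<psi> (v - k) - \<psi> (w - k)) \<le> \<bar>v - w\<bar> * W m"
proof -
  have *: "cmod (\<psi> (b - k) - \<psi> (a - k)) \<le> (b - a) * W m" if "a \<le> b" "\<And>\<xi>. a \<le> \<xi> \<Longrightarrow> \<xi> \<le> b \<Longrightarrow> m \<le> \<bar>\<xi> - k\<bar>" for a b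
  proof -
    have "cmod (\<psi> (b - k) - \<psi> (a - k)) \<le> integral {a..b} (\<lambda>\<xi>. W \<bar>\<xi> - k\<bar>)" by (rule \<psi>_diff_le_integral[OF that(1)])
    also have "\<dots> \<le> integral {a..b} (\<lambda>\<xi>. W m)"
      using that(2) m by (intro integral_le W_abs_integrable integrable_const_ivl W_decr) auto
    also have "\<dots> = (b - a) * W m" using that(1) by simp
    finally show ?thesis .
  qed
  show ?thesis using *[of v w] *[of w v] far by (cases "w \<le> v") (auto simp: norm_minus_commute)
qed

text \<open>An integer cannot be close both to \<open>u\<close> and to the segment from
  \<open>v\<close> to \<open>c\<close>. If it is at distance at least \<open>|u - c| / 4\<close>
  from \<open>u\<close>, the first factor is small; otherwise its distance to the segment is at
  least \<open>|u - c| * (1 - 1/4 - 1/2)\<close>, and the difference is small. The other factor is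
  summed over all translates. The halved argument in \<open>\<psi>_bound\<close> turns 4 into
  8.\<close>

lemma sum_translates_product:
  fixes F :: "int set"
  assumes F: "finite F" and far: "2 * \<bar>v - c\<bar> \<le> \<bar>u - c\<bar>"
  shows "(\<Sum>k\<in>F. cmod (\<psi> (u - of_int k)) * cmod (\<psi> (v - of_int k) - \<psi> (c - of_int k)))
    \<le> 2 * translates_bound * \<bar>v - c\<bar> * W (\<bar>u - c\<bar> / 8)"
proof -
  let ?w = "W (\<bar>u - c\<bar> / 8)"
  have "(\<Sum>k\<in>F. cmod (\<psi> (u - of_int k)) * cmod (\<psi> (v - of_int k) - \<psi> (c - of_int k)))
    \<le> (\<Sum>k\<in>F. ?w * cmod (\<psi> (v - of_int k) - \<psi> (c - of_int k)) + \<bar>v - c\<bar> * ?w * W (\<bar>u - of_int k\<bar> / 2))"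
  proof (rule sum_mono)
    fix k
    have w: "?w \<ge> 0" "W (\<bar>u - of_int k\<bar> / 2) \<ge> 0" using W_pos[of "\<bar>u - c\<bar> / 8"] W_pos[of "\<bar>u - of_int k\<bar> / 2"] by auto
    show "cmod (\<psi> (u - of_int k)) * cmod (\<psi> (v - of_int k) - \<psi> (c - of_int k))
      \<le> ?w * cmod (\<psi> (v - of_int k) - \<psi> (c - of_int k)) + \<bar>v - c\<bar> * ?w * W (\<bar>u - of_int k\<bar> / 2)"
    proof (cases "\<bar>u - c\<bar> / 4 \<le> \<bar>u - of_int k\<bar>")
      case True
      have "cmod (\<psi> (u - of_int k)) \<le> W (\<bar>u - of_int k\<bar> / 2)" by (rule \<psi>_bound)
      also have "\<dots> \<le> ?w" using True by (intro W_decr) auto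
      finally have "cmod (\<psi> (u - of_int k)) * cmod (\<psi> (v - of_int k) - \<psi> (c - of_int k)) \<le> ?w * cmod (\<psi> (v - of_int k) - \<psi> (c - of_int k))"
        by (rule mult_right_mono) simp
      moreover have "0 \<le> \<bar>v - c\<bar> * ?w * W (\<bar>u - of_int k\<bar> / 2)" using w by simp
      ultimately show ?thesis by linarith
    next
      case False
      have "cmod (\<psi> (v - of_int k) - \<psi> (c - of_int k)) \<le> \<bar>v - c\<bar> * W (\<bar>u - c\<bar> / 4)"
      proof (rule \<psi>_diff_far)
        fix \<xi> assume "min v c \<le> \<xi>" "\<xi> \<le> max v c"
        then have "\<bar>\<xi> - c\<bar> \<le> \<bar>v - c\<bar>" by (auto simp: min_def max_def abs_real_def split: if_splits)
        moreover have "\<bar>u - c\<bar> \<le> \<bar>u - of_int k\<bar> + \<bar>\<xi> - of_int k\<bar> + \<bar>\<xi> - c\<bar>" by linarith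
        ultimately show "\<bar>u - c\<bar> / 4 \<le> \<bar>\<xi> - of_int k\<bar>" using False far by linarith
      qed simp
      also have "\<dots> \<le> \<bar>v - c\<bar> * ?w" by (intro mult_left_mono W_decr) auto
      finally have "cmod (\<psi> (u - of_int k)) * cmod (\<psi> (v - of_int k) - \<psi> (c - of_int k)) \<le> W (\<bar>u - of_int k\<bar> / 2) * (\<bar>v - c\<bar> * ?w)"
        using w by (intro mult_mono \<psi>_bound) auto
      moreover have "0 \<le> ?w * cmod (\<psi> (v - of_int k) - \<psi> (c - of_int k))" using w by simp
      ultimately show ?thesis by (simp add: mult_ac)
    qed
  qed
  also have "\<dots> = ?w * (\<Sum>k\<in>F. cmod (\<psi> (v - of_int k) - \<psi> (c - of_int k))) + \<bar>v - c\<bar> * ?w * (\<Sum>k\<in>F. W (\<bar>u - of_int k\<bar> / 2))"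
    by (simp add: sum.distrib sum_distrib_left)
  also have "\<dots> \<le> ?w * (translates_bound * \<bar>v - c\<bar>) + \<bar>v - c\<bar> * ?w * translates_bound"
    using W_pos[of "\<bar>u - c\<bar> / 8"] F
    by (intro add_mono mult_left_mono sum_\<psi>_diff_translates sum_W_translates) auto
  finally show ?thesis by (simp add: mult_ac)
qed

text \<open>With \<open>s = 2^j t\<close>, monotonicity gives
  \<open>s / 2 * W s \<le> x * W x\<close> on \<open>[s / 2, s)\<close>. These dyadic cells are
  disjoint and have length \<open>s / 2\<close>, so the sum of \<open>s^2 / 4 * W s\<close> is at
  most the first moment of \<open>W\<close>.\<close>

lemma sum_dyadic_scales:
  fixes F :: "int set"
  assumes F: "finite F" and t: "t > 0"
  shows "(\<Sum>j\<in>F. (2 powr of_int j)\<^sup>2 * W (2 powr of_int j * t)) \<le> 4 * W_moment / t\<^sup>2"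
proof -
  define s where "s j = 2 powr of_int j * t" for j :: int
  have s: "s j > 0" for j using t by (simp add: s_def)
  let ?A = "\<lambda>j. {s j / 2..<s j}"
  have "(\<Sum>j\<in>F. ennreal (s j / 2 * W (s j)) * emeasure lborel (?A j)) \<le> (\<integral>\<^sup>+x. ennreal (x * W x) * indicator {0..} x \<partial>lborel)"
  proof (rule sum_mult_emeasure_le_nn_integral)
    have less: "s i \<le> s j / 2" if "i < j" for i j
    proof -
      have "2 powr of_int i \<le> 2 powr (of_int j - 1 :: real)" using that by (intro powr_mono) auto
      also have "\<dots> = 2 powr of_int j / 2" by (simp add: powr_diff)
      finally show ?thesis using t by (simp add: s_def)
    qed
    show "disjoint_family_on ?A F"
      unfolding disjoint_family_on_def
    proof (intro ballI impI)
      fix i j :: int assume "i \<noteq> j"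
      then consider "i < j" | "j < i" by linarith
      then show "?A i \<inter> ?A j = {}" using less[of i j] less[of j i] by cases auto
    qed
    fix j x assume "x \<in> ?A j"
    then have x: "s j / 2 \<le> x" "x < s j" by auto
    then have x0: "0 \<le> x" using s[of j] by linarith
    have "s j / 2 * W (s j) \<le> x * W x"
      using x x0 s[of j] W_pos[of "s j"] by (intro mult_mono W_decr) auto
    then show "ennreal (s j / 2 * W (s j)) \<le> ennreal (x * W x) * indicator {0..} x"
      using x0 by (auto intro: ennreal_leI)
  qed (use F in auto)
  also have "\<dots> = ennreal W_moment" by (rule W_moment)
  also have "(\<Sum>j\<in>F. ennreal (s j / 2 * W (s j)) * emeasure lborel (?A j)) = ennreal (\<Sum>j\<in>F. (s j)\<^sup>2 / 4 * W (s j))"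
  proof -
    have "ennreal (s j / 2 * W (s j)) * emeasure lborel (?A j) = ennreal ((s j)\<^sup>2 / 4 * W (s j))" for j
    proof -
      have "emeasure lborel (?A j) = ennreal (s j / 2)" using s[of j] by simp
      then have "ennreal (s j / 2 * W (s j)) * emeasure lborel (?A j) = ennreal (s j / 2 * W (s j) * (s j / 2))"
        using s[of j] by (subst ennreal_mult'') auto
      then show ?thesis by (simp add: power2_eq_square mult_ac)
    qed
    then show ?thesis using W_pos s by (simp add: sum_ennreal less_imp_le)
  qed
  finally have "(\<Sum>j\<in>F. (s j)\<^sup>2 / 4 * W (s j)) \<le> W_moment" using W_moment(2) by simp
  moreover have "(\<Sum>j\<in>F. (s j)\<^sup>2 / 4 * W (s j)) = t\<^sup>2 / 4 * (\<Sum>j\<in>F. (2 powr of_int j)\<^sup>2 * W (2 powr of_int j * t))"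
    by (simp add: s_def sum_distrib_left power_mult_distrib mult_ac)
  ultimately show ?thesis using t by (simp add: field_simps)
qed

text \<open>\<open>512 = 2 * 4 * 8^2\<close>: 2 from \<open>sum_translates_product\<close>, 4 from
  \<open>sum_dyadic_scales\<close>, and the square of the 8 dividing the distance.\<close>

definition kernel_const :: real where "kernel_const = 512 * translates_bound * W_moment"

lemma kernel_const_nonneg: "kernel_const \<ge> 0"
  using translates_bound_nonneg W_moment(2) by (simp add: kernel_const_def)

text \<open>At scale \<open>j\<close> the normalisation contributes \<open>2^j\<close> and the
  dilated displacement another \<open>2^j\<close>, together the weight \<open>4^j\<close> of
  \<open>sum_dyadic_scales\<close>. With absolute values inside, the bound serves every choice of
  signs and every finite index set.\<close>

lemma sum_wav_product:
  assumes G: "finite G" and far: "2 * \<bar>y - c\<bar> \<le> \<bar>x - c\<bar>"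
  shows "(\<Sum>(j, k)\<in>G. cmod (wav \<psi> j k x) * cmod (wav \<psi> j k y - wav \<psi> j k c)) \<le> kernel_const * \<bar>y - c\<bar> / (x - c)\<^sup>2"
proof (cases "x = c")
  \<comment> \<open>Then \<open>y = c\<close> as well, and both sides are 0.\<close>
  case True
  then show ?thesis using far by simp
next
  case False
  define r where "r = \<bar>x - c\<bar>"
  have r: "r > 0" using False by (simp add: r_def)
  let ?p = "\<lambda>j::int. 2 powr real_of_int j"
  define J where "J = fst ` G"
  define L where "L = snd ` G"
  have fin: "finite J" "finite L" using G by (auto simp: J_def L_def)
  \<comment> \<open>Enlarging \<open>G\<close> to a product of scales and translates separates the
    two sums; the terms are nonnegative.\<close>
  have "(\<Sum>(j, k)\<in>G. cmod (wav \<psi> j k x) * cmod (wav \<psi> j k y - wav \<psi> j k c))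
    \<le> (\<Sum>(j, k)\<in>J \<times> L. cmod (wav \<psi> j k x) * cmod (wav \<psi> j k y - wav \<psi> j k c))"
    using fin by (intro sum_mono2) (auto simp: J_def L_def rev_image_eqI)
  also have "\<dots> = (\<Sum>j\<in>J. \<Sum>k\<in>L. cmod (wav \<psi> j k x) * cmod (wav \<psi> j k y - wav \<psi> j k c))"
    by (simp add: sum.cartesian_product)
  also have "\<dots> \<le> (\<Sum>j\<in>J. 2 * translates_bound * \<bar>y - c\<bar> * ((?p j)\<^sup>2 * W (?p j * (r / 8))))"
  proof (rule sum_mono)
    fix j
    have "(\<Sum>k\<in>L. cmod (wav \<psi> j k x) * cmod (wav \<psi> j k y - wav \<psi> j k c))
      = ?p j * (\<Sum>k\<in>L. cmod (\<psi> (?p j * x - of_int k)) * cmod (\<psi> (?p j * y - of_int k) - \<psi> (?p j * c - of_int k)))"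
      unfolding sum_distrib_left
    proof (intro sum.cong refl)
      fix k
      have "?p j = 2 powr (of_int j / 2) * 2 powr (of_int j / 2)" by (simp flip: powr_add)
      then show "cmod (wav \<psi> j k x) * cmod (wav \<psi> j k y - wav \<psi> j k c)
        = ?p j * (cmod (\<psi> (?p j * x - of_int k)) * cmod (\<psi> (?p j * y - of_int k) - \<psi> (?p j * c - of_int k)))"
        unfolding wav_def right_diff_distrib[symmetric] norm_mult by (simp add: mult_ac)
    qed
    also have "\<dots> \<le> ?p j * (2 * translates_bound * \<bar>?p j * y - ?p j * c\<bar> * W (\<bar>?p j * x - ?p j * c\<bar> / 8))"
    proof (intro mult_left_mono sum_translates_product fin)
      have "?p j * (2 * \<bar>y - c\<bar>) \<le> ?p j * \<bar>x - c\<bar>" using far by (intro mult_left_mono) auto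
      then show "2 * \<bar>?p j * y - ?p j * c\<bar> \<le> \<bar>?p j * x - ?p j * c\<bar>"
        by (simp add: right_diff_distrib[symmetric] abs_mult)
    qed simp
    also have "\<dots> = 2 * translates_bound * \<bar>y - c\<bar> * ((?p j)\<^sup>2 * W (?p j * (r / 8)))"
    proof -
      have "\<bar>?p j * a - ?p j * c\<bar> = ?p j * \<bar>a - c\<bar>" for a
        by (simp add: right_diff_distrib[symmetric] abs_mult)
      then show ?thesis by (simp add: r_def power2_eq_square)
    qed
    finally show "(\<Sum>k\<in>L. cmod (wav \<psi> j k x) * cmod (wav \<psi> j k y - wav \<psi> j k c)) \<le> 2 * translates_bound * \<bar>y - c\<bar> * ((?p j)\<^sup>2 * W (?p j * (r / 8)))" .
  qed
  also have "\<dots> = 2 * translates_bound * \<bar>y - c\<bar> * (\<Sum>j\<in>J. (?p j)\<^sup>2 * W (?p j * (r / 8)))"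
    by (simp add: sum_distrib_left)
  also have "\<dots> \<le> 2 * translates_bound * \<bar>y - c\<bar> * (4 * W_moment / (r / 8)\<^sup>2)"
    using translates_bound_nonneg r by (intro mult_left_mono sum_dyadic_scales fin) auto
  also have "\<dots> = kernel_const * \<bar>y - c\<bar> / (x - c)\<^sup>2"
    by (simp add: kernel_const_def r_def power_divide)
  finally show ?thesis .
qed

end

section \<open>Density and extension\<close>

context function_space begin

text \<open>The norm before conversion to a real number: \<open>enn2real\<close> would send an
  infinite norm to 0.\<close>

definition X_norm :: "(real \<Rightarrow> complex) \<Rightarrow> ennreal" where
  "X_norm f = \<rho> (\<lambda>x. ennreal (cmod (f x)))"

lemma inX_iff: "inX \<rho> f \<longleftrightarrow> f \<in> borel_measurable lebesgue \<and> X_norm f < \<infinity>"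
  by (simp add: inX_def X_norm_def)

lemma ennreal_normX: "inX \<rho> f \<Longrightarrow> ennreal (normX \<rho> f) = X_norm f"
  by (simp add: inX_def normX_def X_norm_def)

lemma X_norm_mono:
  assumes "f \<in> borel_measurable lebesgue" "g \<in> borel_measurable lebesgue" "\<And>x. cmod (f x) \<le> cmod (g x)"
  shows "X_norm f \<le> X_norm g"
  unfolding X_norm_def using assms by (intro mono ennreal_leI) auto

lemma X_norm_triangle:
  assumes [measurable]: "f \<in> borel_measurable lebesgue" "g \<in> borel_measurable lebesgue"
  shows "X_norm (\<lambda>x. f x + g x) \<le> X_norm f + X_norm g"
proof -
  have "X_norm (\<lambda>x. f x + g x) \<le> \<rho> (\<lambda>x. ennreal (cmod (f x)) + ennreal (cmod (g x)))"
    unfolding X_norm_def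
  proof (rule mono)
    show "ennreal (cmod (f x + g x)) \<le> ennreal (cmod (f x)) + ennreal (cmod (g x))" for x
      by (simp add: ennreal_plus[symmetric] ennreal_leI norm_triangle_ineq del: ennreal_plus)
  qed measurable
  also have "\<dots> \<le> X_norm f + X_norm g" unfolding X_norm_def by (rule triangle) measurable
  finally show ?thesis .
qed

lemma X_norm_cmult:
  assumes [measurable]: "f \<in> borel_measurable lebesgue"
  shows "X_norm (\<lambda>x. a * f x) = ennreal (cmod a) * X_norm f"
  unfolding X_norm_def by (subst scale[symmetric]) (auto simp: norm_mult ennreal_mult)

lemma X_norm_minus_commute: "X_norm (\<lambda>x. f x - g x) = X_norm (\<lambda>x. g x - f x)"
  unfolding X_norm_def by (simp add: norm_minus_commute)

lemma X_norm_triangle_diff: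
  assumes "f \<in> borel_measurable lebesgue" "g \<in> borel_measurable lebesgue" "h \<in> borel_measurable lebesgue"
  shows "X_norm (\<lambda>x. f x - g x) \<le> X_norm (\<lambda>x. f x - h x) + X_norm (\<lambda>x. h x - g x)"
  using X_norm_triangle[of "\<lambda>x. f x - h x" "\<lambda>x. h x - g x"] assms by simp

lemma X_norm_cong_AE:
  assumes [measurable]: "f \<in> borel_measurable lebesgue" "g \<in> borel_measurable lebesgue" and "AE x in lebesgue. f x = g x"
  shows "X_norm f = X_norm g"
  unfolding X_norm_def using assms(3) by (intro cong_AE) auto

lemma X_norm_eq_0_iff:
  assumes [measurable]: "f \<in> borel_measurable lebesgue"
  shows "X_norm f = 0 \<longleftrightarrow> (AE x in lebesgue. f x = 0)"
  unfolding X_norm_def by (subst zero_iff) auto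

lemma inX_linear:
  assumes "inX \<rho> f" "inX \<rho> g"
  shows "inX \<rho> (\<lambda>x. a * f x + b * g x)"
proof -
  have [measurable]: "f \<in> borel_measurable lebesgue" "g \<in> borel_measurable lebesgue" using assms by (auto simp: inX_iff)
  have "X_norm (\<lambda>x. a * f x + b * g x) \<le> X_norm (\<lambda>x. a * f x) + X_norm (\<lambda>x. b * g x)"
    by (rule X_norm_triangle) measurable
  also have "\<dots> < \<infinity>" using assms by (simp add: X_norm_cmult inX_iff ennreal_mult_less_top)
  finally show ?thesis by (simp add: inX_iff)
qed

lemma inX_diff: "inX \<rho> f \<Longrightarrow> inX \<rho> g \<Longrightarrow> inX \<rho> (\<lambda>x. f x - g x)"
  using inX_linear[of f g 1 "-1"] by simp

lemma inX_bounded_bounded_support: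
  assumes "bounded_bounded_support f"
  shows "inX \<rho> f"
proof -
  obtain m where m: "m > 0" "\<And>x. cmod (f x) \<le> m" "\<And>x. m < \<bar>x\<bar> \<Longrightarrow> f x = 0" and [measurable]: "f \<in> borel_measurable lebesgue"
    using bounded_bounded_supportE[OF assms] by blast
  have "X_norm f \<le> \<rho> (\<lambda>x. ennreal m * indicator {-m..m} x)"
    unfolding X_norm_def
  proof (rule mono)
    fix x
    show "ennreal (cmod (f x)) \<le> ennreal m * indicator {-m..m} x"
    proof (cases "x \<in> {-m..m}")
      case False
      then have "m < \<bar>x\<bar>" by auto
      then show ?thesis using m(3) by simp
    qed (use m(2) in \<open>auto intro: ennreal_leI\<close>)
  qed measurable
  also have "\<dots> = ennreal m * \<rho> (indicator {-m..m})" using m(1) by (intro scale) auto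
  also have "\<dots> < \<infinity>" using finite_indicator[of "{-m..m}"] m(1) by (auto simp: ennreal_mult_less_top)
  finally show ?thesis by (simp add: inX_iff)
qed

text \<open>This is the local integrability axiom on \<open>[-m, m]\<close>. It places the dual test
  functions in the associate space, where the maximal bound can then be applied to them.\<close>

lemma assoc_norm_finite:
  assumes g: "\<And>x. g x \<le> ennreal m" "\<And>x. m < \<bar>x\<bar> \<Longrightarrow> g x = 0"
  shows "assoc_norm \<rho> g < \<infinity>"
proof -
  let ?E = "{-m..m}"
  have E: "?E \<in> sets lebesgue" "emeasure lebesgue ?E < \<infinity>" by (auto simp: emeasure_lborel_Icc_eq)
  obtain C where C: "\<And>f. f \<in> borel_measurable lebesgue \<Longrightarrow> (\<integral>\<^sup>+x\<in>?E. f x \<partial>lebesgue) \<le> ennreal C * \<rho> f"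
    using local_L1[OF E] by blast
  have "assoc_norm \<rho> g \<le> ennreal m * ennreal C"
    unfolding assoc_norm_def
  proof (rule SUP_least, clarify)
    fix f assume [measurable]: "f \<in> borel_measurable lebesgue" and f: "\<rho> f \<le> 1"
    have "(\<integral>\<^sup>+x. f x * g x \<partial>lebesgue) \<le> (\<integral>\<^sup>+x. ennreal m * (f x * indicator ?E x) \<partial>lebesgue)"
    proof (rule nn_integral_mono)
      fix x
      show "f x * g x \<le> ennreal m * (f x * indicator ?E x)"
      proof (cases "x \<in> ?E")
        case True
        then show ?thesis using mult_left_mono[OF g(1)[of x], of "f x"] by (simp add: mult.commute)
      next
        case False
        then have "m < \<bar>x\<bar>" by auto
        then show ?thesis using g(2) by simp
      qed
    qed
    also have "\<dots> = ennreal m * (\<integral>\<^sup>+x\<in>?E. f x \<partial>lebesgue)" by (rule nn_integral_cmult) measurable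
    also have "\<dots> \<le> ennreal m * (ennreal C * \<rho> f)" by (intro mult_left_mono C) auto
    also have "\<dots> \<le> ennreal m * (ennreal C * 1)" by (intro mult_left_mono f) auto
    finally show "(\<integral>\<^sup>+x. f x * g x \<partial>lebesgue) \<le> ennreal m * ennreal C" by simp
  qed
  then show ?thesis by (rule order_le_less_trans) (simp add: ennreal_mult_less_top)
qed

text \<open>Separability makes the norm absolutely continuous: otherwise \<open>f\<close> would have infinitely many disjoint
  pieces of norm bounded below, whose \<open>2\<^sup>\<aleph>\<close> many unions are uniformly separated.\<close>

lemma bounded_bounded_support_dense:
  assumes sep: "X_separable \<rho>" and f: "inX \<rho> f" and \<epsilon>: "\<epsilon> > 0"
  shows "\<exists>h. bounded_bounded_support h \<and> X_norm (\<lambda>x. f x - h x) < ennreal \<epsilon>"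
proof (rule ccontr)
  assume contra: "\<not> ?thesis"
  have fm[measurable]: "f \<in> borel_measurable lebesgue" using f by (simp add: inX_iff)
  define A where "A n = {x. \<bar>x\<bar> \<le> real n \<and> cmod (f x) \<le> real n}" for n :: nat
  have Am[measurable]: "A n \<in> sets lebesgue" for n
  proof -
    have "{x \<in> space lebesgue. \<bar>x\<bar> \<le> real n \<and> cmod (f x) \<le> real n} \<in> sets lebesgue" by measurable
    then show ?thesis by (simp add: A_def)
  qed
  have Amono: "A m \<subseteq> A n" if "m \<le> n" for m n
    using that unfolding A_def by (auto intro: order_trans)
  have Acover: "\<exists>n. x \<in> A n" for x
  proof -
    obtain n where "max \<bar>x\<bar> (cmod (f x)) \<le> real n" using real_arch_simple by blast
    then show ?thesis by (auto simp: A_def)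
  qed
  define u where "u x = ennreal (cmod (f x))" for x
  have [measurable]: "u \<in> borel_measurable lebesgue" unfolding u_def by measurable
  \<comment> \<open>The truncation of \<open>f\<close> to \<open>A n\<close> lies in the core class,
    so under the contrary assumption it stays at distance at least \<open>\<epsilon>\<close> from
    \<open>f\<close>.\<close>
  have big: "ennreal \<epsilon> \<le> \<rho> (\<lambda>x. u x * indicator (- A n) x)" for n
  proof -
    have "bounded_bounded_support (\<lambda>x. indicator (A n) x * f x)"
    proof (rule bounded_bounded_supportI[of _ "real n" "real n"])
      show "(\<lambda>x. indicator (A n) x * f x) \<in> borel_measurable lebesgue" by measurable
    qed (auto simp: A_def split: split_indicator)
    then have "ennreal \<epsilon> \<le> X_norm (\<lambda>x. f x - indicator (A n) x * f x)" using contra by (meson not_le)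
    also have "X_norm (\<lambda>x. f x - indicator (A n) x * f x) = \<rho> (\<lambda>x. u x * indicator (- A n) x)"
      unfolding X_norm_def by (intro arg_cong[of _ _ \<rho>]) (auto simp: u_def fun_eq_iff split: split_indicator)
    finally show ?thesis .
  qed
  \<comment> \<open>The Fatou property catches more than \<open>\<epsilon> / 2\<close> of this tail
    between two truncation levels; iterating the choice of \<open>m\<close> yields the disjoint
    pieces.\<close>
  have "\<exists>m>n. ennreal (\<epsilon> / 2) < \<rho> (\<lambda>x. u x * indicator (A m - A n) x)" for n
  proof -
    have "(\<lambda>m. \<rho> (\<lambda>x. u x * indicator (A m - A n) x)) \<longlonglongrightarrow> \<rho> (\<lambda>x. u x * indicator (- A n) x)"
    proof (rule monotone_limit)
      have "- A n \<in> sets lebesgue" using sets.compl_sets[OF Am[of n]] by (simp add: Compl_eq_Diff_UNIV)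
      then show "(\<lambda>x. u x * indicator (- A n) x) \<in> borel_measurable lebesgue" by measurable
      show "AE x in lebesgue. incseq (\<lambda>m. u x * indicator (A m - A n) x) \<and> (\<lambda>m. u x * indicator (A m - A n) x) \<longlonglongrightarrow> u x * indicator (- A n) x"
      proof (intro AE_I2 conjI)
        fix x
        show "incseq (\<lambda>m. u x * indicator (A m - A n) x)"
          unfolding incseq_def using Amono by (auto split: split_indicator)
        obtain M where M: "x \<in> A M" using Acover by blast
        have "\<forall>\<^sub>F m in sequentially. u x * indicator (A m - A n) x = u x * indicator (- A n) x"
          using eventually_ge_at_top[of M]
        proof eventually_elim
          case (elim m)
          then have "x \<in> A m" using M Amono by blast
          then show ?case by (auto split: split_indicator)
        qed
        then show "(\<lambda>m. u x * indicator (A m - A n) x) \<longlonglongrightarrow> u x * indicator (- A n) x"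
          by (rule tendsto_eventually)
      qed
    qed measurable
    moreover have "ennreal (\<epsilon> / 2) < \<rho> (\<lambda>x. u x * indicator (- A n) x)"
      using big[of n] \<epsilon> by (intro order_less_le_trans[OF _ big]) (auto intro: ennreal_lessI)
    ultimately have "\<forall>\<^sub>F m in sequentially. ennreal (\<epsilon> / 2) < \<rho> (\<lambda>x. u x * indicator (A m - A n) x)"
      by (rule order_tendstoD)
    then have "\<forall>\<^sub>F m in sequentially. n < m \<and> ennreal (\<epsilon> / 2) < \<rho> (\<lambda>x. u x * indicator (A m - A n) x)"
      using eventually_gt_at_top[of n] by eventually_elim simp
    then show ?thesis by (auto dest: eventually_happens)
  qed
  then obtain \<mu> where \<mu>: "\<And>n. n < \<mu> n" "\<And>n. ennreal (\<epsilon> / 2) < \<rho> (\<lambda>x. u x * indicator (A (\<mu> n) - A n) x)" by metis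
  define N where "N i = (\<mu> ^^ i) 0" for i
  have NS: "N (Suc i) = \<mu> (N i)" for i by (simp add: N_def)
  have Nmono: "N i \<le> N j" if "i \<le> j" for i j
  proof -
    have "incseq N" by (rule incseq_SucI) (simp add: NS less_imp_le[OF \<mu>(1)])
    then show ?thesis using that by (simp add: incseq_def)
  qed
  define F where "F i = A (N (Suc i)) - A (N i)" for i
  have Fm[measurable]: "F i \<in> sets lebesgue" for i unfolding F_def by measurable
  have Fdisj: "i = j" if "x \<in> F i" "x \<in> F j" for x i j
  proof (rule ccontr)
    assume "i \<noteq> j"
    then consider "Suc i \<le> j" | "Suc j \<le> i" by linarith
    then show False using that Amono[OF Nmono[of "Suc i" j]] Amono[OF Nmono[of "Suc j" i]] by cases (auto simp: F_def)
  qed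
  \<comment> \<open>For different \<open>S\<close> these restrictions of \<open>f\<close> differ by
    at least a whole piece \<open>F i\<close>, of norm above \<open>\<epsilon> / 2\<close>, while
    each has an element of \<open>D\<close> within \<open>\<epsilon> / 4\<close>: \<open>d\<close>
    would inject all sets of naturals into a countable set.\<close>
  define fS where "fS S x = indicator (\<Union>i\<in>S. F i) x * f x" for S :: "nat set" and x
  have UFm[measurable]: "(\<Union>i\<in>S. F i) \<in> sets lebesgue" for S by (intro sets.countable_UN'') auto
  have fSm[measurable]: "fS S \<in> borel_measurable lebesgue" for S unfolding fS_def by measurable
  have fSX: "inX \<rho> (fS S)" for S
  proof -
    have "X_norm (fS S) \<le> X_norm f" by (rule X_norm_mono) (auto simp: fS_def split: split_indicator)
    then show ?thesis using f by (simp add: inX_iff)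
  qed
  obtain D where D: "countable D" "\<And>d. d \<in> D \<Longrightarrow> inX \<rho> d"
    "\<And>h e. inX \<rho> h \<Longrightarrow> e > 0 \<Longrightarrow> \<exists>d\<in>D. normX \<rho> (\<lambda>x. h x - d x) < e"
    using sep unfolding X_separable_def by blast
  have "\<exists>d\<in>D. normX \<rho> (\<lambda>x. fS S x - d x) < \<epsilon> / 4" for S
    using D(3)[OF fSX, of "\<epsilon> / 4"] \<epsilon> by simp
  then obtain d where d: "\<And>S. d S \<in> D" "\<And>S. normX \<rho> (\<lambda>x. fS S x - d S x) < \<epsilon> / 4" by metis
  have close: "X_norm (\<lambda>x. fS S x - d S x) \<le> ennreal (\<epsilon> / 4)" for S
    using ennreal_normX[OF inX_diff[OF fSX D(2)[OF d(1)], of S S]] d(2)[of S] by (metis ennreal_leI less_imp_le)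
  have dm[measurable]: "d S \<in> borel_measurable lebesgue" for S using D(2)[OF d(1)] by (simp add: inX_iff)
  have "inj d"
  proof (rule injI, rule ccontr)
    fix S S' assume eq: "d S = d S'" and "S \<noteq> S'"
    then obtain i where i: "i \<in> S \<and> i \<notin> S' \<or> i \<in> S' \<and> i \<notin> S" by blast
    have "ennreal (\<epsilon> / 2) < \<rho> (\<lambda>x. u x * indicator (F i) x)" using \<mu>(2)[of "N i"] by (simp add: F_def NS)
    also have "\<dots> \<le> X_norm (\<lambda>x. fS S x - fS S' x)"
      unfolding X_norm_def
    proof (rule mono)
      fix x
      show "u x * indicator (F i) x \<le> ennreal (cmod (fS S x - fS S' x))"
      proof (cases "x \<in> F i")
        case True
        then have "x \<in> (\<Union>i\<in>R. F i) \<longleftrightarrow> i \<in> R" for R using Fdisj by blast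
        then show ?thesis using i True by (auto simp: fS_def u_def indicator_def)
      qed simp
    qed measurable
    also have "\<dots> \<le> X_norm (\<lambda>x. fS S x - d S x) + X_norm (\<lambda>x. d S x - fS S' x)"
      by (rule X_norm_triangle_diff) measurable
    also have "X_norm (\<lambda>x. d S x - fS S' x) = X_norm (\<lambda>x. fS S' x - d S' x)"
      unfolding eq by (rule X_norm_minus_commute)
    also have "X_norm (\<lambda>x. fS S x - d S x) + X_norm (\<lambda>x. fS S' x - d S' x) \<le> ennreal (\<epsilon> / 4) + ennreal (\<epsilon> / 4)"
      by (intro add_mono close)
    also have "\<dots> = ennreal (\<epsilon> / 4 + \<epsilon> / 4)" using \<epsilon> by (intro ennreal_plus[symmetric]) auto
    also have "\<epsilon> / 4 + \<epsilon> / 4 = \<epsilon> / 2" by simp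
    finally show False by simp
  qed
  moreover have "countable (range d)" using D(1) d(1) by (auto intro: countable_subset)
  ultimately have "countable (UNIV :: nat set set)" by (simp add: countable_image_inj_eq)
  then have "range (from_nat_into (UNIV :: nat set set)) = UNIV" by (intro range_from_nat_into) auto
  then show False using Cantors_theorem[of "UNIV :: nat set"] by auto
qed

text \<open>Riesz-Fischer: the local L1 bound gives a.e. convergence on each \<open>[-k, k]\<close>,
  hence a.e. on the line, and Fatou gives the rate.\<close>

lemma X_complete:
  assumes [measurable]: "\<And>n. s n \<in> borel_measurable lebesgue" and K: "K \<ge> 0"
    and fast: "\<And>n. X_norm (\<lambda>x. s (Suc n) x - s n x) \<le> ennreal (K * (1/2) ^ n)"
  obtains v where "v \<in> borel_measurable lebesgue" "\<And>n. X_norm (\<lambda>x. v x - s n x) \<le> ennreal (2 * K * (1/2) ^ n)"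
proof -
  have loc: "AE x in lebesgue. x \<in> {- real k..real k} \<longrightarrow> convergent (\<lambda>n. s n x)" for k :: nat
  proof -
    let ?E = "{- real k..real k}"
    have E: "?E \<in> sets lebesgue" "emeasure lebesgue ?E < \<infinity>" by auto
    obtain C where C: "\<And>f. f \<in> borel_measurable lebesgue \<Longrightarrow> (\<integral>\<^sup>+x\<in>?E. f x \<partial>lebesgue) \<le> ennreal C * \<rho> f"
      using local_L1[OF E] by blast
    have "(\<integral>\<^sup>+x. (\<Sum>n. ennreal (cmod (s (Suc n) x - s n x)) * indicator ?E x) \<partial>lebesgue)
      = (\<Sum>n. \<integral>\<^sup>+x\<in>?E. ennreal (cmod (s (Suc n) x - s n x)) \<partial>lebesgue)"
      by (intro nn_integral_suminf) measurable
    also have "\<dots> \<le> (\<Sum>n. ennreal C * ennreal K * ennreal ((1/2) ^ n))"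
    proof (intro suminf_le)
      fix n
      have "(\<integral>\<^sup>+x\<in>?E. ennreal (cmod (s (Suc n) x - s n x)) \<partial>lebesgue) \<le> ennreal C * X_norm (\<lambda>x. s (Suc n) x - s n x)"
        unfolding X_norm_def by (rule C) measurable
      also have "\<dots> \<le> ennreal C * ennreal (K * (1/2) ^ n)" by (intro mult_left_mono fast) auto
      also have "\<dots> = ennreal C * ennreal K * ennreal ((1/2) ^ n)"
        using K by (subst ennreal_mult) (auto simp: mult.assoc)
      finally show "(\<integral>\<^sup>+x\<in>?E. ennreal (cmod (s (Suc n) x - s n x)) \<partial>lebesgue) \<le> ennreal C * ennreal K * ennreal ((1/2) ^ n)" .
    qed auto
    also have "\<dots> = ennreal C * ennreal K * 2" by (simp add: suminf_half_ennreal)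
    also have "\<dots> < \<infinity>" by (simp add: ennreal_mult_less_top)
    finally have "AE x in lebesgue. (\<Sum>n. ennreal (cmod (s (Suc n) x - s n x)) * indicator ?E x) \<noteq> \<infinity>"
      by (intro nn_integral_noteq_infinite) auto
    then show ?thesis
    proof (eventually_elim, intro impI)
      fix x assume fin: "(\<Sum>n. ennreal (cmod (s (Suc n) x - s n x)) * indicator ?E x) \<noteq> \<infinity>" and x: "x \<in> ?E"
      then have "summable (\<lambda>n. cmod (s (Suc n) x - s n x))"
        by (intro summable_suminf_not_top) auto
      then have "summable (\<lambda>n. s (Suc n) x - s n x)" by (rule summable_norm_cancel)
      then have "(\<lambda>n. s n x - s 0 x) \<longlonglongrightarrow> (\<Sum>k. s (Suc k) x - s k x)"
        by (subst sum_lessThan_telescope[symmetric]) (rule summable_LIMSEQ)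
      then have "(\<lambda>n. (s n x - s 0 x) + s 0 x) \<longlonglongrightarrow> (\<Sum>k. s (Suc k) x - s k x) + s 0 x"
        by (intro tendsto_add tendsto_const)
      then show "convergent (\<lambda>n. s n x)" by (auto intro: convergentI)
    qed
  qed
  have "AE x in lebesgue. \<forall>k::nat. x \<in> {- real k..real k} \<longrightarrow> convergent (\<lambda>n. s n x)"
    using loc by (subst AE_all_countable) blast
  then have conv: "AE x in lebesgue. convergent (\<lambda>n. s n x)"
  proof eventually_elim
    case (elim x)
    obtain k :: nat where "\<bar>x\<bar> \<le> real k" using real_arch_simple by blast
    then show ?case using elim[rule_format, of k] by (auto simp: abs_le_iff)
  qed
  define v where "v x = lim (\<lambda>n. s n x)" for x
  have [measurable]: "v \<in> borel_measurable lebesgue" unfolding v_def by measurable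
  have lim: "AE x in lebesgue. (\<lambda>n. s n x) \<longlonglongrightarrow> v x"
    using conv by eventually_elim (simp add: v_def convergent_LIMSEQ_iff)
  \<comment> \<open>The geometric sum in closed form; without the subtracted term the induction
    would not close.\<close>
  have step: "X_norm (\<lambda>x. s (n + m) x - s n x) \<le> ennreal (2 * K * (1/2) ^ n - 2 * K * (1/2) ^ (n + m))" for n m
  proof (induction m)
    case 0
    then show ?case using X_norm_eq_0_iff[of "\<lambda>x. s n x - s n x"] by simp
  next
    case (Suc m)
    have "X_norm (\<lambda>x. s (n + Suc m) x - s n x) \<le> X_norm (\<lambda>x. s (n + Suc m) x - s (n + m) x) + X_norm (\<lambda>x. s (n + m) x - s n x)"
      by (rule X_norm_triangle_diff) measurable
    also have "\<dots> \<le> ennreal (K * (1/2) ^ (n + m)) + ennreal (2 * K * (1/2) ^ n - 2 * K * (1/2) ^ (n + m))"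
      using fast[of "n + m"] Suc by (intro add_mono) auto
    also have "\<dots> = ennreal (K * (1/2) ^ (n + m) + (2 * K * (1/2) ^ n - 2 * K * (1/2) ^ (n + m)))"
    proof (intro ennreal_plus[symmetric])
      have "(1/2::real) ^ (n + m) \<le> (1/2) ^ n" by (intro power_decreasing) auto
      then show "0 \<le> 2 * K * (1/2) ^ n - 2 * K * (1/2) ^ (n + m)" using K by (simp add: mult_left_mono)
    qed (use K in auto)
    finally show ?case by simp
  qed
  have "X_norm (\<lambda>x. v x - s n x) \<le> ennreal (2 * K * (1/2) ^ n)" for n
    unfolding X_norm_def
  proof (rule Fatou[of "\<lambda>m x. ennreal (cmod (s (n + m) x - s n x))"])
    show "AE x in lebesgue. (\<lambda>m. ennreal (cmod (s (n + m) x - s n x))) \<longlonglongrightarrow> ennreal (cmod (v x - s n x))"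
      using lim
    proof eventually_elim
      case (elim x)
      then have "(\<lambda>m. s (n + m) x) \<longlonglongrightarrow> v x" using LIMSEQ_ignore_initial_segment[OF elim, of n] by (simp add: add.commute)
      then show ?case by (intro tendsto_ennrealI tendsto_intros)
    qed
    show "\<rho> (\<lambda>x. ennreal (cmod (s (n + m) x - s n x))) \<le> ennreal (2 * K * (1/2) ^ n)" for m
      using order_trans[OF step[of n m, unfolded X_norm_def]] K by (simp add: ennreal_leI)
  qed measurable
  then show thesis by (intro that[of v]) auto
qed

text \<open>The extension is the closure of the graph of \<open>T0\<close>: existence comes from
  density and completeness, uniqueness a.e. and the bound from the estimate on the core class.
  Linearity is an a.e. statement because values are representatives chosen up to null sets.\<close>

lemma bounded_extension:
  fixes T0 :: "(real \<Rightarrow> complex) \<Rightarrow> real \<Rightarrow> complex"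
  assumes sep: "X_separable \<rho>" and K: "K \<ge> 0"
    and meas: "\<And>f. bounded_bounded_support f \<Longrightarrow> T0 f \<in> borel_measurable lebesgue"
    and bound: "\<And>f. bounded_bounded_support f \<Longrightarrow> X_norm (T0 f) \<le> ennreal K * X_norm f"
    and linear: "\<And>f g a b. bounded_bounded_support f \<Longrightarrow> bounded_bounded_support g \<Longrightarrow>
      AE x in lebesgue. T0 (\<lambda>y. a * f y + b * g y) x = a * T0 f x + b * T0 g x"
  obtains T where "\<And>f. inX \<rho> f \<Longrightarrow> inX \<rho> (T f)"
    "\<And>f g a b. inX \<rho> f \<Longrightarrow> inX \<rho> g \<Longrightarrow> AE x in lebesgue. T (\<lambda>y. a * f y + b * g y) x = a * T f x + b * T g x"
    "\<And>f. inX \<rho> f \<Longrightarrow> X_norm (T f) \<le> ennreal K * X_norm f"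
    "\<And>f. bounded_bounded_support f \<Longrightarrow> T f = T0 f"
proof -
  define approx where "approx f u \<longleftrightarrow> u \<in> borel_measurable lebesgue \<and> (\<forall>\<epsilon>>0. \<exists>h. bounded_bounded_support h \<and>
     X_norm (\<lambda>x. f x - h x) < ennreal \<epsilon> \<and> X_norm (\<lambda>x. u x - T0 h x) < ennreal \<epsilon>)" for f u
    \<comment> \<open>\<open>(f, u)\<close> lies in the closure of the graph of \<open>T0\<close>\<close>
  note bm = bounded_bounded_support_measurable
  have Tdiff: "X_norm (\<lambda>x. T0 h x - T0 k x) \<le> ennreal K * X_norm (\<lambda>x. h x - k x)"
    if "bounded_bounded_support h" "bounded_bounded_support k" for h k
  proof -
    note [measurable] = meas[OF that(1)] meas[OF that(2)] meas[OF bounded_bounded_support_diff[OF that]]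
    have "X_norm (\<lambda>x. T0 h x - T0 k x) = X_norm (T0 (\<lambda>y. h y - k y))"
      using linear[OF that, of 1 "-1"] by (intro X_norm_cong_AE) auto
    also have "\<dots> \<le> ennreal K * X_norm (\<lambda>x. h x - k x)" by (rule bound[OF bounded_bounded_support_diff[OF that]])
    finally show ?thesis .
  qed
  have approx_ex: "\<exists>u. approx f u" if f: "inX \<rho> f" for f
  proof -
    have fm[measurable]: "f \<in> borel_measurable lebesgue" using f by (simp add: inX_iff)
    have "\<exists>h. bounded_bounded_support h \<and> X_norm (\<lambda>x. f x - h x) < ennreal ((1/2) ^ n)" for n :: nat
      by (rule bounded_bounded_support_dense[OF sep f]) simp
    then obtain h where h: "\<And>n. bounded_bounded_support (h n)" "\<And>n. X_norm (\<lambda>x. f x - h n x) < ennreal ((1/2) ^ n)" by metis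
    note [measurable] = bm[OF h(1)] meas[OF h(1)]
    obtain v where v: "v \<in> borel_measurable lebesgue" "\<And>n. X_norm (\<lambda>x. v x - T0 (h n) x) \<le> ennreal (2 * (2 * K) * (1/2) ^ n)"
    proof (rule X_complete[of "\<lambda>n. T0 (h n)" "2 * K"])
      fix n
      have "X_norm (\<lambda>x. h (Suc n) x - h n x) \<le> X_norm (\<lambda>x. h (Suc n) x - f x) + X_norm (\<lambda>x. f x - h n x)"
        by (rule X_norm_triangle_diff) measurable
      also have "X_norm (\<lambda>x. h (Suc n) x - f x) = X_norm (\<lambda>x. f x - h (Suc n) x)" by (rule X_norm_minus_commute)
      also have "X_norm (\<lambda>x. f x - h (Suc n) x) + X_norm (\<lambda>x. f x - h n x) \<le> ennreal ((1/2) ^ Suc n) + ennreal ((1/2) ^ n)"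
        using h(2) by (intro add_mono less_imp_le)
      also have "\<dots> = ennreal ((1/2) ^ Suc n + (1/2) ^ n)" by (intro ennreal_plus[symmetric]) auto
      also have "\<dots> \<le> ennreal (2 * (1/2) ^ n)" by (intro ennreal_leI) simp
      finally have "ennreal K * X_norm (\<lambda>x. h (Suc n) x - h n x) \<le> ennreal K * ennreal (2 * (1/2) ^ n)" by (rule mult_left_mono) simp
      also have "\<dots> = ennreal (2 * K * (1/2) ^ n)" using K by (subst ennreal_mult[symmetric]) (auto simp: mult_ac)
      finally show "X_norm (\<lambda>x. T0 (h (Suc n)) x - T0 (h n) x) \<le> ennreal (2 * K * (1/2) ^ n)"
        using Tdiff[OF h(1) h(1), of "Suc n" n] by (rule order_trans[rotated])
    qed (use K in auto)
    have "approx f v"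
      unfolding approx_def
    proof (intro conjI allI impI v)
      fix \<epsilon> :: real assume \<epsilon>: "\<epsilon> > 0"
      obtain n where n: "(1/2) ^ n < \<epsilon> / (4 * K + 1)"
        using real_arch_pow_inv[of "\<epsilon> / (4 * K + 1)" "1/2"] \<epsilon> K by auto
      have e: "\<epsilon> / (4 * K + 1) * (4 * K + 1) = \<epsilon>" using K by simp
      have "(1/2) ^ n * (4 * K + 1) < \<epsilon>"
        using mult_strict_right_mono[OF n, of "4 * K + 1"] K unfolding e by simp
      moreover have "0 \<le> 4 * K * (1/2) ^ n" "0 < (1/2::real) ^ n" using K by auto
      ultimately have "(1/2) ^ n < \<epsilon>" "2 * (2 * K) * (1/2) ^ n < \<epsilon>" by (simp_all only: distrib_left mult.commute mult.left_commute)
      then have "X_norm (\<lambda>x. f x - h n x) < ennreal \<epsilon>" "X_norm (\<lambda>x. v x - T0 (h n) x) < ennreal \<epsilon>"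
        using h(2)[of n] v(2)[of n] \<epsilon> by (auto intro: order_less_trans order_le_less_trans ennreal_lessI)
      then show "\<exists>h. bounded_bounded_support h \<and> X_norm (\<lambda>x. f x - h x) < ennreal \<epsilon> \<and> X_norm (\<lambda>x. v x - T0 h x) < ennreal \<epsilon>"
        using h(1) by blast
    qed
    then show ?thesis by blast
  qed
  have approx_unique: "AE x in lebesgue. u x = v x"
    if f: "f \<in> borel_measurable lebesgue" and u: "approx f u" and v: "approx f v" for f u v
  proof -
    have [measurable]: "u \<in> borel_measurable lebesgue" "v \<in> borel_measurable lebesgue" using u v by (auto simp: approx_def)
    note f[measurable]
    have le: "X_norm (\<lambda>x. u x - v x) \<le> ennreal \<epsilon>" if "\<epsilon> > 0" for \<epsilon>
    proof -
      \<comment> \<open>\<open>2 * K + 2\<close>: one \<open>\<delta>\<close> for each of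
        \<open>u\<close> and \<open>v\<close> to the images of the core functions, and
        \<open>K * (2 * \<delta>)\<close> between these images.\<close>
      define \<delta> where "\<delta> = \<epsilon> / (2 * K + 2)"
      have \<delta>: "\<delta> > 0" "(2 * K + 2) * \<delta> = \<epsilon>" using that K by (auto simp: \<delta>_def)
      obtain h where h: "bounded_bounded_support h" "X_norm (\<lambda>x. f x - h x) < ennreal \<delta>" "X_norm (\<lambda>x. u x - T0 h x) < ennreal \<delta>"
        using u \<delta>(1) unfolding approx_def by blast
      obtain k where k: "bounded_bounded_support k" "X_norm (\<lambda>x. f x - k x) < ennreal \<delta>" "X_norm (\<lambda>x. v x - T0 k x) < ennreal \<delta>"
        using v \<delta>(1) unfolding approx_def by blast
      note [measurable] = bm[OF h(1)] bm[OF k(1)] meas[OF h(1)] meas[OF k(1)]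
      have "X_norm (\<lambda>x. h x - k x) \<le> X_norm (\<lambda>x. h x - f x) + X_norm (\<lambda>x. f x - k x)"
        by (rule X_norm_triangle_diff) measurable
      also have "\<dots> \<le> ennreal \<delta> + ennreal \<delta>"
        using h(2) k(2) X_norm_minus_commute[of h f] by (intro add_mono) (auto intro: less_imp_le)
      also have "\<dots> = ennreal (2 * \<delta>)" using \<delta>(1) unfolding mult_2 by (intro ennreal_plus[symmetric]) auto
      finally have "ennreal K * X_norm (\<lambda>x. h x - k x) \<le> ennreal K * ennreal (2 * \<delta>)" by (rule mult_left_mono) simp
      then have hk: "X_norm (\<lambda>x. T0 h x - T0 k x) \<le> ennreal (K * (2 * \<delta>))"
        using Tdiff[OF h(1) k(1)] K \<delta>(1) by (simp add: ennreal_mult)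
      have "X_norm (\<lambda>x. u x - v x) \<le> X_norm (\<lambda>x. u x - T0 h x) + X_norm (\<lambda>x. T0 h x - v x)"
        by (rule X_norm_triangle_diff) measurable
      also have "\<dots> \<le> X_norm (\<lambda>x. u x - T0 h x) + (X_norm (\<lambda>x. T0 h x - T0 k x) + X_norm (\<lambda>x. T0 k x - v x))"
        by (intro add_left_mono X_norm_triangle_diff) measurable
      also have "\<dots> \<le> ennreal \<delta> + (ennreal (K * (2 * \<delta>)) + ennreal \<delta>)"
        using h(3) k(3) X_norm_minus_commute[of "T0 k" v] hk by (intro add_mono) (auto intro: less_imp_le)
      also have "\<dots> = ennreal (\<delta> + (K * (2 * \<delta>) + \<delta>))"
      proof -
        have "0 \<le> \<delta>" "0 \<le> K * (2 * \<delta>)" using K \<delta>(1) by auto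
        then show ?thesis by (simp only: ennreal_plus add_nonneg_nonneg)
      qed
      also have "\<delta> + (K * (2 * \<delta>) + \<delta>) = \<epsilon>" using \<delta>(2) by (simp add: algebra_simps)
      finally show ?thesis .
    qed
    have "X_norm (\<lambda>x. u x - v x) \<le> 0"
      by (rule ennreal_le_epsilon) (use le in auto)
    then have "AE x in lebesgue. u x - v x = 0" by (subst (asm) le_zero_eq, subst (asm) X_norm_eq_0_iff) auto
    then show ?thesis by auto
  qed
  have approx_linear: "approx (\<lambda>x. a * f x + b * g x) (\<lambda>x. a * u x + b * v x)"
    if fm: "f \<in> borel_measurable lebesgue" and gm: "g \<in> borel_measurable lebesgue" and u: "approx f u" and v: "approx g v" for f g u v a b
    unfolding approx_def
  proof (intro conjI allI impI)
    note fm[measurable] gm[measurable]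
    have [measurable]: "u \<in> borel_measurable lebesgue" "v \<in> borel_measurable lebesgue" using u v by (auto simp: approx_def)
    show "(\<lambda>x. a * u x + b * v x) \<in> borel_measurable lebesgue" by measurable
    fix \<epsilon> :: real assume \<epsilon>: "\<epsilon> > 0"
    \<comment> \<open>The 1 guards against \<open>a = b = 0\<close> and makes the final inequality
      strict.\<close>
    define \<delta> where "\<delta> = \<epsilon> / (cmod a + cmod b + 1)"
    have pos: "cmod a + cmod b + 1 > 0" by (intro add_nonneg_pos add_nonneg_nonneg) auto
    have \<delta>: "\<delta> > 0" "(cmod a + cmod b + 1) * \<delta> = \<epsilon>" using \<epsilon> pos by (auto simp: \<delta>_def)
    obtain h where h: "bounded_bounded_support h" "X_norm (\<lambda>x. f x - h x) < ennreal \<delta>" "X_norm (\<lambda>x. u x - T0 h x) < ennreal \<delta>"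
      using u \<delta>(1) unfolding approx_def by blast
    obtain k where k: "bounded_bounded_support k" "X_norm (\<lambda>x. g x - k x) < ennreal \<delta>" "X_norm (\<lambda>x. v x - T0 k x) < ennreal \<delta>"
      using v \<delta>(1) unfolding approx_def by blast
    let ?l = "\<lambda>x. a * h x + b * k x"
    have l: "bounded_bounded_support ?l" by (intro bounded_bounded_support_add bounded_bounded_support_cmult h(1) k(1))
    note [measurable] = bm[OF h(1)] bm[OF k(1)] meas[OF h(1)] meas[OF k(1)] meas[OF l]
    have comb: "X_norm (\<lambda>x. a * p x + b * q x) < ennreal \<epsilon>"
      if [measurable]: "p \<in> borel_measurable lebesgue" "q \<in> borel_measurable lebesgue" and pq: "X_norm p < ennreal \<delta>" "X_norm q < ennreal \<delta>" for p q
    proof -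
      have "X_norm (\<lambda>x. a * p x + b * q x) \<le> X_norm (\<lambda>x. a * p x) + X_norm (\<lambda>x. b * q x)" by (rule X_norm_triangle) measurable
      also have "\<dots> = ennreal (cmod a) * X_norm p + ennreal (cmod b) * X_norm q" by (simp add: X_norm_cmult)
      also have "\<dots> \<le> ennreal (cmod a) * ennreal \<delta> + ennreal (cmod b) * ennreal \<delta>"
        using pq by (intro add_mono mult_left_mono) (auto intro: less_imp_le)
      also have "\<dots> = ennreal (cmod a * \<delta> + cmod b * \<delta>)" using \<delta>(1) by (simp add: ennreal_mult)
      also have "\<dots> < ennreal \<epsilon>"
        using \<delta> \<epsilon> by (intro ennreal_lessI) (auto simp: algebra_simps)
      finally show ?thesis .
    qed
    have "X_norm (\<lambda>x. (a * f x + b * g x) - ?l x) < ennreal \<epsilon>"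
    proof -
      have "X_norm (\<lambda>x. a * (f x - h x) + b * (g x - k x)) < ennreal \<epsilon>" by (rule comb) (measurable, auto intro: h k)
      then show ?thesis by (simp add: algebra_simps)
    qed
    moreover have "X_norm (\<lambda>x. (a * u x + b * v x) - T0 ?l x) < ennreal \<epsilon>"
    proof -
      have "X_norm (\<lambda>x. a * (u x - T0 h x) + b * (v x - T0 k x)) < ennreal \<epsilon>" by (rule comb) (measurable, auto intro: h k)
      moreover have "X_norm (\<lambda>x. a * (u x - T0 h x) + b * (v x - T0 k x)) = X_norm (\<lambda>x. (a * u x + b * v x) - T0 ?l x)"
        using linear[OF h(1) k(1), of a b] by (intro X_norm_cong_AE) (auto simp: algebra_simps)
      ultimately show ?thesis by simp
    qed
    ultimately show "\<exists>h. bounded_bounded_support h \<and> X_norm (\<lambda>x. (a * f x + b * g x) - h x) < ennreal \<epsilon> \<and>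
      X_norm (\<lambda>x. (a * u x + b * v x) - T0 h x) < ennreal \<epsilon>" using l by blast
  qed
  have approx_bound: "X_norm u \<le> ennreal K * X_norm f" if f: "f \<in> borel_measurable lebesgue" and u: "approx f u" for f u
  proof (rule ennreal_le_epsilon)
    fix \<epsilon> :: real assume \<epsilon>: "\<epsilon> > 0"
    have [measurable]: "u \<in> borel_measurable lebesgue" using u by (auto simp: approx_def)
    note f[measurable]
    define \<delta> where "\<delta> = \<epsilon> / (K + 1)"
    have \<delta>: "\<delta> > 0" "(K + 1) * \<delta> = \<epsilon>" using \<epsilon> K by (auto simp: \<delta>_def)
    obtain h where h: "bounded_bounded_support h" "X_norm (\<lambda>x. f x - h x) < ennreal \<delta>" "X_norm (\<lambda>x. u x - T0 h x) < ennreal \<delta>"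
      using u \<delta>(1) unfolding approx_def by blast
    note [measurable] = bm[OF h(1)] meas[OF h(1)]
    have "X_norm h \<le> X_norm f + ennreal \<delta>"
      using X_norm_triangle[of f "\<lambda>x. h x - f x"] h(2) X_norm_minus_commute[of h f]
      by (auto intro: order_trans add_left_mono less_imp_le)
    then have "X_norm (T0 h) \<le> ennreal K * (X_norm f + ennreal \<delta>)"
      using bound[OF h(1)] by (meson mult_left_mono order_trans zero_le)
    moreover have "X_norm u \<le> X_norm (T0 h) + X_norm (\<lambda>x. u x - T0 h x)"
      using X_norm_triangle[of "T0 h" "\<lambda>x. u x - T0 h x"] by simp
    ultimately have "X_norm u \<le> ennreal K * (X_norm f + ennreal \<delta>) + ennreal \<delta>"
      using h(3) by (meson add_mono less_imp_le order_trans)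
    also have "\<dots> = ennreal K * X_norm f + (ennreal (K * \<delta>) + ennreal \<delta>)"
      using K \<delta>(1) by (simp add: distrib_left ennreal_mult add.assoc)
    also have "ennreal (K * \<delta>) + ennreal \<delta> = ennreal (K * \<delta> + \<delta>)" using K \<delta>(1) by (intro ennreal_plus[symmetric]) auto
    also have "K * \<delta> + \<delta> = \<epsilon>" using \<delta>(2) by (simp add: algebra_simps)
    finally show "X_norm u \<le> ennreal K * X_norm f + ennreal \<epsilon>" .
  qed
  \<comment> \<open>On the core class \<open>T0\<close> is kept literally, so that agreement there
    is an equality of functions; elsewhere any limit is chosen.\<close>
  define T where "T f = (if bounded_bounded_support f then T0 f else (SOME u. approx f u))" for f
  have approx_T: "approx f (T f)" if "inX \<rho> f" for f
  proof (cases "bounded_bounded_support f")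
    case True
    have "X_norm (\<lambda>x. 0) = 0" using X_norm_eq_0_iff[of "\<lambda>x. 0"] by simp
    then have "approx f (T0 f)" unfolding approx_def using True meas[OF True] by (auto intro!: exI[of _ f])
    then show ?thesis using True by (simp add: T_def)
  next
    case False
    then show ?thesis using someI_ex[OF approx_ex[OF that]] by (simp add: T_def)
  qed
  show thesis
  proof (rule that[of T])
    fix f assume f: "inX \<rho> f"
    then have fm: "f \<in> borel_measurable lebesgue" by (simp add: inX_iff)
    show le: "X_norm (T f) \<le> ennreal K * X_norm f" by (rule approx_bound[OF fm approx_T[OF f]])
    have "ennreal K * X_norm f < \<infinity>" using f by (simp add: inX_iff ennreal_mult_less_top)
    then show "inX \<rho> (T f)" using le approx_T[OF f] by (auto simp: inX_iff approx_def intro: order_le_less_trans)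
  next
    fix f g a b assume f: "inX \<rho> f" and g: "inX \<rho> g"
    then have m: "f \<in> borel_measurable lebesgue" "g \<in> borel_measurable lebesgue" by (auto simp: inX_iff)
    show "AE x in lebesgue. T (\<lambda>y. a * f y + b * g y) x = a * T f x + b * T g x"
    proof (rule approx_unique)
      show "(\<lambda>y. a * f y + b * g y) \<in> borel_measurable lebesgue" using m by measurable
      show "approx (\<lambda>y. a * f y + b * g y) (T (\<lambda>y. a * f y + b * g y))" by (rule approx_T[OF inX_linear[OF f g]])
      show "approx (\<lambda>y. a * f y + b * g y) (\<lambda>x. a * T f x + b * T g x)"
        by (rule approx_linear[OF m approx_T[OF f] approx_T[OF g]])
    qed
  qed (simp add: T_def)
qed

end

section \<open>The wavelet operators\<close>

lemma in_L2_bounded_bounded_support: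
  assumes "bounded_bounded_support f"
  shows "in_L2 f"
proof -
  obtain m where m: "m > 0" "\<And>x. cmod (f x) \<le> m" "\<And>x. m < \<bar>x\<bar> \<Longrightarrow> f x = 0" and [measurable]: "f \<in> borel_measurable lebesgue"
    using bounded_bounded_supportE[OF assms] by blast
  have "L2sq f \<le> (\<integral>\<^sup>+x. ennreal (m\<^sup>2) * indicator {-m..m} x \<partial>lebesgue)"
    unfolding L2sq_def
  proof (rule nn_integral_mono)
    fix x
    show "ennreal ((cmod (f x))\<^sup>2) \<le> ennreal (m\<^sup>2) * indicator {-m..m} x"
    proof (cases "x \<in> {-m..m}")
      case True
      then show ?thesis using m(2)[of x] by (auto intro!: ennreal_leI power_mono)
    next
      case False
      then have "m < \<bar>x\<bar>" by auto
      then show ?thesis using m(3) by simp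
    qed
  qed
  also have "\<dots> < \<infinity>" using m(1) by (subst nn_integral_cmult_indicator) (auto simp: ennreal_mult_less_top)
  finally show ?thesis by (simp add: in_L2_iff)
qed

lemma abs_sign_seqs: "\<epsilon> \<in> sign_seqs \<Longrightarrow> \<bar>\<epsilon> i\<bar> = 1"
  unfolding sign_seqs_def by (smt (verit) insert_iff mem_Collect_eq empty_iff)

lemma smooth_compact_bounded_bounded_support:
  assumes "smooth_compact f"
  shows "bounded_bounded_support f"
proof -
  obtain D R where D: "D 0 = f" "\<And>n x. (D n has_vector_derivative D (Suc n) x) (at x)" and R: "\<And>x. R < \<bar>x\<bar> \<Longrightarrow> f x = 0"
    using assms unfolding smooth_compact_def by blast
  have cont: "continuous_on UNIV f"
    using D(2)[of 0] unfolding D(1) by (meson continuous_at_imp_continuous_on has_vector_derivative_continuous)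
  then have "compact (f ` {-\<bar>R\<bar>..\<bar>R\<bar>})" by (intro compact_continuous_image) (auto intro: continuous_on_subset)
  then obtain b where b: "\<And>x. x \<in> {-\<bar>R\<bar>..\<bar>R\<bar>} \<Longrightarrow> cmod (f x) \<le> b"
    using compact_imp_bounded bounded_iff by (metis imageI)
  show ?thesis
  proof (rule bounded_bounded_supportI[of _ "max 0 b" R])
    show "f \<in> borel_measurable lebesgue"
      using borel_measurable_continuous_onI[OF cont] by (intro measurable_completion) simp
    show "cmod (f x) \<le> max 0 b" for x
    proof (cases "x \<in> {-\<bar>R\<bar>..\<bar>R\<bar>}")
      case True
      then show ?thesis using b[OF True] by simp
    next
      case False
      then have "R < \<bar>x\<bar>" by auto
      then show ?thesis using R by simp
    qed
  qed (rule R)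
qed

text \<open>The bilinear estimate, Hoelder for the two maximal functions, the maximal bound on the
  space for \<open>f\<close> and on the associate space for \<open>g\<close>, and finally duality.
  The constant involves the kernel through \<open>B\<close> only.\<close>

lemma (in function_space) smooth_kernel_bounded:
  assumes "smooth_kernel K B N"
    and M1: "\<And>f. inX \<rho> f \<Longrightarrow> \<rho> (maximal_op (\<lambda>x. ennreal (cmod (f x)))) \<le> ennreal C1 * \<rho> (\<lambda>x. ennreal (cmod (f x)))"
    and M2: "\<And>f. inX (assoc_norm \<rho>) f \<Longrightarrow> assoc_norm \<rho> (maximal_op (\<lambda>x. ennreal (cmod (f x)))) \<le> ennreal C2 * assoc_norm \<rho> (\<lambda>x. ennreal (cmod (f x)))"
    and C: "C1 \<ge> 0" "C2 \<ge> 0" and f: "bounded_bounded_support f"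
  shows "X_norm (smooth_kernel.T K f) \<le> ennreal (6 * smooth_kernel.osc_const B * C1 * C2) * X_norm f"
proof -
  interpret smooth_kernel K B N by fact
  note Tm[measurable] = T_measurable[OF f]
  define c where "c = 6 * osc_const * C1 * C2"
  have c0: "c \<ge> 0" unfolding c_def using osc_const_pos C by simp
  have fX: "inX \<rho> f" by (rule inX_bounded_bounded_support[OF f])
  obtain r where r: "X_norm f = ennreal r" "r \<ge> 0" using fX by (cases "X_norm f") (auto simp: inX_iff)
  have "X_norm (T f) \<le> ennreal (c * r)"
  proof (rule ennreal_le_epsilon)
    \<comment> \<open>The duality lemma asks for a positive constant, and \<open>c * r\<close> may
      be 0.\<close>
    fix \<epsilon> :: real assume \<epsilon>: "\<epsilon> > 0"
    have "X_norm (T f) \<le> ennreal (c * r + \<epsilon>)"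
      unfolding X_norm_def
    proof (rule Lorentz_Luxemburg)
      show "(\<lambda>x. ennreal (cmod (T f x))) \<in> borel_measurable lebesgue" by measurable
      show "0 < c * r + \<epsilon>" using c0 r(2) \<epsilon> by (simp add: add_nonneg_pos)
      fix g :: "real \<Rightarrow> ennreal" and m :: real
      assume gm[measurable]: "g \<in> borel_measurable lebesgue" and g: "\<And>x. g x \<le> ennreal m" "\<And>x. m < \<bar>x\<bar> \<Longrightarrow> g x = 0"
      \<comment> \<open>Boundedness of the maximal operator is formulated for complex functions;
        \<open>g\<close> is finite-valued, so it is the modulus of one.\<close>
      define g' where "g' x = complex_of_real (enn2real (g x))" for x
      have g'g: "(\<lambda>x. ennreal (cmod (g' x))) = g"
        using order_le_less_trans[OF g(1) ennreal_less_top] by (simp add: g'_def fun_eq_iff)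
      have "g' \<in> borel_measurable lebesgue" unfolding g'_def by measurable
      then have g'X: "inX (assoc_norm \<rho>) g'"
        unfolding inX_def g'g using assoc_norm_finite[OF g] by simp
      have Mf: "\<rho> (maximal_op (\<lambda>x. ennreal (cmod (f x)))) \<le> ennreal C1 * ennreal r"
        using M1[OF fX] r(1) by (simp add: X_norm_def)
      then have fin: "\<rho> (maximal_op (\<lambda>x. ennreal (cmod (f x)))) < \<infinity>"
        by (rule order_le_less_trans) (simp add: ennreal_mult_less_top)
      have "(\<integral>\<^sup>+x. ennreal (cmod (T f x)) * g x \<partial>lebesgue) \<le>
         ennreal (6 * osc_const) * (\<integral>\<^sup>+x. maximal_op (\<lambda>y. ennreal (cmod (f y))) x * maximal_op g x \<partial>lebesgue)"
        by (rule T_maximal_duality_bound[OF f gm g])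
      also have "\<dots> \<le> ennreal (6 * osc_const) * (\<rho> (maximal_op (\<lambda>x. ennreal (cmod (f x)))) * assoc_norm \<rho> (maximal_op g))"
        by (intro mult_left_mono Hoelder fin) auto
      also have "\<dots> \<le> ennreal (6 * osc_const) * ((ennreal C1 * ennreal r) * (ennreal C2 * assoc_norm \<rho> g))"
        using M2[OF g'X] unfolding g'g by (intro mult_left_mono mult_mono Mf) auto
      also have "\<dots> = ennreal (c * r) * assoc_norm \<rho> g"
        unfolding c_def using osc_const_pos C r(2) by (simp add: ennreal_mult mult_ac)
      also have "\<dots> \<le> ennreal (c * r + \<epsilon>) * assoc_norm \<rho> g"
        using \<epsilon> by (intro mult_right_mono ennreal_leI) auto
      finally show "(\<integral>\<^sup>+x. ennreal (cmod (T f x)) * g x \<partial>lebesgue) \<le> ennreal (c * r + \<epsilon>) * assoc_norm \<rho> g" .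
    qed
    then show "X_norm (T f) \<le> ennreal (c * r) + ennreal \<epsilon>" using c0 r(2) \<epsilon> by simp
  qed
  then show ?thesis using r c0 by (simp add: ennreal_mult c_def)
qed

locale orthonormal_decaying_wavelet = decaying_wavelet +
  assumes orthonormal_wavelet: "orthonormal_wavelet \<psi>"
begin

abbreviation wavs :: "int \<times> int \<Rightarrow> real \<Rightarrow> complex" where
  "wavs \<equiv> \<lambda>(j, k). wav \<psi> j k"

lemma wavs_continuous: "continuous_on UNIV (wavs i)"
  unfolding wav_def by (cases i) (auto intro!: continuous_intros continuous_on_compose2[OF \<psi>_continuous])

lemma wavs_measurable [measurable]: "wavs i \<in> borel_measurable lebesgue"
  using borel_measurable_continuous_onI[OF wavs_continuous[of i]] by (intro measurable_completion) simp

sublocale orthonormal_family wavs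
proof
  show "l2_inner (wavs i) (wavs j) = (if i = j then 1 else 0)" for i j
    using orthonormal_wavelet unfolding orthonormal_wavelet_def by (cases i; cases j) simp
qed (rule wavs_measurable)

lemma wavs_bound: "cmod (wavs i x) \<le> 2 powr (real_of_int (fst i) / 2) * W 0"
proof -
  have "cmod (\<psi> y) \<le> W 0" for y
    using \<psi>_bound[of y] W_decr[of 0 "\<bar>y\<bar> / 2"] by simp
  then show ?thesis by (cases i) (auto simp: wav_def norm_mult)
qed

definition multiplier_kernel :: "(int \<times> int \<Rightarrow> real) \<Rightarrow> (int \<times> int) set \<Rightarrow> real \<Rightarrow> real \<Rightarrow> complex" where
  "multiplier_kernel \<epsilon> G x y = (\<Sum>i\<in>G. of_real (\<epsilon> i) * wavs i x * cnj (wavs i y))"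

lemma integral_multiplier_kernel:
  assumes f: "bounded_bounded_support f"
  shows "(LINT y|lebesgue. multiplier_kernel \<epsilon> G x y * f y) = comb (\<lambda>i. of_real (\<epsilon> i) * l2_inner f (wavs i)) G x"
proof -
  have int: "integrable lebesgue (\<lambda>y. f y * cnj (wavs i y))" for i
    by (rule in_L2_mult_integrable[OF in_L2_bounded_bounded_support[OF f] e_L2])
  have "(LINT y|lebesgue. multiplier_kernel \<epsilon> G x y * f y) =
    (LINT y|lebesgue. (\<Sum>i\<in>G. (of_real (\<epsilon> i) * wavs i x) * (f y * cnj (wavs i y))))"
    unfolding multiplier_kernel_def sum_distrib_right by (simp add: mult_ac)
  also have "\<dots> = (\<Sum>i\<in>G. LINT y|lebesgue. (of_real (\<epsilon> i) * wavs i x) * (f y * cnj (wavs i y)))"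
    by (intro Bochner_Integration.integral_sum integrable_mult_right int)
  also have "\<dots> = comb (\<lambda>i. of_real (\<epsilon> i) * l2_inner f (wavs i)) G x"
    unfolding comb_def l2_inner_def 
    by (simp only: Bochner_Integration.integral_mult_right_zero) (simp only: mult_ac)
  finally show ?thesis .
qed

text \<open>Both smoothness conditions come from \<open>sum_wav_product\<close>, since exchanging
  the variables conjugates the kernel, and the signs have modulus one; so the constant is free of
  \<open>\<epsilon>\<close> and \<open>G\<close>, and only the sup bound depends on
  \<open>G\<close>. The contraction property combines orthonormality with Bessel.\<close>

lemma smooth_kernel_multiplier:
  assumes G: "finite G" and \<epsilon>: "\<epsilon> \<in> sign_seqs"
  shows "smooth_kernel (multiplier_kernel \<epsilon> G) kernel_const (\<Sum>i\<in>G. (2 powr (real_of_int (fst i) / 2) * W 0)\<^sup>2)"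
proof
  note e1 = abs_sign_seqs[OF \<epsilon>]
  show "continuous_on UNIV (\<lambda>x. multiplier_kernel \<epsilon> G x y)" for y
    unfolding multiplier_kernel_def by (intro continuous_on_sum continuous_on_mult continuous_on_const wavs_continuous)
  show "continuous_on UNIV (multiplier_kernel \<epsilon> G x)" for x
    unfolding multiplier_kernel_def[abs_def] by (intro continuous_on_sum continuous_on_mult continuous_on_const continuous_on_cnj wavs_continuous)
  show "cmod (multiplier_kernel \<epsilon> G x y) \<le> (\<Sum>i\<in>G. (2 powr (real_of_int (fst i) / 2) * W 0)\<^sup>2)" for x y
    unfolding multiplier_kernel_def
  proof (rule sum_norm_le)
    fix i
    show "cmod (of_real (\<epsilon> i) * wavs i x * cnj (wavs i y)) \<le> (2 powr (real_of_int (fst i) / 2) * W 0)\<^sup>2"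
      using wavs_bound[of i x] wavs_bound[of i y] W_pos[of 0]
      by (simp only: norm_mult norm_of_real e1 mult_1 complex_mod_cnj power2_eq_square) (intro mult_mono, auto)
  qed
  show "cmod (multiplier_kernel \<epsilon> G x y - multiplier_kernel \<epsilon> G c y) \<le> kernel_const * \<bar>x - c\<bar> / (y - c)\<^sup>2"
    if "2 * \<bar>x - c\<bar> \<le> \<bar>y - c\<bar>" for x c y
  proof -
    have "cmod (multiplier_kernel \<epsilon> G x y - multiplier_kernel \<epsilon> G c y) \<le> (\<Sum>i\<in>G. cmod (wavs i y) * cmod (wavs i x - wavs i c))"
      unfolding multiplier_kernel_def sum_subtractf[symmetric]
    proof (rule sum_norm_le)
      fix i
      have "of_real (\<epsilon> i) * wavs i x * cnj (wavs i y) - of_real (\<epsilon> i) * wavs i c * cnj (wavs i y) = of_real (\<epsilon> i) * cnj (wavs i y) * (wavs i x - wavs i c)"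
        by (simp add: algebra_simps)
      then show "cmod (of_real (\<epsilon> i) * wavs i x * cnj (wavs i y) - of_real (\<epsilon> i) * wavs i c * cnj (wavs i y)) \<le> cmod (wavs i y) * cmod (wavs i x - wavs i c)"
        by (simp only: norm_mult norm_of_real e1 mult_1 complex_mod_cnj)
    qed
    also have "\<dots> \<le> kernel_const * \<bar>x - c\<bar> / (y - c)\<^sup>2"
      using sum_wav_product[OF G that] by (simp add: case_prod_beta)
    finally show ?thesis .
  qed
  show "cmod (multiplier_kernel \<epsilon> G x y - multiplier_kernel \<epsilon> G x c) \<le> kernel_const * \<bar>y - c\<bar> / (x - c)\<^sup>2"
    if "2 * \<bar>y - c\<bar> \<le> \<bar>x - c\<bar>" for x c y
  proof -
    have "cmod (multiplier_kernel \<epsilon> G x y - multiplier_kernel \<epsilon> G x c) \<le> (\<Sum>i\<in>G. cmod (wavs i x) * cmod (wavs i y - wavs i c))"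
      unfolding multiplier_kernel_def sum_subtractf[symmetric]
    proof (rule sum_norm_le)
      fix i
      have "of_real (\<epsilon> i) * wavs i x * cnj (wavs i y) - of_real (\<epsilon> i) * wavs i x * cnj (wavs i c) = of_real (\<epsilon> i) * wavs i x * cnj (wavs i y - wavs i c)"
        by (simp add: algebra_simps)
      then show "cmod (of_real (\<epsilon> i) * wavs i x * cnj (wavs i y) - of_real (\<epsilon> i) * wavs i x * cnj (wavs i c)) \<le> cmod (wavs i x) * cmod (wavs i y - wavs i c)"
        by (simp only: norm_mult norm_of_real e1 mult_1 complex_mod_cnj)
    qed
    also have "\<dots> \<le> kernel_const * \<bar>y - c\<bar> / (x - c)\<^sup>2"
      using sum_wav_product[OF G that] by (simp add: case_prod_beta)
    finally show ?thesis .
  qed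
  show "kernel_const \<ge> 0" by (rule kernel_const_nonneg)
  fix f assume f: "bounded_bounded_support f"
  have "L2sq (comb (\<lambda>i. of_real (\<epsilon> i) * l2_inner f (wavs i)) G) \<le> L2sq f"
    using Bessel[OF in_L2_bounded_bounded_support[OF f] G] by (simp add: L2sq_comb[OF G] norm_mult e1)
  then show "(\<integral>\<^sup>+x. ennreal ((cmod (LINT y|lebesgue. multiplier_kernel \<epsilon> G x y * f y))\<^sup>2) \<partial>lebesgue) \<le> (\<integral>\<^sup>+x. ennreal ((cmod (f x))\<^sup>2) \<partial>lebesgue)"
    by (simp add: integral_multiplier_kernel[OF f] L2sq_def)
qed

lemma wavelet_op_value_iff:
  "wavelet_op_value \<psi> \<epsilon> f g \<longleftrightarrow> in_L2 g \<and> (\<forall>e>0. \<exists>F. finite F \<and> (\<forall>G. finite G \<and> F \<subseteq> G \<longrightarrow>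
     L2sq (\<lambda>x. g x - comb (\<lambda>i. of_real (\<epsilon> i) * l2_inner f (wavs i)) G x) < ennreal e))"
  unfolding wavelet_op_value_def L2sq_def comb_def by (simp add: case_prod_beta)

text \<open>Bessel makes the coefficients square summable, and the signs leave their moduli alone.
  The sets \<open>H n\<close> are kept for the passage to the limit in the function norm.\<close>

lemma wavelet_op_value_exists:
  assumes \<epsilon>: "\<epsilon> \<in> sign_seqs" and f: "in_L2 f"
  obtains g H where "wavelet_op_value \<psi> \<epsilon> f g" "\<And>n. finite (H n)"
    "AE x in lebesgue. (\<lambda>n. comb (\<lambda>i. of_real (\<epsilon> i) * l2_inner f (wavs i)) (H n) x) \<longlonglongrightarrow> g x"
proof -
  note e1 = abs_sign_seqs[OF \<epsilon>]
  obtain S where S: "L2sq f = ennreal S" "S \<ge> 0" using f by (cases "L2sq f") (auto simp: in_L2_iff)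
  have "(\<Sum>i\<in>G. (cmod (of_real (\<epsilon> i) * l2_inner f (wavs i)))\<^sup>2) \<le> S" if "finite G" for G
    using Bessel[OF f that] S by (simp add: norm_mult e1)
  from unconditional_L2_limit[OF this] obtain g H where "in_L2 g" "\<And>n. finite (H n)"
    "AE x in lebesgue. (\<lambda>n. comb (\<lambda>i. of_real (\<epsilon> i) * l2_inner f (wavs i)) (H n) x) \<longlonglongrightarrow> g x"
    "\<And>e. e > 0 \<Longrightarrow> \<exists>F. finite F \<and> (\<forall>G. finite G \<and> F \<subseteq> G \<longrightarrow> L2sq (\<lambda>x. g x - comb (\<lambda>i. of_real (\<epsilon> i) * l2_inner f (wavs i)) G x) < ennreal e)"
    by blast
  then show thesis using that[of g H] by (simp add: wavelet_op_value_iff)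
qed

lemma wavelet_op_value_linear:
  assumes f: "in_L2 f" "wavelet_op_value \<psi> \<epsilon> f u" and g: "in_L2 g" "wavelet_op_value \<psi> \<epsilon> g v"
  shows "wavelet_op_value \<psi> \<epsilon> (\<lambda>x. a * f x + b * g x) (\<lambda>x. a * u x + b * v x)"
  unfolding wavelet_op_value_iff
proof (intro conjI allI impI)
  have uv: "in_L2 u" "in_L2 v" using f g by (auto simp: wavelet_op_value_iff)
  show "in_L2 (\<lambda>x. a * u x + b * v x)" by (intro in_L2_add in_L2_cmult uv)
  let ?c = "\<lambda>f i. of_real (\<epsilon> i) * l2_inner f (wavs i)"
  fix e :: real assume e: "e > 0"
  \<comment> \<open>The constants are those of \<open>|x + y|^2 \<le> 2 |x|^2 + 2 |y|^2\<close>; the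
    1 covers \<open>a = b = 0\<close> and gives strictness.\<close>
  define d where "d = e / (2 * (cmod a)\<^sup>2 + 2 * (cmod b)\<^sup>2 + 1)"
  have pos: "2 * (cmod a)\<^sup>2 + 2 * (cmod b)\<^sup>2 + 1 > 0" by (intro add_nonneg_pos add_nonneg_nonneg) auto
  have d: "d > 0" "(2 * (cmod a)\<^sup>2 + 2 * (cmod b)\<^sup>2 + 1) * d = e" using e pos by (auto simp: d_def)
  obtain F1 where F1: "finite F1" "\<And>G. finite G \<Longrightarrow> F1 \<subseteq> G \<Longrightarrow> L2sq (\<lambda>x. u x - comb (?c f) G x) < ennreal d"
    using f(2) d(1) unfolding wavelet_op_value_iff by metis
  obtain F2 where F2: "finite F2" "\<And>G. finite G \<Longrightarrow> F2 \<subseteq> G \<Longrightarrow> L2sq (\<lambda>x. v x - comb (?c g) G x) < ennreal d"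
    using g(2) d(1) unfolding wavelet_op_value_iff by metis
  show "\<exists>F. finite F \<and> (\<forall>G. finite G \<and> F \<subseteq> G \<longrightarrow>
     L2sq (\<lambda>x. (a * u x + b * v x) - comb (?c (\<lambda>x. a * f x + b * g x)) G x) < ennreal e)"
  proof (intro exI[of _ "F1 \<union> F2"] conjI allI impI)
    fix G assume G: "finite G \<and> F1 \<union> F2 \<subseteq> G"
    have "l2_inner (\<lambda>x. a * f x + b * g x) (wavs i) = a * l2_inner f (wavs i) + b * l2_inner g (wavs i)" for i
      using l2_inner_add_left[OF in_L2_cmult[OF f(1)] in_L2_cmult[OF g(1)] e_L2] by (simp add: l2_inner_cmult_left)
    then have "comb (?c (\<lambda>x. a * f x + b * g x)) G x = a * comb (?c f) G x + b * comb (?c g) G x" for x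
      unfolding comb_def by (simp add: sum_distrib_left sum.distrib[symmetric] algebra_simps)
    then have "L2sq (\<lambda>x. (a * u x + b * v x) - comb (?c (\<lambda>x. a * f x + b * g x)) G x)
      = L2sq (\<lambda>x. a * (u x - comb (?c f) G x) + b * (v x - comb (?c g) G x))" by (simp add: algebra_simps)
    also have "\<dots> \<le> 2 * L2sq (\<lambda>x. a * (u x - comb (?c f) G x)) + 2 * L2sq (\<lambda>x. b * (v x - comb (?c g) G x))"
      using in_L2_measurable[OF uv(1)] in_L2_measurable[OF uv(2)] in_L2_measurable[OF comb_L2] G
      by (intro L2sq_add_le) auto
    also have "\<dots> = 2 * (ennreal ((cmod a)\<^sup>2) * L2sq (\<lambda>x. u x - comb (?c f) G x)) + 2 * (ennreal ((cmod b)\<^sup>2) * L2sq (\<lambda>x. v x - comb (?c g) G x))"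
      using in_L2_measurable[OF uv(1)] in_L2_measurable[OF uv(2)] in_L2_measurable[OF comb_L2] G
      by (subst (1 2) L2sq_cmult) auto
    also have "\<dots> \<le> 2 * (ennreal ((cmod a)\<^sup>2) * ennreal d) + 2 * (ennreal ((cmod b)\<^sup>2) * ennreal d)"
      using F1(2)[of G] F2(2)[of G] G by (intro add_mono mult_left_mono) (auto intro: less_imp_le)
    also have "\<dots> = ennreal (2 * ((cmod a)\<^sup>2 * d) + 2 * ((cmod b)\<^sup>2 * d))"
      using d(1) by (simp add: ennreal_mult)
    also have "\<dots> < ennreal e"
    proof (rule ennreal_lessI[OF e])
      have "2 * ((cmod a)\<^sup>2 * d) + 2 * ((cmod b)\<^sup>2 * d) + d = e" using d(2) by (simp add: algebra_simps)
      then show "2 * ((cmod a)\<^sup>2 * d) + 2 * ((cmod b)\<^sup>2 * d) < e" using d(1) by linarith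
    qed
    finally show "L2sq (\<lambda>x. (a * u x + b * v x) - comb (?c (\<lambda>x. a * f x + b * g x)) G x) < ennreal e" .
  qed (use F1 F2 in auto)
qed

text \<open>Both values are compared with the partial sum over one common index set. Uniqueness up
  to null sets transfers bounds and linearity to an arbitrarily chosen value of the
  operator.\<close>

lemma wavelet_op_value_unique:
  assumes u: "wavelet_op_value \<psi> \<epsilon> f u" and v: "wavelet_op_value \<psi> \<epsilon> f v"
  shows "AE x in lebesgue. u x = v x"
proof -
  let ?c = "\<lambda>i. of_real (\<epsilon> i) * l2_inner f (wavs i)"
  have [measurable]: "u \<in> borel_measurable lebesgue" "v \<in> borel_measurable lebesgue"
    using u v by (auto simp: wavelet_op_value_iff in_L2_iff)
  have "L2sq (\<lambda>x. u x - v x) \<le> 0"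
  proof (rule ennreal_le_epsilon)
    fix e :: real assume e: "e > 0"
    then have e4: "e / 4 > 0" by simp
    obtain F1 where F1: "finite F1" "\<And>G. finite G \<Longrightarrow> F1 \<subseteq> G \<Longrightarrow> L2sq (\<lambda>x. u x - comb ?c G x) < ennreal (e / 4)"
      using u e4 unfolding wavelet_op_value_iff by metis
    obtain F2 where F2: "finite F2" "\<And>G. finite G \<Longrightarrow> F2 \<subseteq> G \<Longrightarrow> L2sq (\<lambda>x. v x - comb ?c G x) < ennreal (e / 4)"
      using v e4 unfolding wavelet_op_value_iff by metis
    let ?G = "F1 \<union> F2"
    have G: "finite ?G" using F1 F2 by simp
    note [measurable] = in_L2_measurable[OF comb_L2[OF G]]
    have "L2sq (\<lambda>x. (u x - comb ?c ?G x) - (v x - comb ?c ?G x)) \<le> 2 * L2sq (\<lambda>x. u x - comb ?c ?G x) + 2 * L2sq (\<lambda>x. v x - comb ?c ?G x)"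
      by (rule L2sq_diff_le) measurable
    also have "\<dots> \<le> 2 * ennreal (e / 4) + 2 * ennreal (e / 4)"
      using F1(2)[OF G] F2(2)[OF G] by (intro add_mono mult_left_mono) (auto intro: less_imp_le)
    also have "\<dots> = ennreal (2 * (e / 4) + 2 * (e / 4))"
    proof -
      have "0 \<le> 2 * (e / 4)" using e by simp
      moreover have "ennreal (2 * (e / 4)) = ennreal 2 * ennreal (e / 4)" by (rule ennreal_mult') simp
      then have "ennreal (2 * (e / 4)) = 2 * ennreal (e / 4)" by (simp only: ennreal_numeral)
      ultimately show ?thesis by (simp only: ennreal_plus)
    qed
    also have "2 * (e / 4) + 2 * (e / 4) = e" by simp
    finally show "L2sq (\<lambda>x. u x - v x) \<le> 0 + ennreal e" by simp
  qed
  then have "L2sq (\<lambda>x. u x - v x) = 0" by simp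
  then have "AE x in lebesgue. u x - v x = 0" by (subst (asm) L2sq_eq_0_iff) auto
  then show ?thesis by auto
qed

end

theorem theorem2p8:
  fixes \<rho> :: "(real \<Rightarrow> ennreal) \<Rightarrow> ennreal"
    and \<psi> \<psi>' :: "real \<Rightarrow> complex"
    and W :: "real \<Rightarrow> real"
  assumes "banach_function_norm \<rho>"
    and "X_separable \<rho>"
    and "maximal_bounded \<rho>"
    and "maximal_bounded (assoc_norm \<rho>)"
    and "orthonormal_wavelet \<psi>"
    and "\<forall>x. (\<psi> has_vector_derivative \<psi>' x) (at x)"
    and "radial_decr_L1_majorant W \<psi>"
    and "radial_decr_L1_majorant W \<psi>'"
    and "set_integrable lborel {0..} (\<lambda>s. s * W s)"
  shows "\<exists>C::real. \<forall>\<epsilon> \<in> sign_seqs. \<exists>T :: (real \<Rightarrow> complex) \<Rightarrow> (real \<Rightarrow> complex).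
           (\<forall>f. inX \<rho> f \<longrightarrow> inX \<rho> (T f))
         \<and> (\<forall>f g (a::complex) b. inX \<rho> f \<and> inX \<rho> g \<longrightarrow>
              (AE x in lebesgue. T (\<lambda>y. a * f y + b * g y) x = a * T f x + b * T g x))
         \<and> (\<forall>f. inX \<rho> f \<longrightarrow> normX \<rho> (T f) \<le> C * normX \<rho> f)
         \<and> (\<forall>f. smooth_compact f \<longrightarrow> wavelet_op_value \<psi> \<epsilon> f (T f))"
proof -
  interpret function_space \<rho> by unfold_locales fact
  interpret orthonormal_decaying_wavelet \<psi> \<psi>' W
    using assms by unfold_locales auto
  \<comment> \<open>A negative constant acts as 0 under \<open>ennreal\<close>; passing to the
    positive part provides the sign that later estimates use.\<close>
  have pos: "ennreal C = ennreal (max 0 C)" for C by (simp add: max_def ennreal_neg)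
  obtain C1 where C1: "\<And>f. inX \<rho> f \<Longrightarrow> \<rho> (maximal_op (\<lambda>x. ennreal (cmod (f x)))) \<le> ennreal (max 0 C1) * \<rho> (\<lambda>x. ennreal (cmod (f x)))"
    using assms(3) unfolding maximal_bounded_def by (metis pos)
  obtain C2 where C2: "\<And>f. inX (assoc_norm \<rho>) f \<Longrightarrow> assoc_norm \<rho> (maximal_op (\<lambda>x. ennreal (cmod (f x)))) \<le> ennreal (max 0 C2) * assoc_norm \<rho> (\<lambda>x. ennreal (cmod (f x)))"
    using assms(4) unfolding maximal_bounded_def by (metis pos)
  define C where "C = 6 * smooth_kernel.osc_const kernel_const * max 0 C1 * max 0 C2"
  \<comment> \<open>Positivity of \<open>osc_const\<close> is a fact inside the kernel locale; the
    kernel of the empty index set supplies an instance with the right \<open>B\<close>.\<close>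
  have C0: "C \<ge> 0"
  proof -
    have "(\<lambda>_. 1) \<in> sign_seqs" by (simp add: sign_seqs_def)
    then interpret smooth_kernel "multiplier_kernel (\<lambda>_. 1) {}" kernel_const "\<Sum>i\<in>({} :: (int \<times> int) set). (2 powr (real_of_int (fst i) / 2) * W 0)\<^sup>2"
      by (intro smooth_kernel_multiplier) auto
    show ?thesis unfolding C_def using osc_const_pos by simp
  qed
  show ?thesis
  proof (intro exI[of _ C] ballI)
    fix \<epsilon> assume \<epsilon>: "\<epsilon> \<in> sign_seqs"
    \<comment> \<open>The operator is chosen on the whole core class and not only on test functions,
      since this class is the one shown to be dense.\<close>
    define T0 where "T0 f = (SOME g. wavelet_op_value \<psi> \<epsilon> f g)" for f
    have T0: "wavelet_op_value \<psi> \<epsilon> f (T0 f)" if f: "bounded_bounded_support f" for f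
      unfolding T0_def
    proof (rule someI_ex[of "wavelet_op_value \<psi> \<epsilon> f"])
      show "\<exists>g. wavelet_op_value \<psi> \<epsilon> f g"
        by (rule wavelet_op_value_exists[OF \<epsilon> in_L2_bounded_bounded_support[OF f]]) blast
    qed
    have T0m: "T0 f \<in> borel_measurable lebesgue" if "bounded_bounded_support f" for f
      using T0[OF that] by (simp add: wavelet_op_value_iff in_L2_iff)
    \<comment> \<open>The finite partial sums obey the bound with a common constant and converge
      a.e. to some value \<open>g\<close>; Fatou passes the bound to \<open>g\<close>, which agrees
      with \<open>T0 f\<close> a.e.\<close>
    have T0b: "X_norm (T0 f) \<le> ennreal C * X_norm f" if f: "bounded_bounded_support f" for f
    proof -
      let ?c = "\<lambda>i. of_real (\<epsilon> i) * l2_inner f (wavs i)"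
      obtain g H where g: "wavelet_op_value \<psi> \<epsilon> f g" and H: "\<And>n. finite (H n)"
        and lim: "AE x in lebesgue. (\<lambda>n. comb ?c (H n) x) \<longlonglongrightarrow> g x"
        by (rule wavelet_op_value_exists[OF \<epsilon> in_L2_bounded_bounded_support[OF f]]) (rule that; assumption)
      have gm: "g \<in> borel_measurable lebesgue" using g by (simp add: wavelet_op_value_iff in_L2_iff)
      note [measurable] = gm in_L2_measurable[OF comb_L2[OF H]]
      have "X_norm g \<le> ennreal C * X_norm f"
        unfolding X_norm_def[of g]
      proof (rule Fatou[of "\<lambda>n x. ennreal (cmod (comb ?c (H n) x))"])
        show "AE x in lebesgue. (\<lambda>n. ennreal (cmod (comb ?c (H n) x))) \<longlonglongrightarrow> ennreal (cmod (g x))"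
          using lim by eventually_elim (intro tendsto_ennrealI tendsto_norm)
        fix n
        note sk = smooth_kernel_multiplier[OF H[of n] \<epsilon>]
        have "X_norm (smooth_kernel.T (multiplier_kernel \<epsilon> (H n)) f) \<le> ennreal C * X_norm f"
          unfolding C_def by (rule smooth_kernel_bounded[OF sk C1 C2 _ _ f]) auto
        then show "\<rho> (\<lambda>x. ennreal (cmod (comb ?c (H n) x))) \<le> ennreal C * X_norm f"
          unfolding X_norm_def smooth_kernel.T_def[OF sk] integral_multiplier_kernel[OF f] .
      qed measurable
      moreover have "X_norm (T0 f) = X_norm g"
        by (rule X_norm_cong_AE[OF T0m[OF f] gm wavelet_op_value_unique[OF T0[OF f] g]])
      ultimately show ?thesis by simp
    qed
    have T0l: "AE x in lebesgue. T0 (\<lambda>y. a * f y + b * g y) x = a * T0 f x + b * T0 g x"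
      if f: "bounded_bounded_support f" and g: "bounded_bounded_support g" for f g a b
    proof (rule wavelet_op_value_unique)
      show "wavelet_op_value \<psi> \<epsilon> (\<lambda>y. a * f y + b * g y) (T0 (\<lambda>y. a * f y + b * g y))"
        by (intro T0 bounded_bounded_support_add bounded_bounded_support_cmult f g)
      show "wavelet_op_value \<psi> \<epsilon> (\<lambda>y. a * f y + b * g y) (\<lambda>x. a * T0 f x + b * T0 g x)"
        by (intro wavelet_op_value_linear in_L2_bounded_bounded_support T0 f g)
    qed
    obtain T where T: "\<And>f. inX \<rho> f \<Longrightarrow> inX \<rho> (T f)"
      "\<And>f g a b. inX \<rho> f \<Longrightarrow> inX \<rho> g \<Longrightarrow> AE x in lebesgue. T (\<lambda>y. a * f y + b * g y) x = a * T f x + b * T g x"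
      "\<And>f. inX \<rho> f \<Longrightarrow> X_norm (T f) \<le> ennreal C * X_norm f"
      "\<And>f. bounded_bounded_support f \<Longrightarrow> T f = T0 f"
      by (rule bounded_extension[OF assms(2) C0 T0m T0b T0l]) blast+
    show "\<exists>T. (\<forall>f. inX \<rho> f \<longrightarrow> inX \<rho> (T f))
         \<and> (\<forall>f g a b. inX \<rho> f \<and> inX \<rho> g \<longrightarrow>
              (AE x in lebesgue. T (\<lambda>y. a * f y + b * g y) x = a * T f x + b * T g x))
         \<and> (\<forall>f. inX \<rho> f \<longrightarrow> normX \<rho> (T f) \<le> C * normX \<rho> f)
         \<and> (\<forall>f. smooth_compact f \<longrightarrow> wavelet_op_value \<psi> \<epsilon> f (T f))"
    proof (intro exI[of _ T] conjI allI impI)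
      show "normX \<rho> (T f) \<le> C * normX \<rho> f" if f: "inX \<rho> f" for f
      proof -
        have "ennreal (normX \<rho> (T f)) \<le> ennreal C * ennreal (normX \<rho> f)"
          using T(3)[OF f] by (simp add: ennreal_normX f T(1))
        moreover have "0 \<le> normX \<rho> f" by (simp add: normX_def)
        ultimately show ?thesis using C0 by (simp add: ennreal_mult[symmetric])
      qed
      show "wavelet_op_value \<psi> \<epsilon> f (T f)" if "smooth_compact f" for f
        using smooth_compact_bounded_bounded_support[OF that] T0 T(4) by simp
    qed (use T in blast)+
  qed
qed

end
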